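(* For every Hausdorff space $X$ the following are equivalent: (1) $X$ is homeomorphic to the end space of a graph; (2) $X$ is homeomorphic to the ray space $\mathcal{R}(T)$ of a special order tree $T$; (3) $X$ admits a nested clopen subbase that is noetherian, hereditarily complete and $\sigma$-disjoint.
   Context: End spaces: In a graph $G$, a (graph) ray is a one-way infinite path. Two graph rays are equivalent if for every finite set $S$ of vertices they have tails in the same component of $G-S$. The equivalence classes are the ends of $G$, and $\Omega(G)$ is the set of ends. For a finite vertex set $S$ and an end $\omega$, let $C(S,\omega)$ be the component of $G-S$ containing a tail of every ray in $\omega$, and let $\Omega(S,\omega)$ be the set of ends $\omega'$ with $C(S,\omega')=C(S,\omega)$. The end space of $G$ is $\Omega(G)$ with the topology whose basis consists of all sets $\Omega(S,\omega)$. Trees: An (order) tree is a partially ordered set $T$ with a unique minimal element such that the set of predecessors of any element is well-ordered. It is special if it is a union of countably many antichains. Distinct limit nodes may have the same set of strict predecessors. A path in $T$ is a nonempty down-closed chain. A ray of $T$ is a path without maximal element. The ray space $\mathcal{R}(T)$ is the set of all rays of $T$ with the subspace topology inherited from $2^T$ (product topology) when rays are identified with their characteristic functions; that is, the topology generated by declaring all sets $[t]=\{x\in\mathcal{R}(T): t\in x\}$, $t\in T$, to be clopen. Subbases: A collection $\mathcal{A}$ of subsets of a topological space $(X,\tau)$ is - a clopen subbase for $X$ if $\tau$ is the smallest topology on $X$ containing all elements of $\mathcal{A}$ as clopen subsets (equivalently, $\mathcal{A}\cup\{X\setminus A: A\in\mathcal{A}\}$ is an open subbase); - nested if for all $A,B\in\mathcal{A}$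 with $A\cap B\neq\emptyset$ we have $A\subseteq B$ or $B\subseteq A$; - noetherian if every $\subseteq$-increasing sequence of elements of $\mathcal{A}$ is eventually constant; - centered if every nonempty finite subfamily of $\mathcal{A}$ has nonempty intersection; - complete if every nonempty centered subfamily of $\mathcal{A}$ has nonempty intersection; - hereditarily complete if for every closed subspace $Y\subseteq X$ the collection $\{A\cap Y: A\in\mathcal{A}\}$ is complete; - $\sigma$-disjoint if $\mathcal{A}$ is a countable union of subcollections each consisting of pairwise disjoint sets. *)

theory Defs
  imports "HOL-Analysis.Analysis"
begin

section \<open>End spaces of graphs\<close>

definition simple_graph :: "'v set \<Rightarrow> 'v set set \<Rightarrow> bool" where
  "simple_graph V E \<longleftrightarrow> (\<forall>e\<in>E. \<exists>u\<in>V. \<exists>v\<in>V. u \<noteq> v \<and> e = {u, v})"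

text \<open>A one-way infinite path has a unique first vertex, so it is the same thing as an injective
  sequence of successively adjacent vertices.\<close>

definition graph_rays :: "'v set \<Rightarrow> 'v set set \<Rightarrow> (nat \<Rightarrow> 'v) set" where
  "graph_rays V E = {x. range x \<subseteq> V \<and> inj x \<and> (\<forall>n. {x n, x (Suc n)} \<in> E)}"

definition adj_avoiding :: "'v set set \<Rightarrow> 'v set \<Rightarrow> 'v rel" where
  "adj_avoiding E S = {(u, v). {u, v} \<in> E \<and> u \<notin> S \<and> v \<notin> S}"

definition components_avoiding :: "'v set \<Rightarrow> 'v set set \<Rightarrow> 'v set \<Rightarrow> 'v set set" where
  "components_avoiding V E S =
     {{v \<in> V - S. (u, v) \<in> (adj_avoiding E S)\<^sup>*} | u. u \<in> V - S}"

definition has_tail_in :: "(nat \<Rightarrow> 'v) \<Rightarrow> 'v set \<Rightarrow> bool" where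
  "has_tail_in x C \<longleftrightarrow> (\<exists>N. x ` {N..} \<subseteq> C)"

definition ray_equiv :: "'v set \<Rightarrow> 'v set set \<Rightarrow> (nat \<Rightarrow> 'v) rel" where
  "ray_equiv V E = {(x, y). x \<in> graph_rays V E \<and> y \<in> graph_rays V E \<and>
     (\<forall>S. finite S \<and> S \<subseteq> V \<longrightarrow>
        (\<exists>C \<in> components_avoiding V E S. has_tail_in x C \<and> has_tail_in y C))}"

definition graph_ends :: "'v set \<Rightarrow> 'v set set \<Rightarrow> (nat \<Rightarrow> 'v) set set" where
  "graph_ends V E = graph_rays V E // ray_equiv V E"

definition end_component ::
    "'v set \<Rightarrow> 'v set set \<Rightarrow> 'v set \<Rightarrow> (nat \<Rightarrow> 'v) set \<Rightarrow> 'v set" where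
  "end_component V E S \<omega> =
     (THE C. C \<in> components_avoiding V E S \<and> (\<forall>x\<in>\<omega>. has_tail_in x C))"

definition ends_in_same_component ::
    "'v set \<Rightarrow> 'v set set \<Rightarrow> 'v set \<Rightarrow> (nat \<Rightarrow> 'v) set \<Rightarrow> (nat \<Rightarrow> 'v) set set" where
  "ends_in_same_component V E S \<omega> =
     {\<omega>' \<in> graph_ends V E. end_component V E S \<omega>' = end_component V E S \<omega>}"

definition end_space :: "'v set \<Rightarrow> 'v set set \<Rightarrow> (nat \<Rightarrow> 'v) set topology" where
  "end_space V E = topology_generated_by
     {ends_in_same_component V E S \<omega> | S \<omega>. finite S \<and> S \<subseteq> V \<and> \<omega> \<in> graph_ends V E}"


section \<open>Ray spaces of order trees\<close>

definition order_tree :: "'t set \<Rightarrow> 't rel \<Rightarrow> bool" where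
  "order_tree T r \<longleftrightarrow>
     partial_order_on T r \<and>
     (\<exists>!m. m \<in> T \<and> (\<forall>s\<in>T. (s, m) \<in> r \<longrightarrow> s = m)) \<and>
     (\<forall>t\<in>T. well_order_on (underS r t) (Restr r (underS r t)))"

definition order_antichain :: "'t rel \<Rightarrow> 't set \<Rightarrow> bool" where
  "order_antichain r A \<longleftrightarrow> (\<forall>s\<in>A. \<forall>t\<in>A. (s, t) \<in> r \<longrightarrow> s = t)"

definition special_tree :: "'t set \<Rightarrow> 't rel \<Rightarrow> bool" where
  "special_tree T r \<longleftrightarrow>
     order_tree T r \<and> (\<exists>A :: nat \<Rightarrow> 't set. T = (\<Union>n. A n) \<and> (\<forall>n. order_antichain r (A n)))"

definition tree_paths :: "'t set \<Rightarrow> 't rel \<Rightarrow> 't set set" where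
  "tree_paths T r =
     {P. P \<noteq> {} \<and> P \<subseteq> T \<and> P \<in> Chains r \<and> (\<forall>t\<in>P. under r t \<subseteq> P)}"

definition tree_rays :: "'t set \<Rightarrow> 't rel \<Rightarrow> 't set set" where
  "tree_rays T r = {P \<in> tree_paths T r. \<not> (\<exists>m\<in>P. \<forall>t\<in>P. (m, t) \<in> r \<longrightarrow> t = m)}"

text \<open>The power \<open>2\<^sup>T\<close> is the library's product topology, whose points are functions that are
  \<open>undefined\<close> outside \<open>T\<close>; hence the restriction of the characteristic functions.\<close>

definition ray_space :: "'t set \<Rightarrow> 't rel \<Rightarrow> 't set topology" where
  "ray_space T r = pullback_topology (tree_rays T r) (\<lambda>x. restrict (\<lambda>t. t \<in> x) T)
     (product_topology (\<lambda>_. discrete_topology (UNIV :: bool set)) T)"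


section \<open>Clopen subbases\<close>

definition clopen_subbase :: "'a topology \<Rightarrow> 'a set set \<Rightarrow> bool" where
  "clopen_subbase X \<A> \<longleftrightarrow>
     (\<forall>A\<in>\<A>. openin X A \<and> closedin X A) \<and>
     (\<forall>Y. topspace Y = topspace X \<and> (\<forall>A\<in>\<A>. openin Y A \<and> closedin Y A) \<longrightarrow>
        (\<forall>U. openin X U \<longrightarrow> openin Y U))"

definition nested :: "'a set set \<Rightarrow> bool" where
  "nested \<A> \<longleftrightarrow> (\<forall>A\<in>\<A>. \<forall>B\<in>\<A>. A \<inter> B \<noteq> {} \<longrightarrow> A \<subseteq> B \<or> B \<subseteq> A)"

definition noetherian :: "'a set set \<Rightarrow> bool" where
  "noetherian \<A> \<longleftrightarrow>
     (\<forall>A :: nat \<Rightarrow> 'a set. range A \<subseteq> \<A> \<and> incseq A \<longrightarrow> (\<exists>N. \<forall>n\<ge>N. A n = A N))"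

definition centered :: "'a set set \<Rightarrow> bool" where
  "centered \<A> \<longleftrightarrow> (\<forall>\<B>\<subseteq>\<A>. finite \<B> \<and> \<B> \<noteq> {} \<longrightarrow> \<Inter>\<B> \<noteq> {})"

definition complete_family :: "'a set set \<Rightarrow> bool" where
  "complete_family \<A> \<longleftrightarrow> (\<forall>\<B>\<subseteq>\<A>. \<B> \<noteq> {} \<and> centered \<B> \<longrightarrow> \<Inter>\<B> \<noteq> {})"

definition hereditarily_complete :: "'a topology \<Rightarrow> 'a set set \<Rightarrow> bool" where
  "hereditarily_complete X \<A> \<longleftrightarrow>
     (\<forall>Y. closedin X Y \<longrightarrow> complete_family {A \<inter> Y | A. A \<in> \<A>})"

definition sigma_disjoint :: "'a set set \<Rightarrow> bool" where
  "sigma_disjoint \<A> \<longleftrightarrow>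
     (\<exists>D :: nat \<Rightarrow> 'a set set. \<A> = (\<Union>n. D n) \<and> (\<forall>n. disjoint (D n)))"


section \<open>Types for the existentially quantified graphs and trees\<close>

text \<open>HOL cannot quantify over types inside a formula, so the vertices of the graph and the nodes
  of the tree are drawn from types with a summand \<open>'b\<close> that the theorem instantiates by a type
  variable not constrained by the space: every graph and every tree, on any type whatsoever, has
  an isomorphic copy there. The summand \<open>'a set \<times> nat\<close>, where \<open>'a\<close> is the type of the points of
  the space, leaves enough room for the graphs and trees that have to be constructed.\<close>

type_synonym ('a, 'b) ample = "'b + 'a set \<times> nat"

end

theory Submission
  imports Defs
begin

text \<open>A nested subbase is itself a tree under reverse inclusion. To make its points correspond to rays, a
  sequence of copies is inserted above each member that is the smallest one around some point;
  hereditary completeness says precisely that no further rays arise. Conversely, the sets of rays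
  through a node form such a subbase, and a special tree carries a graph whose ends are its rays.

  For the end space of a graph, decompose the vertex set transfinitely: remove from each connected
  piece \<open>C\<close> a connected core and pass to the components of the remainder, and pass to the components
  of the intersection along chains without least element. Along such a chain the removed cores contain
  a ray. If the outer neighbourhood of \<open>C\<close> is infinite, it accumulates at a unique end; the core then
  contains the vertices of \<open>C\<close> dominating that end and a maximal disjoint family of rays of \<open>C\<close> in
  that end, so that by the star-comb lemma the components of the remainder have finite neighbourhoods.
  The ends in such components, grouped by their neighbourhood where \<open>C\<close> is the limit of a chain, are
  the members of the subbase.\<close>

section \<open>Clopen subbases\<close>

text \<open>Having a tail in a vertex set is a property of the end, not only of the ray, once the
  set has a finite outer neighbourhood; the ends concerned then form a clopen set. Limit pieces have
  infinite neighbourhoods and cannot be members themselves, so finite neighbourhoods must be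
  regained one step below them. The grouping answers a finiteness problem. Infinitely many
  components below one limit piece may avoid the side of its end, yet a basic neighbourhood of that
  end must exclude them all by finitely many members. Their neighbourhoods lie in one finite set, so
  finitely many groups suffice. Countability is the second obstacle. A colouring of the non-limit
  pieces by natural numbers that separates comparable ones gives sigma-disjointness, and it gives
  every chain without least element a countable cofinal sequence along which a ray can be built. In
  the graph on a special tree a node is joined to a predecessor whose antichain index is smaller
  than all indices in between; this keeps neighbourhoods of strict up-sets finite and intervals
  connected.\<close>

lemma clopen_subbaseD:
  assumes "clopen_subbase X \<A>" "A \<in> \<A>"
  shows "openin X A" "closedin X A" "A \<subseteq> topspace X"
proof -
  show "openin X A" "closedin X A" using assms unfolding clopen_subbase_def by blast+
  then show "A \<subseteq> topspace X" by (simp add: openin_subset)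
qed

text \<open>Minimality is tested against a single topology, the one generated by the members and
  their complements; induction over its generation yields the finite intersections. In this local
  form the notion can be verified and transported point by point.\<close>

lemma clopen_subbase_iff:
  "clopen_subbase X \<A> \<longleftrightarrow>
     (\<forall>A\<in>\<A>. openin X A \<and> closedin X A) \<and>
     (\<forall>U x. openin X U \<and> x \<in> U \<longrightarrow> (\<exists>F G. finite F \<and> finite G \<and> F \<subseteq> \<A> \<and> G \<subseteq> \<A> \<and>
        x \<in> topspace X \<inter> \<Inter>F - \<Union>G \<and> topspace X \<inter> \<Inter>F - \<Union>G \<subseteq> U))"
    (is "_ \<longleftrightarrow> ?clopen \<and> ?loc")
proof (intro iffI conjI)
  assume X: "clopen_subbase X \<A>"
  then show ?clopen unfolding clopen_subbase_def by blast
  \<comment> \<open>The whole space is added so that the generated topology keeps its carrier even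
    if \<open>\<A>\<close> is empty.\<close>
  define \<S> where "\<S> = insert (topspace X) (\<A> \<union> (\<lambda>A. topspace X - A) ` \<A>)"
  define Y where "Y = topology_generated_by \<S>"
  have sub: "A \<subseteq> topspace X" if "A \<in> \<A>" for A
    using that X clopen_subbaseD(3) by blast
  have tY: "topspace Y = topspace X"
    unfolding Y_def topology_generated_by_topspace \<S>_def using sub by auto
  have "openin Y A \<and> closedin Y A" if "A \<in> \<A>" for A
  proof
    show "openin Y A"
      using that unfolding Y_def by (auto simp: \<S>_def intro: topology_generated_by_Basis)
    have "openin Y (topspace X - A)"
      using that unfolding Y_def by (auto simp: \<S>_def intro: topology_generated_by_Basis)
    then show "closedin Y A"
      using sub[OF that] by (simp add: closedin_def tY)
  qed
  then have XY: "openin Y U" if "openin X U" for U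
    using X tY that unfolding clopen_subbase_def by blast
  have *: "\<exists>F G. finite F \<and> finite G \<and> F \<subseteq> \<A> \<and> G \<subseteq> \<A> \<and>
        x \<in> topspace X \<inter> \<Inter>F - \<Union>G \<and> topspace X \<inter> \<Inter>F - \<Union>G \<subseteq> U"
    if "generate_topology_on \<S> U" "x \<in> U" for U x
    using that
  proof induction
    case (Int a b)
    obtain F G where 1: "finite F \<and> finite G \<and> F \<subseteq> \<A> \<and> G \<subseteq> \<A> \<and>
        x \<in> topspace X \<inter> \<Inter>F - \<Union>G \<and> topspace X \<inter> \<Inter>F - \<Union>G \<subseteq> a"
      using Int by blast
    obtain F' G' where 2: "finite F' \<and> finite G' \<and> F' \<subseteq> \<A> \<and> G' \<subseteq> \<A> \<and>
        x \<in> topspace X \<inter> \<Inter>F' - \<Union>G' \<and> topspace X \<inter> \<Inter>F' - \<Union>G' \<subseteq> b"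
      using Int by blast
    show ?case
      by (rule exI[of _ "F \<union> F'"], rule exI[of _ "G \<union> G'"]) (use 1 2 in auto)
  next
    case (UN K)
    then obtain k where "k \<in> K" "x \<in> k" by auto
    with UN.IH[OF this] show ?case by (meson Sup_upper order_trans)
  next
    case (Basis s)
    then consider "s = topspace X" | "s \<in> \<A>" | A where "A \<in> \<A>" "s = topspace X - A"
      by (auto simp: \<S>_def)
    then show ?case
    proof cases
      case 1
      then show ?thesis using Basis by (intro exI[of _ "{}"]) auto
    next
      case 2
      then show ?thesis using Basis sub[OF 2]
        by (intro exI[of _ "{s}"] exI[of _ "{}"]) auto
    next
      case 3
      then show ?thesis using Basis by (intro exI[of _ "{}"] exI[of _ "{A}"]) auto
    qed
  qed simp
  show ?loc
    using * XY unfolding Y_def openin_topology_generated_by_iff by blast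
next
  assume *: "?clopen \<and> ?loc"
  have "openin Y U"
    if Y: "topspace Y = topspace X" "\<forall>A\<in>\<A>. openin Y A \<and> closedin Y A" and U: "openin X U" for Y U
  proof (subst openin_subopen, intro ballI)
    fix x assume "x \<in> U"
    then obtain F G where FG: "finite F" "finite G" "F \<subseteq> \<A>" "G \<subseteq> \<A>"
      "x \<in> topspace X \<inter> \<Inter>F - \<Union>G" "topspace X \<inter> \<Inter>F - \<Union>G \<subseteq> U"
      using * U by metis
    have "openin Y (\<Inter>(insert (topspace Y) F))"
      using FG(1,3) Y(2) by (intro openin_Inter) auto
    moreover have "closedin Y (\<Union>G)"
      using FG Y by (intro closedin_Union) auto
    ultimately have "openin Y (\<Inter>(insert (topspace Y) F) - \<Union>G)"
      by (rule openin_diff)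
    with FG show "\<exists>T. openin Y T \<and> x \<in> T \<and> T \<subseteq> U"
      by (intro exI[of _ "\<Inter>(insert (topspace Y) F) - \<Union>G"]) (auto simp: Y)
  qed
  with * show "clopen_subbase X \<A>" unfolding clopen_subbase_def by blast
qed

lemma continuous_map_clopen_subbase:
  assumes Y: "clopen_subbase Y \<B>"
    and f: "\<And>x. x \<in> topspace X \<Longrightarrow> f x \<in> topspace Y"
    and clopen: "\<And>B. B \<in> \<B> \<Longrightarrow> openin X {x \<in> topspace X. f x \<in> B} \<and> closedin X {x \<in> topspace X. f x \<in> B}"
  shows "continuous_map X Y f"
proof -
  have "openin X {x \<in> topspace X. f x \<in> U}" if U: "openin Y U" for U
  proof (subst openin_subopen, intro ballI)
    fix x assume "x \<in> {x \<in> topspace X. f x \<in> U}"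
    then have x: "x \<in> topspace X" "f x \<in> U" by auto
    obtain F G where FG: "finite F" "finite G" "F \<subseteq> \<B>" "G \<subseteq> \<B>"
      "f x \<in> topspace Y \<inter> \<Inter>F - \<Union>G" "topspace Y \<inter> \<Inter>F - \<Union>G \<subseteq> U"
      using Y U x unfolding clopen_subbase_iff by metis
    define pre where "pre B = {x \<in> topspace X. f x \<in> B}" for B
    have "openin X (\<Inter>(insert (topspace X) (pre ` F)))"
      using FG clopen by (intro openin_Inter) (auto simp: pre_def)
    moreover have "closedin X (\<Union>(pre ` G))"
      using FG clopen by (intro closedin_Union) (auto simp: pre_def)
    ultimately have "openin X (\<Inter>(insert (topspace X) (pre ` F)) - \<Union>(pre ` G))" (is "openin X ?T")
      by (rule openin_diff)
    moreover have "x \<in> ?T" using FG x by (auto simp: pre_def)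
    moreover have "?T \<subseteq> {x \<in> topspace X. f x \<in> U}"
    proof
      fix z assume z: "z \<in> ?T"
      then have "f z \<in> topspace Y \<inter> \<Inter>F - \<Union>G" using f by (auto simp: pre_def)
      then show "z \<in> {x \<in> topspace X. f x \<in> U}" using z FG by auto
    qed
    ultimately show "\<exists>T. openin X T \<and> x \<in> T \<and> T \<subseteq> {x \<in> topspace X. f x \<in> U}" by blast
  qed
  then show ?thesis using f by (auto simp: continuous_map_def)
qed

text \<open>Preimages of members under the bijection and under its inverse are again members, so
  continuity in both directions reduces to clopenness.\<close>

lemma homeomorphic_space_clopen_subbase:
  assumes X: "clopen_subbase X \<A>" and Y: "clopen_subbase Y \<B>"
    and f: "bij_betw f (topspace X) (topspace Y)" and im: "image f ` \<A> = \<B>"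
  shows "X homeomorphic_space Y"
proof -
  define g where "g = inv_into (topspace X) f"
  have g: "g y \<in> topspace X" "f (g y) = y" if "y \<in> topspace Y" for y
    using f that unfolding g_def by (auto simp: bij_betw_def inv_into_into f_inv_into_f)
  have fg: "f x \<in> topspace Y" "g (f x) = x" if "x \<in> topspace X" for x
    using f that unfolding g_def by (auto simp: bij_betw_def)
  have sX: "A \<subseteq> topspace X" if "A \<in> \<A>" for A
    using X that clopen_subbaseD(3) by blast
  have pre: "{x \<in> topspace X. f x \<in> f ` A} = A" if "A \<in> \<A>" for A
    using sX[OF that] fg by (auto) (metis subset_iff)
  have pre': "{y \<in> topspace Y. g y \<in> A} = f ` A" if "A \<in> \<A>" for A
    using sX[OF that] fg g by (force simp: image_iff)
  have "continuous_map X Y f"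
  proof (rule continuous_map_clopen_subbase[OF Y fg(1)])
    fix B assume "B \<in> \<B>"
    then obtain A where "A \<in> \<A>" "B = f ` A" using im by auto
    then show "openin X {x \<in> topspace X. f x \<in> B} \<and> closedin X {x \<in> topspace X. f x \<in> B}"
      using clopen_subbaseD[OF X] by (simp add: pre)
  qed
  moreover have "continuous_map Y X g"
  proof (rule continuous_map_clopen_subbase[OF X g(1)])
    fix A assume "A \<in> \<A>"
    then show "openin Y {y \<in> topspace Y. g y \<in> A} \<and> closedin Y {y \<in> topspace Y. g y \<in> A}"
      using clopen_subbaseD[OF Y] im by (auto simp add: pre')
  qed
  ultimately show ?thesis
    unfolding homeomorphic_space_def homeomorphic_maps_def using g fg by blast
qed

section \<open>Nested families and a chain criterion for hereditary completeness\<close>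

lemma nestedD: "nested \<A> \<Longrightarrow> A \<in> \<A> \<Longrightarrow> B \<in> \<A> \<Longrightarrow> x \<in> A \<Longrightarrow> x \<in> B \<Longrightarrow> A \<subseteq> B \<or> B \<subseteq> A"
  unfolding nested_def by blast

lemma finite_chain_Min:
  assumes "finite F" "F \<noteq> {}" "\<And>A B. A \<in> F \<Longrightarrow> B \<in> F \<Longrightarrow> A \<subseteq> B \<or> B \<subseteq> A"
  shows "\<exists>M\<in>F. \<forall>A\<in>F. M \<subseteq> A"
  using assms
proof (induction F rule: finite_ne_induct)
  case (insert A F)
  then obtain M where "M \<in> F" "\<forall>A\<in>F. M \<subseteq> A" by blast
  then show ?case using insert.prems by (metis insert_iff order_trans order_refl)
qed auto

text \<open>A centered family of traces on \<open>Y\<close> comes from a chain \<open>\<B>\<close>.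
  A least member of the chain settles the matter. Otherwise the point \<open>e\<close> given by
  \<open>lim\<close> is common to \<open>\<B>\<close>; if it lies outside \<open>Y\<close>, a basic
  neighbourhood of \<open>e\<close> misses \<open>Y\<close>, and deep in the chain its conditions
  can fail only inside \<open>\<Inter>\<B>\<close>. A point of \<open>Y\<close> that deep must
  therefore lie in \<open>\<Inter>\<B>\<close>.\<close>

lemma hereditarily_completeI:
  assumes sub: "clopen_subbase X \<A>" and nest: "nested \<A>"
    and lim: "\<And>\<B>. \<B> \<subseteq> \<A> \<Longrightarrow> \<B> \<noteq> {} \<Longrightarrow> {} \<notin> \<B> \<Longrightarrow> (\<And>A B. A \<in> \<B> \<Longrightarrow> B \<in> \<B> \<Longrightarrow> A \<subseteq> B \<or> B \<subseteq> A) \<Longrightarrow>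
        (\<And>B. B \<in> \<B> \<Longrightarrow> \<exists>B'\<in>\<B>. B' \<subset> B) \<Longrightarrow> \<exists>e\<in>\<Inter>\<B>. \<forall>A\<in>\<A>. e \<in> A \<longrightarrow> \<not> A \<subseteq> \<Inter>\<B>"
  shows "hereditarily_complete X \<A>"
  unfolding hereditarily_complete_def complete_family_def
proof (intro allI impI)
  fix Y \<D>
  assume Y: "closedin X Y" and D: "\<D> \<subseteq> {A \<inter> Y |A. A \<in> \<A>}" and "\<D> \<noteq> {} \<and> centered \<D>"
  then have ne: "\<D> \<noteq> {}" and cen: "\<And>\<F>. \<F> \<subseteq> \<D> \<Longrightarrow> finite \<F> \<Longrightarrow> \<F> \<noteq> {} \<Longrightarrow> \<Inter>\<F> \<noteq> {}"
    unfolding centered_def by blast+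
  define \<B> where "\<B> = {A \<in> \<A>. A \<inter> Y \<in> \<D>}"
  have int: "\<exists>y\<in>Y. y \<in> A \<and> y \<in> B" if "A \<in> \<B>" "B \<in> \<B>" for A B
    using cen[of "{A \<inter> Y, B \<inter> Y}"] that unfolding \<B>_def by auto
  have chain: "A \<subseteq> B \<or> B \<subseteq> A" if "A \<in> \<B>" "B \<in> \<B>" for A B
    using int[OF that] nestedD[OF nest] that unfolding \<B>_def by blast
  have DB: "\<exists>B\<in>\<B>. d = B \<inter> Y" if "d \<in> \<D>" for d
    using that D unfolding \<B>_def by blast
  have Bne: "\<B> \<noteq> {}" using DB ne by blast
  show "\<Inter>\<D> \<noteq> {}"
  proof (cases "\<exists>B\<in>\<B>. \<forall>B'\<in>\<B>. \<not> B' \<subset> B")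
    case True
    then obtain B where B: "B \<in> \<B>" "\<And>B'. B' \<in> \<B> \<Longrightarrow> \<not> B' \<subset> B" by blast
    obtain y where y: "y \<in> B" "y \<in> Y" using int B by blast
    have "y \<in> d" if "d \<in> \<D>" for d
      using DB[OF that] chain B y by blast
    then show ?thesis by blast
  next
    case False
    have "{} \<notin> \<B>" using int by blast
    have "\<exists>e\<in>\<Inter>\<B>. \<forall>A\<in>\<A>. e \<in> A \<longrightarrow> \<not> A \<subseteq> \<Inter>\<B>"
    proof (rule lim[of \<B>, OF _ Bne _ chain])
      show "\<B> \<subseteq> \<A>" unfolding \<B>_def by blast
      show "{} \<notin> \<B>" by fact
      show "\<exists>B'\<in>\<B>. B' \<subset> B" if "B \<in> \<B>" for B using False that by meson
    qed
    then obtain e where e: "e \<in> \<Inter>\<B>" and e': "\<forall>A\<in>\<A>. e \<in> A \<longrightarrow> \<not> A \<subseteq> \<Inter>\<B>"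
      by (rule bexE)
    show ?thesis
    proof (cases "e \<in> Y")
      case True
      then show ?thesis using DB e by blast
    next
      case False
      have "openin X (topspace X - Y)" "e \<in> topspace X - Y"
        using Y False e Bne clopen_subbaseD(3)[OF sub] unfolding \<B>_def
        by (auto simp: closedin_def)
      then obtain F G where FG: "finite F" "finite G" "F \<subseteq> \<A>" "G \<subseteq> \<A>"
        "e \<in> topspace X \<inter> \<Inter>F - \<Union>G" "topspace X \<inter> \<Inter>F - \<Union>G \<subseteq> topspace X - Y"
        using sub unfolding clopen_subbase_iff by metis
      \<comment> \<open>\<open>A\<close> contains \<open>e\<close> but is not inside
        \<open>\<Inter>\<B>\<close>, so nestedness puts some chain member inside
        \<open>A\<close>.\<close>
      have 1: "\<exists>B\<in>\<B>. B \<subseteq> A" if "A \<in> F" for A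
      proof -
        have "A \<in> \<A>" "e \<in> A" using that FG by auto
        then obtain B where "B \<in> \<B>" "\<not> A \<subseteq> B" using e' by (meson Inter_greatest)
        then show ?thesis using e nestedD[OF nest, of A B e] \<open>A \<in> \<A>\<close> \<open>e \<in> A\<close> \<B>_def by auto
      qed
      then obtain b where b: "\<And>A. A \<in> F \<Longrightarrow> b A \<in> \<B> \<and> b A \<subseteq> A" by metis
      \<comment> \<open>Every chain member contains \<open>e\<close> and \<open>A\<close> does not,
        so each chain member that meets \<open>A\<close> must contain it.\<close>
      have 2: "\<exists>B\<in>\<B>. A \<inter> B = {} \<or> A \<subseteq> \<Inter>\<B>" if "A \<in> G" for A
      proof -
        have "A \<in> \<A>" "e \<notin> A" using that FG by auto
        have "A \<subseteq> B" if "B \<in> \<B>" "A \<inter> B \<noteq> {}" for B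
          using that nest \<open>A \<in> \<A>\<close> \<open>e \<notin> A\<close> e unfolding nested_def \<B>_def by blast
        then show ?thesis using Bne by blast
      qed
      then obtain c where c: "\<And>A. A \<in> G \<Longrightarrow> c A \<in> \<B> \<and> (A \<inter> c A = {} \<or> A \<subseteq> \<Inter>\<B>)" by metis
      obtain B0 where "B0 \<in> \<B>" using Bne by blast
      \<comment> \<open>\<open>M\<close> is deep enough for all finitely many conditions at once;
        \<open>B0\<close> keeps the set nonempty when there are none.\<close>
      have "\<exists>M\<in>insert B0 (b ` F \<union> c ` G). \<forall>A\<in>insert B0 (b ` F \<union> c ` G). M \<subseteq> A"
      proof (rule finite_chain_Min)
        show "A \<subseteq> B \<or> B \<subseteq> A" if "A \<in> insert B0 (b ` F \<union> c ` G)" "B \<in> insert B0 (b ` F \<union> c ` G)" for A B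
        proof -
          have "insert B0 (b ` F \<union> c ` G) \<subseteq> \<B>" using b c \<open>B0 \<in> \<B>\<close> by auto
          then show ?thesis using that chain by (meson subsetD)
        qed
      qed (use FG in auto)
      then obtain M where M: "M \<in> insert B0 (b ` F \<union> c ` G)"
          "\<forall>A\<in>insert B0 (b ` F \<union> c ` G). M \<subseteq> A" by (rule bexE)
      have "M \<in> \<B>" using M(1) b c \<open>B0 \<in> \<B>\<close> by auto
      then obtain y where y: "y \<in> M" "y \<in> Y" using int by blast
      have "y \<in> A" if "A \<in> F" for A using b[OF that] M(2) that y(1) by auto
      then have "y \<in> \<Inter>F" by simp
      moreover have "y \<in> topspace X" using y Y closedin_subset by blast
      moreover have "y \<notin> topspace X \<inter> \<Inter>F - \<Union>G" using FG(6) y(2) by (meson DiffD2 subsetD)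
      ultimately obtain A where A: "A \<in> G" "y \<in> A" by auto
      then have "y \<in> c A" using M(2) y(1) by auto
      then have "y \<in> \<Inter>\<B>" using c[OF A(1)] A(2) by auto
      then show ?thesis using DB y by blast
    qed
  qed
qed

section \<open>Transport of subbases along homeomorphisms\<close>

lemma complete_family_image:
  assumes "complete_family \<D>" "inj_on g S" "\<And>D. D \<in> \<D> \<Longrightarrow> D \<subseteq> S"
  shows "complete_family (image g ` \<D>)"
  unfolding complete_family_def
proof (intro allI impI)
  fix \<B> assume "\<B> \<subseteq> image g ` \<D>" and B: "\<B> \<noteq> {} \<and> centered \<B>"
  then obtain \<C> where C: "\<C> \<subseteq> \<D>" "\<B> = image g ` \<C>" by (metis subset_imageE)
  have "centered \<C>"
    unfolding centered_def
  proof (intro allI impI)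
    fix \<F> assume F: "\<F> \<subseteq> \<C>" "finite \<F> \<and> \<F> \<noteq> {}"
    then have "image g ` \<F> \<subseteq> \<B>" "finite (image g ` \<F>)" "image g ` \<F> \<noteq> {}" using C by auto
    then obtain y where "y \<in> \<Inter>(image g ` \<F>)" using B unfolding centered_def by blast
    moreover obtain F0 where "F0 \<in> \<F>" using F by blast
    ultimately obtain x where x: "x \<in> F0" "y = g x" by blast
    have "x \<in> F'" if F': "F' \<in> \<F>" for F'
    proof -
      obtain x' where x': "x' \<in> F'" "y = g x'" using F' \<open>y \<in> _\<close> by blast
      have "x \<in> S" "x' \<in> S" using assms(3) F(1) C(1) F' \<open>F0 \<in> \<F>\<close> x x' by blast+
      then show ?thesis using x x' inj_onD[OF assms(2)] by metis
    qed
    then show "\<Inter>\<F> \<noteq> {}" by blast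
  qed
  then obtain x where "x \<in> \<Inter>\<C>"
    using assms(1) B C unfolding complete_family_def by (metis ex_in_conv image_is_empty)
  then show "\<Inter>\<B> \<noteq> {}" using C by blast
qed

lemma good_subbase_homeomorphic:
  assumes "X homeomorphic_space Y"
    and "clopen_subbase Y \<A>" "nested \<A>" "noetherian \<A>" "hereditarily_complete Y \<A>" "sigma_disjoint \<A>"
  shows "\<exists>\<A>'. clopen_subbase X \<A>' \<and> nested \<A>' \<and> noetherian \<A>' \<and>
            hereditarily_complete X \<A>' \<and> sigma_disjoint \<A>'"
proof -
  obtain f g where fg: "homeomorphic_maps X Y f g"
    using assms homeomorphic_space_def by blast
  then have gf: "\<And>x. x \<in> topspace X \<Longrightarrow> g (f x) = x \<and> f x \<in> topspace Y"
    "\<And>y. y \<in> topspace Y \<Longrightarrow> f (g y) = y \<and> g y \<in> topspace X"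
    by (auto simp: homeomorphic_maps_def continuous_map_def)
  have hom: "homeomorphic_map Y X g" "homeomorphic_map X Y f"
    using fg homeomorphic_map_maps homeomorphic_maps_sym by blast+
  have inj: "inj_on g (topspace Y)" using gf by (metis inj_onI)
  have sub: "A \<subseteq> topspace Y" if "A \<in> \<A>" for A
    using that assms clopen_subbaseD(3) by blast
  have fgA: "f ` g ` A = A" if "A \<in> \<A>" for A
    using gf sub[OF that] by (force simp: image_iff)
  let ?B = "image g ` \<A>"
  have "clopen_subbase X ?B"
    unfolding clopen_subbase_iff
  proof (intro conjI ballI allI impI)
    fix A' assume "A' \<in> ?B"
    then obtain A where A: "A \<in> \<A>" "A' = g ` A" by blast
    show "openin X A'" "closedin X A'"
      using clopen_subbaseD[OF assms(2) A(1)] homeomorphic_map_openness_eq[OF hom(1), of A]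
        homeomorphic_map_closedness_eq[OF hom(1), of A] unfolding A(2) by iprover+
  next
    fix U x assume U: "openin X U \<and> x \<in> U"
    then have x: "x \<in> topspace X" "U \<subseteq> topspace X" using openin_subset by blast+
    have "openin Y (f ` U)" "f x \<in> f ` U"
      using U hom homeomorphic_map_openness_eq by blast+
    then obtain F G where FG: "finite F" "finite G" "F \<subseteq> \<A>" "G \<subseteq> \<A>"
        "f x \<in> topspace Y \<inter> \<Inter>F - \<Union>G" "topspace Y \<inter> \<Inter>F - \<Union>G \<subseteq> f ` U"
      using assms(2) unfolding clopen_subbase_iff by metis
    have mem: "z \<in> g ` A \<longleftrightarrow> f z \<in> A" if "z \<in> topspace X" "A \<in> \<A>" for z A
      using that gf sub by (metis image_iff subsetD)
    have "x \<in> topspace X \<inter> \<Inter>(image g ` F) - \<Union>(image g ` G)"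
    proof -
      have "x \<in> g ` A" if "A \<in> F" for A using mem[OF x(1)] that FG by blast
      moreover have "x \<notin> g ` A" if "A \<in> G" for A using mem[OF x(1)] that FG by blast
      ultimately show ?thesis using x by blast
    qed
    moreover have "topspace X \<inter> \<Inter>(image g ` F) - \<Union>(image g ` G) \<subseteq> U"
    proof
      fix z assume z: "z \<in> topspace X \<inter> \<Inter>(image g ` F) - \<Union>(image g ` G)"
      then have zX: "z \<in> topspace X" by blast
      have "f z \<in> A" if "A \<in> F" for A
        using mem[OF zX, of A] z that FG(3) by auto
      moreover have "f z \<notin> A" if "A \<in> G" for A
        using mem[OF zX, of A] z that FG(4) by auto
      moreover have "f z \<in> topspace Y" using gf(1)[OF zX] by simp
      ultimately have "f z \<in> topspace Y \<inter> \<Inter>F - \<Union>G" by auto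
      then have "f z \<in> f ` U" by (rule subsetD[OF FG(6)])
      then show "z \<in> U" using gf x zX by (metis imageE subsetD)
    qed
    ultimately show "\<exists>F G. finite F \<and> finite G \<and> F \<subseteq> ?B \<and> G \<subseteq> ?B \<and>
        x \<in> topspace X \<inter> \<Inter>F - \<Union>G \<and> topspace X \<inter> \<Inter>F - \<Union>G \<subseteq> U"
      using FG(1-4) by (intro exI[of _ "image g ` F"] exI[of _ "image g ` G"] conjI finite_imageI image_mono)
  qed
  moreover have "nested ?B"
    unfolding nested_def
  proof (intro ballI impI)
    fix A' B' assume "A' \<in> ?B" "B' \<in> ?B" and ne: "A' \<inter> B' \<noteq> {}"
    then obtain A B where AB: "A \<in> \<A>" "B \<in> \<A>" "A' = g ` A" "B' = g ` B" by auto
    then have "g ` (A \<inter> B) = A' \<inter> B'" using inj_on_image_Int[OF inj] sub by blast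
    then have "A \<inter> B \<noteq> {}" using ne by auto
    then show "A' \<subseteq> B' \<or> B' \<subseteq> A'" using AB assms unfolding nested_def by (metis image_mono)
  qed
  moreover have "noetherian ?B"
    unfolding noetherian_def
  proof (intro allI impI)
    fix B :: "nat \<Rightarrow> _" assume B: "range B \<subseteq> ?B \<and> incseq B"
    then have "\<forall>n. \<exists>A\<in>\<A>. B n = g ` A" by blast
    then obtain A where A: "\<And>n. A n \<in> \<A> \<and> B n = g ` A n" by metis
    then have "A n = f ` B n" for n using fgA by metis
    then have "incseq A" using B by (simp add: incseq_def image_mono)
    then show "\<exists>N. \<forall>n\<ge>N. B n = B N"
      using assms(4) A unfolding noetherian_def by (metis image_subsetI)
  qed
  moreover have "hereditarily_complete X ?B"
    unfolding hereditarily_complete_def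
  proof (intro allI impI)
    fix Z assume Z: "closedin X Z"
    then have "closedin Y (f ` Z)" using hom homeomorphic_map_closedness_eq by blast
    then have "complete_family {A \<inter> f ` Z |A. A \<in> \<A>}"
      using assms(5) unfolding hereditarily_complete_def by blast
    then have "complete_family (image g ` {A \<inter> f ` Z |A. A \<in> \<A>})"
      by (rule complete_family_image[OF _ inj]) (use sub in blast)
    moreover have "g ` (A \<inter> f ` Z) = g ` A \<inter> Z" if "A \<in> \<A>" for A
    proof (intro equalityI subsetI)
      fix z assume "z \<in> g ` (A \<inter> f ` Z)"
      then obtain w where w: "f w \<in> A" "w \<in> Z" "z = g (f w)" by blast
      then have "z = w" using gf(1)[of w] closedin_subset[OF Z] by auto
      then show "z \<in> g ` A \<inter> Z" using w by blast
    next
      fix z assume "z \<in> g ` A \<inter> Z"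
      then obtain a where a: "a \<in> A" "z = g a" "z \<in> Z" by blast
      then have "f z = a" using gf(2)[of a] sub[OF that] by auto
      then show "z \<in> g ` (A \<inter> f ` Z)" using a by blast
    qed
    then have "image g ` {A \<inter> f ` Z |A. A \<in> \<A>} = {A \<inter> Z |A. A \<in> ?B}"
      unfolding Setcompr_eq_image image_image by (intro image_cong) auto
    ultimately show "complete_family {A \<inter> Z |A. A \<in> ?B}" by simp
  qed
  moreover have "sigma_disjoint ?B"
  proof -
    obtain D :: "nat \<Rightarrow> _" where D: "\<A> = (\<Union>n. D n)" "\<And>n. disjoint (D n)"
      using assms(6) unfolding sigma_disjoint_def by blast
    have "disjoint (image g ` D n)" for n
      unfolding disjoint_def
    proof (intro ballI impI)
      fix A' B' assume AB': "A' \<in> image g ` D n" "B' \<in> image g ` D n" "A' \<noteq> B'"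
      then obtain A B where AB: "A \<in> D n" "B \<in> D n" "A' = g ` A" "B' = g ` B" by auto
      then have "A \<inter> B = {}" using disjointD[OF D(2)[of n], of A B] AB'(3) by auto
      moreover have "A \<subseteq> topspace Y" "B \<subseteq> topspace Y" using sub D(1) AB by blast+
      ultimately show "A' \<inter> B' = {}"
        using inj_on_image_Int[OF inj] AB by (metis image_empty)
    qed
    moreover have "?B = (\<Union>n. image g ` D n)" using D(1) by blast
    ultimately show ?thesis unfolding sigma_disjoint_def by (intro exI[of _ "\<lambda>n. image g ` D n"]) simp
  qed
  ultimately show ?thesis by blast
qed

section \<open>Connected sets, rays and ends\<close>

definition frequently_in :: "(nat \<Rightarrow> 'v) \<Rightarrow> 'v set \<Rightarrow> bool" where
  "frequently_in x U \<longleftrightarrow> (\<forall>N. \<exists>n\<ge>N. x n \<in> U)"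

lemma tail_frequently_in: "has_tail_in x U \<Longrightarrow> frequently_in x U"
  unfolding has_tail_in_def frequently_in_def by (metis atLeast_iff image_subset_iff nle_le)

lemma not_has_tail_in: "\<not> has_tail_in x U \<longleftrightarrow> frequently_in x (- U)"
  unfolding has_tail_in_def frequently_in_def by auto

lemma has_tail_in_mono: "has_tail_in x U \<Longrightarrow> U \<subseteq> U' \<Longrightarrow> has_tail_in x U'"
  unfolding has_tail_in_def by blast

lemma frequently_in_mono: "frequently_in x U \<Longrightarrow> U \<subseteq> U' \<Longrightarrow> frequently_in x U'"
  unfolding frequently_in_def by blast

lemma frequently_tail_Int: "frequently_in x U \<Longrightarrow> has_tail_in x U' \<Longrightarrow> frequently_in x (U \<inter> U')"
  unfolding has_tail_in_def frequently_in_def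
  by (metis (no_types, lifting) IntI atLeast_iff image_subset_iff max.bounded_iff)

lemma has_tail_in_Int: "has_tail_in x U \<Longrightarrow> has_tail_in x U' \<Longrightarrow> has_tail_in x (U \<inter> U')"
  unfolding has_tail_in_def by (metis (no_types, lifting) IntI atLeast_iff image_subset_iff max.bounded_iff)

lemma has_tail_in_ex: "has_tail_in x U \<Longrightarrow> \<exists>n. x n \<in> U"
  unfolding has_tail_in_def by auto

locale sgraph =
  fixes V :: "'v set" and E :: "'v set set"
  assumes simple: "simple_graph V E"
begin

abbreviation "rays \<equiv> graph_rays V E"

lemma edgeD: "{u, v} \<in> E \<Longrightarrow> u \<in> V" "{u, v} \<in> E \<Longrightarrow> v \<in> V" "{u, v} \<in> E \<Longrightarrow> u \<noteq> v"
  using simple unfolding simple_graph_def by (metis doubleton_eq_iff)+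

lemma edge_sym: "{u, v} \<in> E \<Longrightarrow> {v, u} \<in> E"
  by (simp add: insert_commute)

section \<open>Components of induced subgraphs and outer neighbourhoods\<close>

definition R :: "'v set \<Rightarrow> 'v rel" where
  "R X = {(u, v). {u, v} \<in> E \<and> u \<in> X \<and> v \<in> X}"

definition conn :: "'v set \<Rightarrow> bool" where
  "conn C \<longleftrightarrow> C \<subseteq> V \<and> (\<forall>u\<in>C. \<forall>v\<in>C. (u, v) \<in> (R C)\<^sup>*)"

text \<open>For \<open>v\<close> outside \<open>X\<close> the value is just \<open>{v}\<close>;
  \<open>comps\<close> inserts only vertices of \<open>X\<close>.\<close>

definition comp :: "'v set \<Rightarrow> 'v \<Rightarrow> 'v set" where
  "comp X v = {u. (v, u) \<in> (R X)\<^sup>*}"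

definition comps :: "'v set \<Rightarrow> 'v set set" where
  "comps X = comp X ` X"

definition nb :: "'v set \<Rightarrow> 'v set" where
  "nb C = {x. x \<notin> C \<and> (\<exists>c\<in>C. {x, c} \<in> E)}"

lemma sym_R: "(u, v) \<in> (R X)\<^sup>* \<Longrightarrow> (v, u) \<in> (R X)\<^sup>*"
proof -
  have "sym (R X)" unfolding R_def sym_def by (auto simp: insert_commute)
  then show "(u, v) \<in> (R X)\<^sup>* \<Longrightarrow> (v, u) \<in> (R X)\<^sup>*" using sym_rtrancl symD by metis
qed

lemma R_mono: "X \<subseteq> Y \<Longrightarrow> (u, v) \<in> (R X)\<^sup>* \<Longrightarrow> (u, v) \<in> (R Y)\<^sup>*"
proof -
  assume "X \<subseteq> Y"
  then have "R X \<subseteq> R Y" unfolding R_def by blast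
  then show "(u, v) \<in> (R X)\<^sup>* \<Longrightarrow> (u, v) \<in> (R Y)\<^sup>*" using rtrancl_mono by blast
qed

lemma R_step: "{u, v} \<in> E \<Longrightarrow> u \<in> X \<Longrightarrow> v \<in> X \<Longrightarrow> (u, v) \<in> (R X)\<^sup>*"
  unfolding R_def by blast

lemma R_invariant:
  assumes "(u, v) \<in> (R X)\<^sup>*" "u \<in> D"
    and "\<And>a b. a \<in> D \<Longrightarrow> a \<in> X \<Longrightarrow> b \<in> X \<Longrightarrow> {a, b} \<in> E \<Longrightarrow> b \<in> D"
  shows "v \<in> D"
  using assms(1,2)
proof (induction rule: rtrancl_induct)
  case (step y z)
  then show ?case using assms(3)[of y z] unfolding R_def by blast
qed

lemma R_in: "(u, v) \<in> (R X)\<^sup>* \<Longrightarrow> u \<in> X \<Longrightarrow> v \<in> X"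
  by (erule R_invariant) auto

lemma R_restrict:
  assumes "(u, v) \<in> (R X)\<^sup>*" "u \<in> D"
    and "\<And>a b. a \<in> D \<Longrightarrow> a \<in> X \<Longrightarrow> b \<in> X \<Longrightarrow> {a, b} \<in> E \<Longrightarrow> b \<in> D"
  shows "(u, v) \<in> (R D)\<^sup>*"
proof -
  have "v \<in> {w \<in> D. (u, w) \<in> (R D)\<^sup>*}"
  proof (rule R_invariant[OF assms(1)])
    fix a b assume a: "a \<in> {w \<in> D. (u, w) \<in> (R D)\<^sup>*}" and "a \<in> X" "b \<in> X" "{a, b} \<in> E"
    then have "b \<in> D" using assms(3)[of a b] by blast
    then have "(a, b) \<in> R D" using a \<open>{a, b} \<in> E\<close> unfolding R_def by blast
    then show "b \<in> {w \<in> D. (u, w) \<in> (R D)\<^sup>*}" using a \<open>b \<in> D\<close> by (auto intro: rtrancl_into_rtrancl)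
  qed (use assms(2) in simp)
  then show ?thesis by simp
qed

lemma connI:
  assumes "C \<subseteq> V" "\<And>v. v \<in> C \<Longrightarrow> (a, v) \<in> (R C)\<^sup>*"
  shows "conn C"
  unfolding conn_def
proof (intro conjI ballI)
  fix u v assume "u \<in> C" "v \<in> C"
  then show "(u, v) \<in> (R C)\<^sup>*" using sym_R[OF assms(2)] assms(2) by (meson rtrancl_trans)
qed (fact assms)

lemma connD: "conn C \<Longrightarrow> u \<in> C \<Longrightarrow> v \<in> C \<Longrightarrow> (u, v) \<in> (R C)\<^sup>*"
  unfolding conn_def by blast

lemma conn_subset: "conn C \<Longrightarrow> C \<subseteq> V" unfolding conn_def by blast

lemma comps_subset: "C \<in> comps X \<Longrightarrow> C \<subseteq> X"
  unfolding comps_def comp_def using R_in by blast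

lemma comps_nonempty: "C \<in> comps X \<Longrightarrow> C \<noteq> {}"
  unfolding comps_def comp_def by blast

lemma comps_cover: "v \<in> X \<Longrightarrow> \<exists>C\<in>comps X. v \<in> C"
  unfolding comps_def comp_def by blast

lemma comps_closed: "C \<in> comps X \<Longrightarrow> a \<in> C \<Longrightarrow> {a, b} \<in> E \<Longrightarrow> b \<in> X \<Longrightarrow> b \<in> C"
  using comps_subset[of C X] R_step[of a b X] rtrancl_trans
  unfolding comps_def comp_def by fastforce

lemma conn_comps:
  assumes "X \<subseteq> V" "C \<in> comps X"
  shows "conn C"
proof -
  obtain a where a: "a \<in> X" "C = comp X a" using assms unfolding comps_def by blast
  have "(a, v) \<in> (R C)\<^sup>*" if "v \<in> C" for v
    by (rule R_restrict[of a v X])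
      (use that a comps_closed[OF assms(2)] in \<open>auto simp: comp_def\<close>)
  then show ?thesis using connI comps_subset assms by (metis order_trans)
qed

lemma conn_subset_comps:
  assumes "conn D" "D \<subseteq> X" "C \<in> comps X" "D \<inter> C \<noteq> {}"
  shows "D \<subseteq> C"
proof
  fix v assume "v \<in> D"
  obtain u where u: "u \<in> D" "u \<in> C" using assms by blast
  have "(u, v) \<in> (R X)\<^sup>*" using assms R_mono connD u \<open>v \<in> D\<close> by metis
  then show "v \<in> C" by (rule R_invariant) (use u comps_closed[OF assms(3)] in auto)
qed

lemma comps_disjoint: "C \<in> comps X \<Longrightarrow> D \<in> comps X \<Longrightarrow> v \<in> C \<Longrightarrow> v \<in> D \<Longrightarrow> C = D"
proof -
  have *: "D \<subseteq> C" if CD: "C \<in> comps X" "D \<in> comps X" "v \<in> C" "v \<in> D" for C D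
  proof
    obtain d where d: "D = comp X d" using CD unfolding comps_def by blast
    fix w assume "w \<in> D"
    then have "(d, w) \<in> (R X)\<^sup>*" "(v, d) \<in> (R X)\<^sup>*"
      using CD(4) sym_R unfolding d comp_def by auto
    then have "(v, w) \<in> (R X)\<^sup>*" by (meson rtrancl_trans)
    then show "w \<in> C" by (rule R_invariant) (use CD comps_closed in auto)
  qed
  assume "C \<in> comps X" "D \<in> comps X" "v \<in> C" "v \<in> D"
  then show "C = D" using * by (metis subset_antisym)
qed

lemma conn_in_comps: "conn D \<Longrightarrow> D \<subseteq> X \<Longrightarrow> D \<noteq> {} \<Longrightarrow> \<exists>C\<in>comps X. D \<subseteq> C"
  by (metis comps_cover conn_subset_comps disjoint_iff ex_in_conv subsetD)

text \<open>A path that leaves \<open>D\<close> has to pass through \<open>nb D\<close>. All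
  separation arguments below come down to this.\<close>

lemma conn_absorb:
  assumes "conn C" "C \<inter> D \<noteq> {}" "C \<inter> nb D = {}"
  shows "C \<subseteq> D"
proof
  fix v assume "v \<in> C"
  obtain u where u: "u \<in> C" "u \<in> D" using assms by blast
  have "(u, v) \<in> (R C)\<^sup>*" using assms connD u \<open>v \<in> C\<close> by metis
  then show "v \<in> D"
  proof (rule R_invariant)
    fix a b assume "a \<in> D" "a \<in> C" "b \<in> C" "{a, b} \<in> E"
    then show "b \<in> D" using assms(3) edge_sym[of a b] unfolding nb_def by blast
  qed (use u in auto)
qed

lemma conn_nb:
  assumes "conn C" "D \<subset> C" "D \<noteq> {}"
  shows "\<exists>x. x \<in> nb D \<and> x \<in> C"
  using conn_absorb[OF assms(1), of D] assms by blast

lemma comps_nb: "C \<in> comps X \<Longrightarrow> nb C \<inter> X = {}"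
  unfolding nb_def using comps_closed by (auto simp: insert_commute)

lemma comps_nb_V: "C \<in> comps (V - S) \<Longrightarrow> nb C \<subseteq> S"
  using comps_nb[of C "V - S"] edgeD unfolding nb_def by blast

text \<open>A breadth-first tree: \<open>d\<close> is the distance from \<open>r\<close>, and the
  parent is some neighbour at smaller distance. The root is made a fixed point of \<open>p\<close>
  so that iterating \<open>p\<close> is total and ends at \<open>r\<close>.\<close>

lemma spanning_tree:
  assumes "conn C" "r \<in> C"
  obtains p :: "'v \<Rightarrow> 'v" and d :: "'v \<Rightarrow> nat" where "p r = r"
    "\<And>v. v \<in> C \<Longrightarrow> p v \<in> C"
    "\<And>v. v \<in> C \<Longrightarrow> v \<noteq> r \<Longrightarrow> {v, p v} \<in> E \<and> d (p v) < d v"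
proof -
  define d where "d v = (LEAST n. (r, v) \<in> (R C) ^^ n)" for v
  have d: "(r, v) \<in> (R C) ^^ d v" if v: "v \<in> C" for v
  proof -
    obtain n where "(r, v) \<in> (R C) ^^ n"
      using connD[OF assms v] rtrancl_power by blast
    then show ?thesis unfolding d_def by (rule LeastI)
  qed
  have "\<exists>u. u \<in> C \<and> {v, u} \<in> E \<and> d u < d v" if v: "v \<in> C" "v \<noteq> r" for v
  proof -
    have "d v \<noteq> 0" using d[OF v(1)] v(2) by (metis IdE pair_in_Id_conv relpow.simps(1))
    then obtain n where n: "d v = Suc n" by (cases "d v") auto
    then obtain u where u: "(r, u) \<in> (R C) ^^ n" "(u, v) \<in> R C" using d[OF v(1)] by auto
    have "d u \<le> n" unfolding d_def using u(1) by (rule Least_le)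
    then show ?thesis using u(2) n unfolding R_def by (auto simp: insert_commute)
  qed
  then obtain q where q: "\<And>v. v \<in> C \<Longrightarrow> v \<noteq> r \<Longrightarrow> q v \<in> C \<and> {v, q v} \<in> E \<and> d (q v) < d v" by metis
  show ?thesis
    by (rule that[of "q(r := r)" d]) (use q assms in auto)
qed

section \<open>Rays and the side of a finite separator on which they end\<close>

lemma ray_inV: "x \<in> rays \<Longrightarrow> x n \<in> V" unfolding graph_rays_def by blast

lemma ray_edge: "x \<in> rays \<Longrightarrow> {x n, x (Suc n)} \<in> E" unfolding graph_rays_def by blast

lemma ray_inj: "x \<in> rays \<Longrightarrow> inj x" unfolding graph_rays_def by blast

lemma ray_avoid: "x \<in> rays \<Longrightarrow> finite S \<Longrightarrow> \<exists>N. \<forall>n\<ge>N. x n \<notin> S"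
proof -
  assume "x \<in> rays" "finite S"
  then have "finite {n. x n \<in> S}" using finite_vimageI[of S x] ray_inj by (simp add: vimage_def)
  then obtain N where "\<forall>n\<in>{n. x n \<in> S}. n < N" using finite_nat_set_iff_bounded by blast
  then show ?thesis by (intro exI[of _ N]) force
qed

lemma conn_ray_tail: "x \<in> rays \<Longrightarrow> conn (x ` {N..})"
proof (rule connI[of _ "x N"])
  assume x: "x \<in> rays"
  show "x ` {N..} \<subseteq> V" using ray_inV[OF x] by blast
  have "(x N, x (N + k)) \<in> (R (x ` {N..}))\<^sup>*" for k
  proof (induction k)
    case (Suc k)
    have "(x (N + k), x (Suc (N + k))) \<in> (R (x ` {N..}))\<^sup>*"
      by (rule R_step) (use ray_edge[OF x] in auto)
    with Suc show ?case by (simp add: rtrancl_trans)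
  qed simp
  then show "(x N, v) \<in> (R (x ` {N..}))\<^sup>*" if "v \<in> x ` {N..}" for v
    using that by (metis atLeast_iff imageE le_Suc_ex)
qed

text \<open>Being injective, the ray eventually avoids the finite set \<open>nb U\<close>, and its
  next visit to \<open>U\<close> is permanent.\<close>

lemma ray_finite_nb:
  assumes x: "x \<in> rays" "finite (nb U)" "frequently_in x U"
  shows "has_tail_in x U"
proof -
  obtain N where N: "\<forall>n\<ge>N. x n \<notin> nb U" using ray_avoid x by blast
  obtain n where n: "n \<ge> N" "x n \<in> U" using x(3) unfolding frequently_in_def by blast
  have "x ` {N..} \<subseteq> U"
    by (rule conn_absorb[OF conn_ray_tail[OF x(1)]]) (use N n in auto)
  then show ?thesis unfolding has_tail_in_def by blast
qed

lemma ray_tail_in_comps: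
  assumes x: "x \<in> rays" "has_tail_in x U" "U \<subseteq> V"
  shows "\<exists>C\<in>comps U. has_tail_in x C"
proof -
  obtain N where N: "x ` {N..} \<subseteq> U" using x(2) unfolding has_tail_in_def by blast
  have "\<exists>C\<in>comps U. x ` {N..} \<subseteq> C"
    by (rule conn_in_comps[OF conn_ray_tail[OF x(1)] N]) auto
  then show ?thesis unfolding has_tail_in_def by blast
qed

lemma components_avoiding_eq: "components_avoiding V E S = comps (V - S)"
proof -
  have "adj_avoiding E S = R (V - S)"
    unfolding adj_avoiding_def R_def by (auto dest: edgeD(1,2))
  moreover have "{v \<in> V - S. (u, v) \<in> (R (V - S))\<^sup>*} = comp (V - S) u" if "u \<in> V - S" for u
    unfolding comp_def by (intro Collect_cong) (use R_in that in metis)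
  ultimately show ?thesis
    unfolding components_avoiding_def comps_def image_def by force
qed

text \<open>The component used in the definition of the end space, but attached to a ray and
  available for finite sets that need not lie in \<open>V\<close>; \<open>end_component_cls\<close>
  identifies the two.\<close>

definition side :: "'v set \<Rightarrow> (nat \<Rightarrow> 'v) \<Rightarrow> 'v set" where
  "side S x = (THE C. C \<in> comps (V - S) \<and> has_tail_in x C)"

lemma side:
  assumes "x \<in> rays" "finite S"
  shows "side S x \<in> comps (V - S)" "has_tail_in x (side S x)"
proof -
  have "has_tail_in x (V - S)"
    using ray_avoid[OF assms] ray_inV[OF assms(1)] unfolding has_tail_in_def by blast
  then obtain C where C: "C \<in> comps (V - S)" "has_tail_in x C"
    using ray_tail_in_comps assms by blast
  have uniq: "C' = C" if C': "C' \<in> comps (V - S) \<and> has_tail_in x C'" for C'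
  proof -
    obtain n where "x n \<in> C" "x n \<in> C'"
      using has_tail_in_ex[OF has_tail_in_Int[OF C(2), of C']] C' by auto
    then show ?thesis using comps_disjoint[of C' "V - S" C "x n"] C' C(1) by simp
  qed
  have "side S x = C" unfolding side_def
    by (rule the_equality[OF _ uniq]) (intro conjI C)
  then show "side S x \<in> comps (V - S)" "has_tail_in x (side S x)" using C by auto
qed

lemma side_conn: "x \<in> rays \<Longrightarrow> finite S \<Longrightarrow> conn (side S x)"
  using conn_comps side(1) by (metis Diff_subset)

lemma side_subset: "x \<in> rays \<Longrightarrow> finite S \<Longrightarrow> side S x \<subseteq> V - S"
  using comps_subset side(1) by blast

lemma side_absorb:
  assumes "x \<in> rays" "finite S" "conn D" "D \<inter> S = {}" "D \<inter> side S x \<noteq> {}"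
  shows "D \<subseteq> side S x"
proof (rule conn_subset_comps[OF assms(3) _ side(1)[OF assms(1,2)] assms(5)])
  show "D \<subseteq> V - S" using conn_subset[OF assms(3)] assms(4) by blast
qed

lemma side_absorb_freq:
  assumes "x \<in> rays" "finite S" "conn D" "D \<inter> S = {}" "frequently_in x D"
  shows "D \<subseteq> side S x"
proof (rule side_absorb[OF assms(1-4)])
  show "D \<inter> side S x \<noteq> {}"
    using frequently_tail_Int[OF assms(5) side(2)[OF assms(1,2)]] unfolding frequently_in_def by blast
qed

lemma side_closed:
  assumes "x \<in> rays" "finite S" "a \<in> side S x" "{a, b} \<in> E" "b \<notin> S"
  shows "b \<in> side S x"
  using comps_closed[OF side(1)[OF assms(1,2)] assms(3,4)] assms(5) edgeD(2)[OF assms(4)] by blast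

lemma side_eqI:
  assumes "x \<in> rays" "finite S" "C \<in> comps (V - S)" "frequently_in x C"
  shows "side S x = C"
proof -
  obtain n where "x n \<in> C \<inter> side S x"
    using frequently_tail_Int[OF assms(4) side(2)[OF assms(1,2)]] unfolding frequently_in_def by blast
  then show ?thesis using comps_disjoint[OF side(1)[OF assms(1,2)] assms(3)] by blast
qed

lemma side_eqI2:
  assumes "x \<in> rays" "y \<in> rays" "finite S" "frequently_in x (side S y)"
  shows "side S x = side S y"
  by (rule side_eqI[OF assms(1,3) side(1)[OF assms(2,3)] assms(4)])

lemma side_Int_V: "side (S \<inter> V) x = side S x"
proof -
  have "V - S \<inter> V = V - S" by blast
  then show ?thesis unfolding side_def by simp
qed

definition eqv :: "(nat \<Rightarrow> 'v) \<Rightarrow> (nat \<Rightarrow> 'v) \<Rightarrow> bool" where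
  "eqv x y \<longleftrightarrow> x \<in> rays \<and> y \<in> rays \<and> (\<forall>S. finite S \<longrightarrow> side S x = side S y)"

lemma eqv_sym: "eqv x y \<Longrightarrow> eqv y x" unfolding eqv_def by auto

lemma eqv_refl: "x \<in> rays \<Longrightarrow> eqv x x" unfolding eqv_def by auto

lemma ray_equiv_iff: "(x, y) \<in> ray_equiv V E \<longleftrightarrow> eqv x y"
proof
  assume xy: "(x, y) \<in> ray_equiv V E"
  then have r: "x \<in> rays" "y \<in> rays" unfolding ray_equiv_def by auto
  have "side S x = side S y" if S: "finite S" for S
  proof -
    have "finite (S \<inter> V)" "S \<inter> V \<subseteq> V" using S by auto
    then obtain C where C: "C \<in> comps (V - S \<inter> V)" "has_tail_in x C" "has_tail_in y C"
      using xy unfolding ray_equiv_def components_avoiding_eq by blast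
    then have "side (S \<inter> V) x = C" "side (S \<inter> V) y = C"
      using side_eqI[OF r(1) _ C(1)] side_eqI[OF r(2) _ C(1)] S tail_frequently_in by auto
    then show ?thesis by (simp add: side_Int_V)
  qed
  then show "eqv x y" using r unfolding eqv_def by blast
next
  assume e: "eqv x y"
  then have "\<exists>C\<in>comps (V - S). has_tail_in x C \<and> has_tail_in y C" if "finite S" for S
    using that side[of x S] side(2)[of y S] unfolding eqv_def by metis
  then show "(x, y) \<in> ray_equiv V E"
    using e unfolding ray_equiv_def components_avoiding_eq eqv_def by blast
qed

text \<open>Deleting \<open>nb U\<close> cuts \<open>U\<close> off from the rest of the graph, so a
  component that holds a tail of \<open>x\<close> and meets \<open>U\<close> stays inside
  \<open>U\<close>.\<close>

lemma same_side_tail: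
  assumes xy: "x \<in> rays" "y \<in> rays" "side (nb U) y = side (nb U) x"
    and U: "finite (nb U)" "has_tail_in x U"
  shows "has_tail_in y U"
proof -
  have "side (nb U) x \<subseteq> U"
  proof (rule conn_absorb)
    show "conn (side (nb U) x)" by (rule side_conn[OF xy(1) U(1)])
    show "side (nb U) x \<inter> U \<noteq> {}"
      using has_tail_in_ex[OF has_tail_in_Int[OF side(2)[OF xy(1) U(1)] U(2)]] by blast
    show "side (nb U) x \<inter> nb U = {}" using side_subset[OF xy(1) U(1)] by blast
  qed
  then show ?thesis using side(2)[OF xy(2) U(1)] xy(3) has_tail_in_mono by metis
qed

lemma eqv_tail: "eqv x y \<Longrightarrow> finite (nb U) \<Longrightarrow> has_tail_in x U \<Longrightarrow> has_tail_in y U"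
  using same_side_tail[of x y U] unfolding eqv_def by simp

text \<open>Convergence of the vertex set \<open>K\<close> to the end of \<open>x\<close>. Every
  finite set converges to every end, which is why uniqueness of the limit in \<open>conc_eqv\<close>
  asks for infinite \<open>K\<close>.\<close>

definition conc :: "'v set \<Rightarrow> (nat \<Rightarrow> 'v) \<Rightarrow> bool" where
  "conc K x \<longleftrightarrow> (\<forall>S. finite S \<longrightarrow> finite (K - side S x))"

lemma conc_subset: "conc K x \<Longrightarrow> L \<subseteq> K \<Longrightarrow> conc L x"
  unfolding conc_def by (meson Diff_mono finite_subset order_refl)

lemma conc_Un: "conc K x \<Longrightarrow> conc L x \<Longrightarrow> conc (K \<union> L) x"
  unfolding conc_def by (simp add: Un_Diff)

lemma conc_freq:
  assumes "conc K x" "x \<in> rays" "y \<in> rays" "frequently_in y K"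
  shows "eqv y x"
  unfolding eqv_def
proof (intro conjI allI impI)
  fix S :: "'v set" assume S: "finite S"
  have "finite (K - side S x)" using assms(1) S unfolding conc_def by blast
  then obtain N where N: "\<forall>n\<ge>N. y n \<notin> K - side S x" using ray_avoid assms by blast
  have "frequently_in y (side S x)"
    unfolding frequently_in_def
  proof
    fix M
    obtain n where "n \<ge> max M N" "y n \<in> K" using assms(4) unfolding frequently_in_def by blast
    then show "\<exists>n\<ge>M. y n \<in> side S x" using N by (intro exI[of _ n]) auto
  qed
  then show "side S y = side S x" by (rule side_eqI2[OF assms(3,2) S])
qed (use assms in auto)

lemma conc_eqv:
  assumes "conc K x" "conc K y" "infinite K" "x \<in> rays" "y \<in> rays"
  shows "eqv x y"
  unfolding eqv_def
proof (intro conjI allI impI)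
  fix S :: "'v set" assume S: "finite S"
  have "finite (K - side S x)" "finite (K - side S y)" using assms S unfolding conc_def by blast+
  then have "finite ((K - side S x) \<union> (K - side S y))" by blast
  then have "\<not> K \<subseteq> (K - side S x) \<union> (K - side S y)" using assms(3) finite_subset by blast
  then obtain v where "v \<in> side S x" "v \<in> side S y" by blast
  then show "side S x = side S y"
    by (rule comps_disjoint[OF side(1)[OF assms(4) S] side(1)[OF assms(5) S]])
qed (use assms in auto)

subsection \<open>Constructing rays\<close>

lemma walk_ray:
  assumes w: "\<And>n. w n \<in> V" "\<And>n. w (Suc n) = w n \<or> {w n, w (Suc n)} \<in> E"
    and fin: "\<And>n. finite {m. w m = w n}"
  shows "\<exists>f. strict_mono f \<and> w \<circ> f \<in> rays"
proof -
  define l where "l n = Max {m. w m = w n}" for n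
  have l: "w (l n) = w n" "n \<le> l n" "\<And>m. w m = w n \<Longrightarrow> m \<le> l n" for n
    using Max_in[OF fin[of n]] Max_ge[OF fin[of n]] unfolding l_def by auto
  define f where "f = rec_nat (l 0) (\<lambda>_ k. l (Suc k))"
  have f: "f 0 = l 0" "f (Suc k) = l (Suc (f k))" for k unfolding f_def by auto
  have lf: "m \<le> f k" if "w m = w (f k)" for m k
    using that l f by (cases k) auto
  have inc: "f k < f (Suc k)" for k using l(2)[of "Suc (f k)"] f by simp
  have mono: "strict_mono f" using inc strict_mono_Suc_iff by blast
  have wf: "w (f (Suc k)) = w (Suc (f k))" for k using f l(1) by simp
  have "{w (f k), w (f (Suc k))} \<in> E" for k
    using w(2)[of "f k"] lf[of "Suc (f k)" k] wf by auto
  moreover have "inj (w \<circ> f)"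
  proof (rule injI)
    fix i j assume "(w \<circ> f) i = (w \<circ> f) j"
    then have "f i = f j" using lf[of "f i" j] lf[of "f j" i] by auto
    then show "i = j" using mono strict_mono_eq by blast
  qed
  ultimately have "w \<circ> f \<in> rays" unfolding graph_rays_def using w(1) by auto
  then show ?thesis using mono by blast
qed

text \<open>In stage \<open>n\<close> a walk inside \<open>B n\<close> follows a spanning tree
  rooted at a point of \<open>B (Suc n)\<close>. Every vertex is missing from some
  \<open>B n\<close>, so the walk visits it finitely often and its loops can be erased.\<close>

lemma decseq_conn_ray:
  assumes B: "decseq B" "\<And>n. conn (B n)" "\<And>n. B n \<noteq> {}" "\<And>v. \<exists>n. v \<notin> B n"
  shows "\<exists>x\<in>rays. \<forall>n. has_tail_in x (B n)"
proof -
  have "\<forall>n. \<exists>b. b \<in> B n" using B(3) by auto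
  then obtain b where b: "\<And>n. b n \<in> B n" by metis
  have b': "b (Suc n) \<in> B n" for n using b B(1) decseqD by (metis le_SucI order_refl subsetD)
  have "\<exists>q d. (\<forall>v\<in>B n. q v \<in> B n) \<and> (\<forall>v\<in>B n. v \<noteq> b (Suc n) \<longrightarrow> {v, q v} \<in> E \<and> d (q v) < (d v :: nat))" for n
    using spanning_tree[OF B(2)[of n] b'[of n]] by metis
  then obtain q d where q: "\<And>n v. v \<in> B n \<Longrightarrow> q n v \<in> B n"
    "\<And>n v. v \<in> B n \<Longrightarrow> v \<noteq> b (Suc n) \<Longrightarrow> {v, q n v} \<in> E \<and> d n (q n v) < (d n v :: nat)" by metis
  \<comment> \<open>A state is a vertex together with the stage. On arrival at the root of the
    current tree the vertex rests for one step while the stage advances.\<close>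
  define step where "step = (\<lambda>(v, n). if v = b (Suc n) then (v, Suc n) else (q n v, n))"
  define s where "s k = (step ^^ k) (b 0, 0)" for k
  have s: "s 0 = (b 0, 0)" "s (Suc k) = step (s k)" for k unfolding s_def by auto
  define w where "w k = fst (s k)" for k
  define m where "m k = snd (s k)" for k
  have ws: "w (Suc k) = (if w k = b (Suc (m k)) then w k else q (m k) (w k))"
     "m (Suc k) = (if w k = b (Suc (m k)) then Suc (m k) else m k)" for k
    unfolding w_def m_def s step_def by (auto split: prod.splits)
  have inB: "w k \<in> B (m k)" for k
  proof (induction k)
    case 0 then show ?case using b by (simp add: w_def m_def s)
  next
    case (Suc k) then show ?case using q(1)[OF Suc] b[of "Suc (m k)"] by (simp add: ws)
  qed
  have mmono: "m k \<le> m l" if "k \<le> l" for k l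
    using that by (induction l rule: dec_induct) (auto simp: ws)
  have reach: "\<exists>l\<ge>k. w l = b (Suc (m k)) \<and> m l = m k" for k
  proof (induction "d (m k) (w k)" arbitrary: k rule: less_induct)
    case less
    show ?case
    proof (cases "w k = b (Suc (m k))")
      case False
      then have "m (Suc k) = m k" "d (m k) (w (Suc k)) < d (m k) (w k)"
        using q(2)[OF inB False] by (simp_all add: ws)
      then show ?thesis using less[of "Suc k"] by (metis Suc_leD)
    qed auto
  qed
  have unb: "\<exists>k. n \<le> m k" for n
  proof (induction n)
    case (Suc n)
    then obtain k where "n \<le> m k" by blast
    moreover obtain l where "w l = b (Suc (m k))" "m l = m k" using reach by blast
    ultimately have "Suc n \<le> m (Suc l)" by (simp add: ws)
    then show ?case by blast
  qed simp
  have late: "\<exists>K. \<forall>k\<ge>K. w k \<in> B n" for n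
  proof -
    obtain K where K: "n \<le> m K" using unb by blast
    have "w k \<in> B n" if "k \<ge> K" for k
      using inB[of k] decseqD[OF B(1) order_trans[OF K mmono[OF that]]] by blast
    then show ?thesis by blast
  qed
  have "\<exists>f. strict_mono f \<and> w \<circ> f \<in> rays"
  proof (rule walk_ray)
    show "w n \<in> V" for n using inB conn_subset B(2) by blast
    show "w (Suc n) = w n \<or> {w n, w (Suc n)} \<in> E" for n
      using q(2)[OF inB[of n]] by (auto simp: ws)
    fix n
    obtain i where "w n \<notin> B i" using B(4) by blast
    moreover obtain K where "\<forall>k\<ge>K. w k \<in> B i" using late by blast
    ultimately have "{m. w m = w n} \<subseteq> {..<K}" by (metis (mono_tags) lessThan_iff linorder_not_le mem_Collect_eq subsetI)
    then show "finite {m. w m = w n}" using finite_subset by blast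
  qed
  then obtain f where f: "strict_mono f" "w \<circ> f \<in> rays" by blast
  have "has_tail_in (w \<circ> f) (B n)" for n
  proof -
    obtain K where K: "\<forall>k\<ge>K. w k \<in> B n" using late by blast
    have "(w \<circ> f) k \<in> B n" if "k \<ge> K" for k
      using K that strict_mono_imp_increasing[OF f(1), of k] by simp
    then show ?thesis unfolding has_tail_in_def by blast
  qed
  then show ?thesis using f by blast
qed

end

section \<open>Concentrated cores\<close>

text \<open>The reflexive ancestor relation of the tree with parent map \<open>p\<close>; the
  ancestor is the last argument.\<close>

definition anc :: "('v \<Rightarrow> 'v) \<Rightarrow> 'v \<Rightarrow> 'v \<Rightarrow> bool" where
  "anc p v w \<longleftrightarrow> (\<exists>n. w = (p ^^ n) v)"

lemma anc_refl: "anc p v v" unfolding anc_def by (intro exI[of _ 0]) simp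

lemma anc_trans: "anc p u v \<Longrightarrow> anc p v w \<Longrightarrow> anc p u w"
  unfolding anc_def by (metis comp_apply funpow_add)

lemma anc_step: "anc p (p v) w \<Longrightarrow> anc p v w"
  unfolding anc_def by (metis funpow_Suc_right comp_apply)

lemma anc_parent: "anc p v (p v)"
  unfolding anc_def by (intro exI[of _ 1]) simp

lemma anc_neq:
  assumes "anc p v w" "v \<noteq> w"
  shows "\<exists>c. anc p v c \<and> p c = w \<and> c \<noteq> w"
proof -
  define n where "n = (LEAST n. w = (p ^^ n) v)"
  have n: "w = (p ^^ n) v" using assms(1) unfolding n_def anc_def by (rule LeastI_ex)
  with assms(2) obtain m where m: "n = Suc m" by (cases n) auto
  then have "(p ^^ m) v \<noteq> w" using not_less_Least[of m "\<lambda>n. w = (p ^^ n) v"] unfolding n_def by auto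
  then show ?thesis using n m by (intro exI[of _ "(p ^^ m) v"]) (auto simp: anc_def)
qed

context sgraph begin

definition dominates :: "'v \<Rightarrow> (nat \<Rightarrow> 'v) \<Rightarrow> bool" where
  "dominates w x \<longleftrightarrow> (\<forall>S. finite S \<longrightarrow> w \<notin> S \<longrightarrow> w \<in> side S x)"

end

section \<open>Ancestor hulls in a rooted spanning tree\<close>

locale rooted = sgraph +
  fixes C :: "'a set" and r :: 'a and p :: "'a \<Rightarrow> 'a" and d :: "'a \<Rightarrow> nat"
  assumes C: "C \<subseteq> V" "r \<in> C" "p r = r" "\<And>v. v \<in> C \<Longrightarrow> p v \<in> C"
    and dec: "\<And>v. v \<in> C \<Longrightarrow> v \<noteq> r \<Longrightarrow> {v, p v} \<in> E \<and> d (p v) < d v"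
begin

lemma pow_in: "v \<in> C \<Longrightarrow> (p ^^ n) v \<in> C"
  by (induction n) (auto simp: C)

lemma anc_in: "anc p v w \<Longrightarrow> v \<in> C \<Longrightarrow> w \<in> C"
  unfolding anc_def using pow_in by blast

lemma pow_le: "v \<in> C \<Longrightarrow> d ((p ^^ n) v) \<le> d v"
proof (induction n)
  case (Suc n)
  then show ?case using dec[of "(p ^^ n) v"] pow_in[of v n] C(3) by (cases "(p ^^ n) v = r") auto
qed simp

lemma anc_le: "anc p v w \<Longrightarrow> v \<in> C \<Longrightarrow> d w \<le> d v"
  unfolding anc_def using pow_le by blast

lemma anc_root: "v \<in> C \<Longrightarrow> anc p v r"
proof (induction "d v" arbitrary: v rule: less_induct)
  case less
  show ?case
  proof (cases "v = r")
    case False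
    then have "anc p (p v) r" using less dec C by blast
    then show ?thesis by (rule anc_step)
  qed (simp add: anc_refl)
qed

lemma finite_anc: assumes "v \<in> C" shows "finite {w. anc p v w}"
proof -
  obtain N where N: "r = (p ^^ N) v" using anc_root[OF assms] unfolding anc_def by blast
  have stay: "(p ^^ k) r = r" for k by (induction k) (auto simp: C)
  have "{w. anc p v w} \<subseteq> (\<lambda>n. (p ^^ n) v) ` {..N}"
  proof
    fix w assume "w \<in> {w. anc p v w}"
    then obtain n where n: "w = (p ^^ n) v" unfolding anc_def by blast
    show "w \<in> (\<lambda>n. (p ^^ n) v) ` {..N}"
    proof (cases "n \<le> N")
      case False
      then obtain k where "n = k + N" by (metis add.commute le_Suc_ex nat_le_linear)
      then have "w = r" using n N stay by (simp add: funpow_add)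
      then show ?thesis using N by blast
    qed (use n in blast)
  qed
  then show ?thesis using finite_surj[of "{..N}"] by blast
qed

lemma anc_path:
  assumes "anc p v w" "v \<in> C" "\<And>a. anc p v a \<Longrightarrow> anc p a w \<Longrightarrow> a \<in> T"
  shows "(v, w) \<in> (R T)\<^sup>*"
proof -
  obtain n where "w = (p ^^ n) v" using assms(1) unfolding anc_def by blast
  then show ?thesis using assms(2,3)
  proof (induction n arbitrary: v)
    case (Suc n)
    have pw: "w = (p ^^ n) (p v)" using Suc.prems(1) by (simp add: funpow_swap1)
    then have aw: "anc p (p v) w" unfolding anc_def by blast
    have "(p v, w) \<in> (R T)\<^sup>*"
    proof (rule Suc.IH[OF pw C(4)[OF Suc.prems(2)]])
      show "a \<in> T" if "anc p (p v) a" "anc p a w" for a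
        by (rule Suc.prems(3)[OF anc_step[OF that(1)] that(2)])
    qed
    moreover have "(v, p v) \<in> (R T)\<^sup>*"
    proof (cases "v = r")
      case False
      have "v \<in> T" by (rule Suc.prems(3)[OF anc_refl anc_step[OF aw]])
      moreover have "p v \<in> T" by (rule Suc.prems(3)[OF anc_parent aw])
      ultimately show ?thesis using R_step[of v "p v" T] dec[OF Suc.prems(2) False] by simp
    qed (simp add: C)
    ultimately show ?case by (simp add: rtrancl_trans)
  qed simp
qed

lemma side_anc:
  assumes "x \<in> rays" "finite S" "v \<in> side S x" "v \<in> C" "anc p v w"
    and "\<And>a. anc p v a \<Longrightarrow> anc p a w \<Longrightarrow> a \<notin> S"
  shows "w \<in> side S x"
proof -
  have "(v, w) \<in> (R (V - S))\<^sup>*"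
    by (rule anc_path[OF assms(5,4)]) (use assms(6) anc_in[OF _ assms(4)] C(1) in blast)
  then show ?thesis
  proof (rule R_invariant[OF _ assms(3)])
    show "b \<in> side S x" if "a \<in> side S x" "b \<in> V - S" "{a, b} \<in> E" for a b
      using side_closed[OF assms(1,2)] that by blast
  qed
qed

definition tree_hull :: "'a set \<Rightarrow> 'a set" where
  "tree_hull U = {w. \<exists>u\<in>U. anc p u w}"

lemma tree_hull_superset: "U \<subseteq> tree_hull U"
proof
  fix u assume "u \<in> U"
  then show "u \<in> tree_hull U" unfolding tree_hull_def using anc_refl[of p u] by blast
qed

lemma tree_hull_subset: "U \<subseteq> C \<Longrightarrow> tree_hull U \<subseteq> C"
  unfolding tree_hull_def using anc_in by blast

lemma finite_tree_hull:
  assumes "U \<subseteq> C" "finite U" shows "finite (tree_hull U)"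
proof -
  have "tree_hull U = (\<Union>u\<in>U. {w. anc p u w})" unfolding tree_hull_def by blast
  then show ?thesis using assms finite_anc by (metis finite_UN_I subsetD)
qed

lemma conn_tree_hull: assumes "U \<subseteq> C" shows "conn (tree_hull U)"
proof (rule connI[of _ r])
  show "tree_hull U \<subseteq> V" using tree_hull_subset[OF assms] C(1) by blast
  fix v assume v: "v \<in> tree_hull U"
  have "(v, r) \<in> (R (tree_hull U))\<^sup>*"
  proof (rule anc_path)
    show vC: "v \<in> C" using v tree_hull_subset[OF assms] by blast
    show "anc p v r" by (rule anc_root[OF vC])
    show "a \<in> tree_hull U" if "anc p v a" for a
      using v anc_trans[OF _ that] unfolding tree_hull_def by blast
  qed
  then show "(r, v) \<in> (R (tree_hull U))\<^sup>*" by (rule sym_R)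
qed

text \<open>Let \<open>w\<close>, an ancestor of \<open>u\<close>, be off the side of
  \<open>x\<close>. Either \<open>u\<close> is off that side too, or the tree path from
  \<open>u\<close> to \<open>w\<close> meets \<open>S\<close> and \<open>w\<close> is an ancestor of
  a vertex of \<open>S\<close>. Both cases leave finitely many starting vertices, each with finitely
  many ancestors.\<close>

lemma conc_tree_hull:
  assumes U: "U \<subseteq> C" "conc U x" and x: "x \<in> rays"
  shows "conc (tree_hull U) x"
  unfolding conc_def
proof (intro allI impI)
  fix S :: "'a set" assume S: "finite S"
  let ?F = "(S \<inter> C) \<union> (U - side S x)"
  have "finite (U - side S x)" using U(2) S unfolding conc_def by blast
  then have fin: "finite (\<Union>u\<in>?F. {w. anc p u w})"
    using S U(1) by (intro finite_UN_I finite_UnI finite_Int finite_anc) auto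
  have "tree_hull U - side S x \<subseteq> (\<Union>u\<in>?F. {w. anc p u w})"
  proof
    fix w assume w: "w \<in> tree_hull U - side S x"
    then obtain u where u: "u \<in> U" "anc p u w" unfolding tree_hull_def by blast
    have uC: "u \<in> C" using u U(1) by blast
    show "w \<in> (\<Union>u\<in>?F. {w. anc p u w})"
    proof (cases "u \<in> side S x")
      case True
      then obtain a where a: "anc p u a" "anc p a w" "a \<in> S"
        using side_anc[OF x S True uC u(2)] w by blast
      then have "a \<in> ?F" using anc_in[OF a(1) uC] by blast
      then show ?thesis using a(2) by blast
    qed (use u in blast)
  qed
  then show "finite (tree_hull U - side S x)" using fin finite_subset by blast
qed

end

section \<open>The star-comb lemma and the existence of cores\<close>

context sgraph begin

text \<open>Climb a spanning tree of \<open>D\<close> from its root, always into a subtree to which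
  infinitely many vertices of \<open>K\<close> attach. A vertex where the climb gets stuck dominates
  the end; a climb that never stops traces a ray of the end.\<close>

lemma star_comb:
  assumes x: "x \<in> rays" and D: "conn D" and K: "infinite K" "K \<subseteq> nb D" "conc K x"
  shows "(\<exists>w\<in>D. dominates w x) \<or> (\<exists>y. eqv y x \<and> range y \<subseteq> D)"
proof (rule disjCI)
  assume no: "\<not> (\<exists>y. eqv y x \<and> range y \<subseteq> D)"
  show "\<exists>w\<in>D. dominates w x"
  proof (rule ccontr)
    assume nodom: "\<not> (\<exists>w\<in>D. dominates w x)"
    have "\<forall>k\<in>K. \<exists>h. h \<in> D \<and> {k, h} \<in> E" using K(2) unfolding nb_def by blast
    then obtain h where h: "\<And>k. k \<in> K \<Longrightarrow> h k \<in> D \<and> {k, h k} \<in> E" by metis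
    obtain k0 where "k0 \<in> K" using K(1) by (metis finite.emptyI ex_in_conv)
    define r where "r = h k0"
    have r: "r \<in> D" unfolding r_def using h \<open>k0 \<in> K\<close> by blast
    obtain p and d :: "'v \<Rightarrow> nat" where pd: "p r = r" "\<And>v. v \<in> D \<Longrightarrow> p v \<in> D"
      "\<And>v. v \<in> D \<Longrightarrow> v \<noteq> r \<Longrightarrow> {v, p v} \<in> E \<and> d (p v) < d v"
      using spanning_tree[OF D r] by metis
    interpret rooted V E D r p d
      by unfold_locales (use pd r conn_subset[OF D] in auto)
    \<comment> \<open>The vertices of \<open>K\<close> whose chosen attachment vertex lies in the
      subtree at \<open>w\<close>.\<close>
    define I where "I w = {k \<in> K. anc p (h k) w}" for w
    have to_side: "w \<in> side S x"
      if "finite S" "k \<in> K" "k \<in> side S x" "anc p (h k) w"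
        "\<And>a. anc p (h k) a \<Longrightarrow> anc p a w \<Longrightarrow> a \<notin> S" for S k w
    proof (rule side_anc[OF x that(1) _ _ that(4,5)])
      show hD: "h k \<in> D" using h that(2) by blast
      show "h k \<in> side S x"
        using side_closed[OF x that(1,3)] h[OF that(2)] that(5)[OF anc_refl that(4)] by blast
    qed
    have child: "\<exists>c. c \<in> D \<and> p c = w \<and> c \<noteq> r \<and> infinite (I c)" if w: "w \<in> D" "infinite (I w)" for w
    proof (rule ccontr)
      assume "\<not> ?thesis"
      then have finI: "\<And>c. c \<in> D \<Longrightarrow> p c = w \<Longrightarrow> c \<noteq> r \<Longrightarrow> finite (I c)" by blast
      obtain S where S: "finite S" "w \<notin> S" "w \<notin> side S x"
        using nodom w unfolding dominates_def by blast
      \<comment> \<open>The children of \<open>w\<close> with a vertex of \<open>S\<close> in their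
        subtree; there are finitely many, as each is an ancestor of a vertex of \<open>S\<close>.
        Through any other child the tree path to \<open>w\<close> avoids \<open>S\<close>.\<close>
      define H where "H = {c. (\<exists>s\<in>S \<inter> D. anc p s c) \<and> c \<in> D \<and> p c = w \<and> c \<noteq> r}"
      have "H \<subseteq> (\<Union>s\<in>S \<inter> D. {c. anc p s c})" unfolding H_def by blast
      moreover have "finite (\<Union>s\<in>S \<inter> D. {c. anc p s c})" using S(1) finite_anc by blast
      ultimately have "finite H" using finite_subset by blast
      then have "finite (\<Union>c\<in>H. I c)" using finI unfolding H_def by blast
      moreover have "finite (K - side S x)" using K(3) S unfolding conc_def by blast
      ultimately have "finite ((\<Union>c\<in>H. I c) \<union> (K - side S x))" by blast
      then have "\<not> I w \<subseteq> (\<Union>c\<in>H. I c) \<union> (K - side S x)" using w(2) finite_subset by blast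
      then obtain k where k: "k \<in> I w" "\<forall>c\<in>H. k \<notin> I c" "k \<in> side S x" "k \<in> K"
        unfolding I_def by blast
      have "w \<in> side S x"
      proof (rule to_side[OF S(1) k(4,3)])
        show "anc p (h k) w" using k(1) unfolding I_def by blast
        fix a assume a: "anc p (h k) a" "anc p a w"
        have aD: "a \<in> D" using anc_in[OF a(1)] h[OF k(4)] by blast
        show "a \<notin> S"
        proof
          assume aS: "a \<in> S"
          then have "a \<noteq> w" using S(2) by blast
          then obtain c where c: "anc p a c" "p c = w" "c \<noteq> w" using anc_neq[OF a(2)] by blast
          then have "c \<noteq> r" using pd(1) by auto
          then have "c \<in> H" using c(1,2) aS aD anc_in[OF c(1) aD] unfolding H_def by auto
          moreover have "k \<in> I c" using anc_trans[OF a(1) c(1)] k(4) unfolding I_def by blast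
          ultimately show False using k(2) by blast
        qed
      qed
      then show False using S(3) by blast
    qed
    then obtain ch where ch: "\<And>w. w \<in> D \<Longrightarrow> infinite (I w) \<Longrightarrow>
        ch w \<in> D \<and> p (ch w) = w \<and> ch w \<noteq> r \<and> infinite (I (ch w))" by metis
    define y where "y n = (ch ^^ n) r" for n
    have Ir: "I r = K" unfolding I_def using anc_root h by blast
    have y: "y n \<in> D \<and> infinite (I (y n))" for n
    proof (induction n)
      case 0 then show ?case using r Ir K(1) by (simp add: y_def)
    next
      case (Suc n) then show ?case using ch[of "y n"] by (simp add: y_def)
    qed
    have yS: "p (y (Suc n)) = y n \<and> y (Suc n) \<noteq> r" for n
      using ch[of "y n"] y[of n] by (simp add: y_def)
    have e: "{y (Suc n), y n} \<in> E \<and> d (y n) < d (y (Suc n))" for n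
      using pd(3)[of "y (Suc n)"] y[of "Suc n"] yS[of n] by auto
    then have mono: "strict_mono (\<lambda>n. d (y n))" by (simp add: strict_mono_Suc_iff)
    have "y \<in> rays"
      unfolding graph_rays_def
    proof (intro CollectI conjI allI)
      show "range y \<subseteq> V" using y conn_subset[OF D] by auto
      show "inj y"
        using inj_on_imageI2[of d y UNIV] strict_mono_imp_inj_on[OF mono] by (simp add: o_def)
      show "{y n, y (Suc n)} \<in> E" for n using edge_sym[OF conjunct1[OF e]] .
    qed
    moreover have "side S y = side S x" if S: "finite S" for S
    proof (rule side_eqI2[OF \<open>y \<in> rays\<close> x S])
      \<comment> \<open>Tree paths down to \<open>y n\<close> with \<open>n \<ge> N\<close> stay at
        heights above those of all vertices of \<open>S\<close>.\<close>
      obtain N where N: "\<forall>s\<in>S. d s < N"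
        using finite_nat_set_iff_bounded[of "d ` S"] S by auto
      have "y n \<in> side S x" if n: "n \<ge> N" for n
      proof -
        have "finite (K - side S x)" using K(3) S unfolding conc_def by blast
        then have "\<not> I (y n) \<subseteq> K - side S x" using y finite_subset by blast
        then obtain k where k: "k \<in> K" "k \<in> side S x" "anc p (h k) (y n)" unfolding I_def by blast
        show ?thesis
        proof (rule to_side[OF S k])
          fix a assume a: "anc p (h k) a" "anc p a (y n)"
          have "a \<in> D" using anc_in[OF a(1)] h[OF k(1)] by blast
          then have "d (y n) \<le> d a" using anc_le[OF a(2)] by blast
          moreover have "n \<le> d (y n)" using strict_mono_imp_increasing[OF mono] by blast
          ultimately show "a \<notin> S" using N n by force
        qed
      qed
      then show "frequently_in y (side S x)"
        unfolding frequently_in_def by (metis max.cobounded1 max.cobounded2)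
    qed
    ultimately have "eqv y x" unfolding eqv_def using x by blast
    then show False using no y by blast
  qed
qed

text \<open>Adjacency to all of \<open>nb C\<close> keeps unions of cores connected; finiteness
  makes every ray leave the core of a piece with finite neighbourhood; convergence ties the core to
  the end of \<open>nb C\<close>; the last clause gives the components finite neighbourhoods. If
  \<open>nb C\<close> is infinite and converges to no end, the last three clauses are void.\<close>

definition is_core :: "'v set \<Rightarrow> 'v set \<Rightarrow> bool" where
  "is_core C U \<longleftrightarrow> U \<subseteq> C \<and> U \<noteq> {} \<and> conn U \<and> (\<forall>x\<in>nb C. \<exists>u\<in>U. {x, u} \<in> E) \<and>
     (finite (nb C) \<longrightarrow> finite U) \<and>
     (\<forall>x\<in>rays. infinite (nb C) \<longrightarrow> conc (nb C) x \<longrightarrow> conc U x) \<and>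
     (finite (nb C) \<or> (\<exists>x\<in>rays. conc (nb C) x) \<longrightarrow> (\<forall>D\<in>comps (C - U). finite (nb D)))"

lemma nb_comps_Diff: "D \<in> comps (C - U) \<Longrightarrow> nb D \<subseteq> U \<union> nb C"
  using comps_nb[of D "C - U"] comps_subset[of D "C - U"] unfolding nb_def by blast

lemma conc_dominating: "x \<in> rays \<Longrightarrow> conc {w. dominates w x} x"
proof -
  have "{w. dominates w x} - side S x \<subseteq> S" if "finite S" for S
    using that unfolding dominates_def by blast
  then show ?thesis unfolding conc_def using finite_subset by blast
qed

text \<open>Only finitely many of the disjoint rays meet \<open>S\<close>, and each of these has a
  tail on the right side. Every other ray is connected and avoids \<open>S\<close>, so it lies on
  that side entirely.\<close>

lemma conc_disjoint_rays:
  assumes x: "x \<in> rays" and \<R>: "\<And>A. A \<in> \<R> \<Longrightarrow> \<exists>y. eqv y x \<and> A = range y" "disjoint \<R>"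
  shows "conc (\<Union>\<R>) x"
  unfolding conc_def
proof (intro allI impI)
  fix S :: "'v set" assume S: "finite S"
  have "{A \<in> \<R>. A \<inter> S \<noteq> {}} \<subseteq> (\<lambda>s. THE A. A \<in> \<R> \<and> s \<in> A) ` S"
  proof
    fix A assume "A \<in> {A \<in> \<R>. A \<inter> S \<noteq> {}}"
    then obtain s where s: "A \<in> \<R>" "s \<in> A" "s \<in> S" by blast
    have "(THE A. A \<in> \<R> \<and> s \<in> A) = A"
    proof (rule the_equality)
      show "B = A" if "B \<in> \<R> \<and> s \<in> B" for B
        using disjointD[OF \<R>(2), of A B] s that by blast
    qed (use s in blast)
    then show "A \<in> (\<lambda>s. THE A. A \<in> \<R> \<and> s \<in> A) ` S" using s(3) by blast
  qed
  then have fin: "finite {A \<in> \<R>. A \<inter> S \<noteq> {}}" using S finite_surj by blast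
  have finA: "finite (A - side S x)" if AR: "A \<in> \<R>" for A
  proof -
    obtain y where y: "eqv y x" "A = range y" using \<R>(1)[OF AR] by auto
    then have "side S y = side S x" "y \<in> rays" using S unfolding eqv_def by auto
    then have "has_tail_in y (side S x)" using side(2)[of y S] S by simp
    then obtain N where "y ` {N..} \<subseteq> side S x" unfolding has_tail_in_def by blast
    then have "A - side S x \<subseteq> y ` {..<N}" unfolding y(2) by (force simp: not_less)
    then show ?thesis using finite_subset by blast
  qed
  have "A \<subseteq> side S x" if AR: "A \<in> \<R>" and AS: "A \<inter> S = {}" for A
  proof -
    obtain y where y: "eqv y x" "A = range y" using \<R>(1)[OF AR] by auto
    then have r: "side S y = side S x" "y \<in> rays" using S unfolding eqv_def by auto
    have "conn A" using conn_ray_tail[OF r(2), of 0] y(2) by (simp add: atLeast_0)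
    moreover have "frequently_in y A" unfolding frequently_in_def y(2) by blast
    ultimately show ?thesis using side_absorb_freq[OF r(2) S _ AS] r(1) by simp
  qed
  then have "\<Union>\<R> - side S x \<subseteq> (\<Union>A\<in>{A \<in> \<R>. A \<inter> S \<noteq> {}}. A - side S x)" by fastforce
  moreover have "finite (\<Union>A\<in>{A \<in> \<R>. A \<inter> S \<noteq> {}}. A - side S x)"
    using fin finA by (intro finite_UN_I) auto
  ultimately show "finite (\<Union>\<R> - side S x)" by (rule finite_subset)
qed

lemma maximal_disjoint_rays:
  obtains \<R> where "\<And>A. A \<in> \<R> \<Longrightarrow> \<exists>y. eqv y x \<and> A = range y \<and> A \<subseteq> C" "disjoint \<R>"
    "\<And>y. eqv y x \<Longrightarrow> range y \<subseteq> C \<Longrightarrow> range y \<inter> \<Union>\<R> \<noteq> {}"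
proof -
  define \<P> where "\<P> = {\<R>. (\<forall>A\<in>\<R>. \<exists>y. eqv y x \<and> A = range y \<and> A \<subseteq> C) \<and> disjoint \<R>}"
  have "\<exists>M\<in>\<P>. \<forall>X\<in>\<P>. M \<subseteq> X \<longrightarrow> X = M"
  proof (rule subset_Zorn')
    fix \<C> assume c: "subset.chain \<P> \<C>"
    then have sub: "\<C> \<subseteq> \<P>" and ch: "\<And>X Y. X \<in> \<C> \<Longrightarrow> Y \<in> \<C> \<Longrightarrow> X \<subseteq> Y \<or> Y \<subseteq> X"
      unfolding subset.chain_def by auto
    have "disjoint (\<Union>\<C>)"
      unfolding disjoint_def
    proof (intro ballI impI)
      fix A B assume "A \<in> \<Union>\<C>" "B \<in> \<Union>\<C>" "A \<noteq> B"
      then obtain X Y where XY: "X \<in> \<C>" "Y \<in> \<C>" "A \<in> X" "B \<in> Y" by blast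
      then obtain Z where "Z \<in> \<C>" "A \<in> Z" "B \<in> Z" using ch[OF XY(1,2)] by blast
      then show "A \<inter> B = {}" using sub \<open>A \<noteq> B\<close> disjointD unfolding \<P>_def by blast
    qed
    then show "\<Union>\<C> \<in> \<P>" using sub unfolding \<P>_def by blast
  qed
  then obtain \<R> where \<R>: "\<R> \<in> \<P>" "\<And>X. X \<in> \<P> \<Longrightarrow> \<R> \<subseteq> X \<Longrightarrow> X = \<R>" by blast
  show ?thesis
  proof (rule that[of \<R>])
    show "\<exists>y. eqv y x \<and> A = range y \<and> A \<subseteq> C" if "A \<in> \<R>" for A
      using \<R>(1) that unfolding \<P>_def by blast
    show dis: "disjoint \<R>" using \<R>(1) unfolding \<P>_def by blast
    fix y assume y: "eqv y x" "range y \<subseteq> C"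
    show "range y \<inter> \<Union>\<R> \<noteq> {}"
    proof
      assume e: "range y \<inter> \<Union>\<R> = {}"
      have "disjoint (insert (range y) \<R>)"
        unfolding disjoint_def
      proof (intro ballI impI)
        fix A B assume AB: "A \<in> insert (range y) \<R>" "B \<in> insert (range y) \<R>" "A \<noteq> B"
        consider "A \<in> \<R>" "B \<in> \<R>" | "A = range y" "B \<in> \<R>" | "B = range y" "A \<in> \<R>"
          using AB by blast
        then show "A \<inter> B = {}" using disjointD[OF dis _ _ AB(3)] e by cases blast+
      qed
      then have "insert (range y) \<R> \<in> \<P>" using \<R>(1) y unfolding \<P>_def by blast
      then have "range y \<in> \<R>" using \<R>(2) by blast
      then show False using e by blast
    qed
  qed
qed

text \<open>When \<open>nb C\<close> is finite or converges to an end, the core is the ancestor hull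
  of a suitable seed: hulls are connected, and converge or are finite whenever the seed does or is.
  The root is put into the seed so that the hull is nonempty even if \<open>nb C\<close> is
  empty.\<close>

lemma is_core_ex:
  assumes cC: "conn C" "C \<noteq> {}"
  shows "\<exists>U. is_core C U"
proof -
  obtain r where r: "r \<in> C" using cC by blast
  obtain p and d :: "'v \<Rightarrow> nat" where pd: "p r = r" "\<And>v. v \<in> C \<Longrightarrow> p v \<in> C"
    "\<And>v. v \<in> C \<Longrightarrow> v \<noteq> r \<Longrightarrow> {v, p v} \<in> E \<and> d (p v) < d v"
    using spanning_tree[OF cC(1) r] by metis
  interpret rooted V E C r p d
    by unfold_locales (use pd r conn_subset[OF cC(1)] in auto)
  have "\<forall>k\<in>nb C. \<exists>h. h \<in> C \<and> {k, h} \<in> E" unfolding nb_def by blast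
  then obtain h where h: "\<And>k. k \<in> nb C \<Longrightarrow> h k \<in> C \<and> {k, h k} \<in> E" by metis
  define H where "H = insert r (h ` nb C)"
  have HC: "H \<subseteq> C" unfolding H_def using r h by blast
  have adj: "\<forall>x\<in>nb C. \<exists>u\<in>U. {x, u} \<in> E" if "H \<subseteq> U" for U
    using h that unfolding H_def by blast
  consider "finite (nb C)" | "infinite (nb C)" "\<exists>x\<in>rays. conc (nb C) x"
    | "infinite (nb C)" "\<not> (\<exists>x\<in>rays. conc (nb C) x)" by blast
  then show ?thesis
  proof cases
    case 1
    have fin: "finite (tree_hull H)" by (rule finite_tree_hull[OF HC]) (simp add: H_def 1)
    have "finite (nb D)" if "D \<in> comps (C - tree_hull H)" for D
      using finite_subset[OF nb_comps_Diff[OF that]] 1 fin by blast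
    then have "is_core C (tree_hull H)"
      unfolding is_core_def
      using tree_hull_subset[OF HC] conn_tree_hull[OF HC] adj[OF tree_hull_superset] fin 1 tree_hull_superset[of H]
      by (auto simp: H_def)
    then show ?thesis by blast
  next
    case 3
    \<comment> \<open>Cores have to exist for all connected sets because they enter the construction
      of the pieces. That a piece never falls into this case is known only after
      \<open>node_nb\<close>.\<close>
    then have "is_core C C"
      unfolding is_core_def using cC adj[OF HC] by simp
    then show ?thesis by blast
  next
    case 2
    then obtain x where x: "x \<in> rays" "conc (nb C) x" by blast
    obtain \<R> where \<R>: "\<And>A. A \<in> \<R> \<Longrightarrow> \<exists>y. eqv y x \<and> A = range y \<and> A \<subseteq> C" "disjoint \<R>"
      "\<And>y. eqv y x \<Longrightarrow> range y \<subseteq> C \<Longrightarrow> range y \<inter> \<Union>\<R> \<noteq> {}"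
      using maximal_disjoint_rays[of x C] by metis
    define U0 where "U0 = {w. dominates w x} \<inter> C \<union> \<Union>\<R> \<union> H"
    have U0C: "U0 \<subseteq> C" using \<R>(1) HC unfolding U0_def by blast
    have "conc H x"
      unfolding conc_def
    proof (intro allI impI)
      fix S :: "'v set" assume S: "finite S"
      have "H - side S x \<subseteq> insert r (S \<union> h ` (nb C - side S x))"
      proof
        fix v assume v: "v \<in> H - side S x"
        show "v \<in> insert r (S \<union> h ` (nb C - side S x))"
        proof (cases "v = r \<or> v \<in> S")
          case False
          then obtain k where k: "k \<in> nb C" "v = h k" using v unfolding H_def by blast
          then have "k \<notin> side S x" using side_closed[OF x(1) S, of k v] h[OF k(1)] v False by blast
          then show ?thesis using k by blast
        qed blast
      qed
      moreover have "finite (nb C - side S x)" using x(2) S unfolding conc_def by blast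
      ultimately show "finite (H - side S x)" using S finite_subset by blast
    qed
    moreover have "conc (\<Union>\<R>) x" by (rule conc_disjoint_rays[OF x(1) _ \<R>(2)]) (use \<R>(1) in blast)
    ultimately have cU0: "conc U0 x"
      using conc_subset[OF conc_dominating[OF x(1)] Int_lower1] unfolding U0_def by (intro conc_Un)
    define U where "U = tree_hull U0"
    have cU: "conc U x" unfolding U_def by (rule conc_tree_hull[OF U0C cU0 x(1)])
    have U0U: "U0 \<subseteq> U" unfolding U_def by (rule tree_hull_superset)
    then have HU: "H \<subseteq> U" unfolding U0_def by blast
    have fin: "finite (nb D)" if D: "D \<in> comps (C - U)" for D
    proof (rule ccontr)
      assume inf: "infinite (nb D)"
      have cD: "conn D" by (rule conn_comps[OF _ D]) (use C(1) in blast)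
      have DC: "D \<subseteq> C - U" by (rule comps_subset[OF D])
      have "conc (nb D) x"
        by (rule conc_subset[OF conc_Un[OF cU x(2)] nb_comps_Diff[OF D]])
      then consider w where "w \<in> D" "dominates w x" | y where "eqv y x" "range y \<subseteq> D"
        using star_comb[OF x(1) cD inf] by blast
      then show False
      proof cases
        case 1
        then have "w \<in> U0" unfolding U0_def using DC by blast
        then show False using 1 DC U0U by blast
      next
        case 2
        then have "range y \<inter> \<Union>\<R> \<noteq> {}" by (intro \<R>(3)) (use DC in blast)+
        then show False using 2 DC U0U unfolding U0_def by blast
      qed
    qed
    \<comment> \<open>The clause speaks of all rays to which \<open>nb C\<close> converges, but an
      infinite set has only one limit end.\<close>
    have "conc U y" if "y \<in> rays" "conc (nb C) y" for y
    proof -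
      have "eqv x y" by (rule conc_eqv[OF x(2) that(2) 2(1) x(1) that(1)])
      then show ?thesis using cU unfolding conc_def eqv_def by simp
    qed
    then have "is_core C U"
      unfolding is_core_def
      using 2(1) tree_hull_subset[OF U0C] conn_tree_hull[OF U0C] adj[OF HU] fin HU
      unfolding U_def[symmetric] H_def by blast
    then show ?thesis by blast
  qed
qed

end

section \<open>The decomposition tree of a graph\<close>

context sgraph begin

definition core :: "'v set \<Rightarrow> 'v set" where
  "core C = (SOME U. is_core C U)"

text \<open>The factor \<open>V\<close> gives the value for \<open>Z = {}\<close>, so that the
  components of the graph become the roots.\<close>

definition rest :: "'v set set \<Rightarrow> 'v set" where
  "rest Z = V \<inter> (\<Inter>A\<in>Z. A - core A)"

text \<open>Transfinite recursion without ordinals: \<open>Z\<close> may be any set of pieces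
  already obtained, not only a chain. \<open>node_rest\<close> recovers the canonical choice, all
  pieces properly above \<open>D\<close>.\<close>

inductive_set nodes :: "'v set set" where
  node: "(\<And>A. A \<in> Z \<Longrightarrow> A \<in> nodes) \<Longrightarrow> D \<in> comps (rest Z) \<Longrightarrow> D \<in> nodes"

definition up :: "'v set \<Rightarrow> 'v set set" where
  "up D = {A \<in> nodes. D \<subset> A}"

lemma node_props:
  assumes "D \<in> nodes"
  shows node_conn: "conn D" and node_ne: "D \<noteq> {}" and node_V: "D \<subseteq> V" and node_core: "is_core D (core D)"
proof -
  have "conn D \<and> D \<noteq> {}"
    using assms
  proof cases
    case (node Z)
    have "rest Z \<subseteq> V" unfolding rest_def by blast
    then show ?thesis using conn_comps[OF _ node(2)] comps_nonempty[OF node(2)] by blast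
  qed
  then show "conn D" "D \<noteq> {}" by auto
  then show "is_core D (core D)" unfolding core_def using is_core_ex someI_ex by metis
  show "D \<subseteq> V" using conn_subset[OF \<open>conn D\<close>] .
qed

lemma core_props:
  assumes "D \<in> nodes"
  shows core_subset: "core D \<subseteq> D" and core_ne: "core D \<noteq> {}" and core_conn: "conn (core D)"
    and core_adj: "\<And>x. x \<in> nb D \<Longrightarrow> \<exists>u\<in>core D. {x, u} \<in> E"
  using node_core[OF assms] unfolding is_core_def by auto

lemma rest_subset: "A \<in> Z \<Longrightarrow> rest Z \<subseteq> A - core A"
  unfolding rest_def by blast

text \<open>Double induction over the generation, as in comparability proofs for well-ordered
  chains. In a counterexample every \<open>B\<close> in \<open>Z'\<close> must have \<open>D\<close>
  inside \<open>B - core B\<close>, so \<open>D\<close> lies in \<open>rest Z'\<close> and, being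
  connected and meeting the component \<open>A\<close>, in \<open>A\<close>. Symmetrically
  \<open>A\<close> lies in \<open>D\<close>, so they are equal.\<close>

lemma nodes_trichotomy:
  assumes "D \<in> nodes" "A \<in> nodes"
  shows "D = A \<or> D \<subseteq> A - core A \<or> A \<subseteq> D - core D \<or> D \<inter> A = {}"
  using assms
proof (induction D arbitrary: A)
  case (node Z D)
  note outer = node.IH and D = node.hyps(2)
  have nD: "D \<in> nodes" using nodes.node node.hyps by blast
  show ?case using node.prems
  proof (induction A)
    case (node Z' A)
    note A = node.hyps(2)
    have nA: "A \<in> nodes" using nodes.node node.hyps by blast
    show ?case
    proof (rule ccontr)
      assume contra: "\<not> ?thesis"
      have sub: "D \<subseteq> B - core B" if B: "B \<in> Z'" for B
      proof -
        have AB: "A \<subseteq> B - core B" using comps_subset[OF A] rest_subset[OF B] by blast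
        have "D = B \<or> D \<subseteq> B - core B \<or> B \<subseteq> D - core D \<or> D \<inter> B = {}" by (rule node.IH[OF B])
        then show ?thesis using AB contra by blast
      qed
      have "D \<subseteq> rest Z'" unfolding rest_def using sub node_V[OF nD] by blast
      then have 1: "D \<subseteq> A"
        by (intro conn_subset_comps[OF node_conn[OF nD] _ A]) (use contra in blast)+
      have sub': "A \<subseteq> B - core B" if B: "B \<in> Z" for B
      proof -
        have DB: "D \<subseteq> B - core B" using comps_subset[OF D] rest_subset[OF B] by blast
        have "B = A \<or> B \<subseteq> A - core A \<or> A \<subseteq> B - core B \<or> B \<inter> A = {}" by (rule outer[OF B nA])
        then show ?thesis using DB contra by blast
      qed
      have "A \<subseteq> rest Z" unfolding rest_def using sub' node_V[OF nA] by blast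
      then have "A \<subseteq> D"
        by (intro conn_subset_comps[OF node_conn[OF nA] _ D]) (use contra in blast)+
      with 1 contra show False by blast
    qed
  qed
qed

lemma node_less: "D \<in> nodes \<Longrightarrow> A \<in> nodes \<Longrightarrow> D \<subset> A \<Longrightarrow> D \<subseteq> A - core A"
  using nodes_trichotomy[of D A] node_ne[of D] by blast

lemma node_nested: "D \<in> nodes \<Longrightarrow> A \<in> nodes \<Longrightarrow> v \<in> D \<Longrightarrow> v \<in> A \<Longrightarrow> D \<subseteq> A \<or> A \<subseteq> D"
  using nodes_trichotomy[of D A] by blast

lemma node_rest:
  assumes D: "D \<in> nodes"
  shows "D \<in> comps (rest (up D))"
  using D
proof cases
  case (node Z)
  have "A \<in> up D" if A: "A \<in> Z" for A
    using comps_subset[OF node(2)] rest_subset[OF A] core_subset[of A] core_ne[of A] node(1)[OF A]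
    unfolding up_def by blast
  then have sub: "rest (up D) \<subseteq> rest Z" unfolding rest_def by blast
  have "D \<subseteq> A - core A" if "A \<in> up D" for A using node_less[OF D] that unfolding up_def by blast
  then have "D \<subseteq> rest (up D)" unfolding rest_def using node_V[OF D] by blast
  then obtain D' where D': "D' \<in> comps (rest (up D))" "D \<subseteq> D'"
    using conn_in_comps[OF node_conn[OF D] _ node_ne[OF D]] by blast
  have V: "rest (up D) \<subseteq> V" unfolding rest_def by blast
  have "D' \<subseteq> D"
    by (rule conn_subset_comps[OF conn_comps[OF V D'(1)] _ node(2)])
      (use comps_subset[OF D'(1)] sub D'(2) node_ne[OF D] in blast)+
  then show ?thesis using D' by simp
qed

text \<open>Let \<open>Z\<close> be the pieces that contain all of \<open>M\<close> off their cores.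
  The component of \<open>rest Z\<close> at \<open>v\<close> is a piece \<open>A\<close> containing
  all of \<open>M\<close>. If it were not in \<open>M\<close>, it would belong to \<open>Z\<close>
  and thus avoid its own core. Reverse inclusion is thereby well-founded.\<close>

lemma node_max:
  assumes M: "M \<subseteq> nodes" "M \<noteq> {}" "\<And>D. D \<in> M \<Longrightarrow> v \<in> D"
  shows "\<exists>A\<in>M. \<forall>D\<in>M. D \<subseteq> A"
proof -
  define Z where "Z = {A \<in> nodes. \<forall>D\<in>M. D \<subseteq> A - core A}"
  have sub: "D \<subseteq> rest Z" if "D \<in> M" for D
    using that node_V[of D] M(1) unfolding rest_def Z_def by blast
  obtain D0 where "D0 \<in> M" using M(2) by blast
  then have "v \<in> rest Z" using sub M(3) by blast
  then obtain A where A: "A \<in> comps (rest Z)" "v \<in> A" using comps_cover by blast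
  have nA: "A \<in> nodes" by (rule nodes.node[OF _ A(1)]) (simp add: Z_def)
  have le: "D \<subseteq> A" if "D \<in> M" for D
    by (rule conn_subset_comps[OF node_conn sub A(1)]) (use that M A in blast)+
  have "A \<in> M"
  proof (rule ccontr)
    assume "A \<notin> M"
    then have "D \<subseteq> A - core A" if "D \<in> M" for D
      using node_less[of D A] le[OF that] that M(1) nA by blast
    then have "A \<in> Z" unfolding Z_def using nA by blast
    then have "A \<subseteq> A - core A" using comps_subset[OF A(1)] rest_subset by blast
    then show False using core_subset[OF nA] core_ne[OF nA] by blast
  qed
  then show ?thesis using le by blast
qed

lemma node_induct [consumes 1, case_names less]:
  assumes "D \<in> nodes"
    and step: "\<And>D. D \<in> nodes \<Longrightarrow> (\<And>A. A \<in> nodes \<Longrightarrow> D \<subset> A \<Longrightarrow> P A) \<Longrightarrow> P D"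
  shows "P D"
proof (rule ccontr)
  assume no: "\<not> P D"
  obtain v where v: "v \<in> D" using node_ne[OF assms(1)] by blast
  have "\<exists>A\<in>{A \<in> nodes. D \<subseteq> A \<and> \<not> P A}. \<forall>B\<in>{A \<in> nodes. D \<subseteq> A \<and> \<not> P A}. B \<subseteq> A"
    by (rule node_max[of _ v]) (use no assms(1) v in auto)
  then obtain A where "A \<in> nodes" "D \<subseteq> A" "\<not> P A"
      "\<And>B. B \<in> nodes \<Longrightarrow> D \<subseteq> B \<Longrightarrow> \<not> P B \<Longrightarrow> B \<subseteq> A" by auto
  then show False using step[of A] by (meson psubset_imp_subset psubsetD subset_not_subset_eq order_trans psubsetE)
qed

text \<open>Take the largest piece \<open>A\<close> above \<open>D\<close> for which
  \<open>x\<close> is not in \<open>A - core A\<close>. All larger pieces keep \<open>x\<close>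
  after removal of their cores, so \<open>x\<close> is in \<open>rest (up A)\<close>; its edge to
  \<open>D\<close> puts it into the component \<open>A\<close>, and so into
  \<open>core A\<close>.\<close>

lemma nb_in_core:
  assumes D: "D \<in> nodes" and x: "x \<in> nb D"
  shows "\<exists>A\<in>up D. x \<in> core A"
proof -
  obtain d where d: "d \<in> D" "{x, d} \<in> E" "x \<notin> D" using x unfolding nb_def by blast
  have xV: "x \<in> V" by (rule edgeD(1)[OF d(2)])
  define M where "M = {A \<in> up D. x \<notin> A - core A}"
  have "x \<notin> rest (up D)" using comps_nb[OF node_rest[OF D]] x by blast
  then have "M \<noteq> {}" unfolding M_def rest_def using xV by blast
  then have "\<exists>A\<in>M. \<forall>D\<in>M. D \<subseteq> A"
    by (intro node_max[of M d]) (use d in \<open>auto simp: M_def up_def\<close>)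
  then obtain A where A: "A \<in> M" "\<And>B. B \<in> M \<Longrightarrow> B \<subseteq> A" by blast
  then have nA: "A \<in> nodes" "D \<subset> A" unfolding M_def up_def by auto
  have "x \<in> B - core B" if "B \<in> up A" for B
  proof -
    have "A \<subset> B" "B \<in> up D" using that nA unfolding up_def by auto
    then have "B \<notin> M" using A(2)[of B] by blast
    then show ?thesis using \<open>B \<in> up D\<close> unfolding M_def by blast
  qed
  then have "x \<in> rest (up A)" unfolding rest_def using xV by blast
  then have "x \<in> A"
    by (intro comps_closed[OF node_rest[OF nA(1)] _ edge_sym[OF d(2)]]) (use d(1) nA(2) in blast)+
  then show ?thesis using A(1) unfolding M_def by blast
qed

section \<open>Chains of pieces without least element and rays along their removed cores\<close>

definition branch :: "'v set set \<Rightarrow> bool" where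
  "branch P \<longleftrightarrow> P \<subseteq> nodes \<and> P \<noteq> {} \<and> (\<forall>A\<in>P. \<forall>B\<in>nodes. A \<subseteq> B \<longrightarrow> B \<in> P) \<and>
     (\<forall>A\<in>P. \<forall>B\<in>P. A \<subseteq> B \<or> B \<subseteq> A) \<and> (\<forall>A\<in>P. \<exists>B\<in>P. B \<subset> A)"

definition spine :: "'v set set \<Rightarrow> 'v set" where
  "spine P = (\<Union>A\<in>P. core A)"

definition along :: "(nat \<Rightarrow> 'v) \<Rightarrow> 'v set set \<Rightarrow> bool" where
  "along x P \<longleftrightarrow> x \<in> rays \<and> (\<forall>A\<in>P. has_tail_in x (spine P \<inter> A))"

text \<open>A node at a limit level: no least piece lies properly above it. Roots do not count,
  since a branch is nonempty.\<close>

definition limit :: "'v set \<Rightarrow> bool" where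
  "limit C \<longleftrightarrow> C \<in> nodes \<and> branch (up C)"

lemma branchD:
  assumes "branch P"
  shows "A \<in> P \<Longrightarrow> A \<in> nodes" "P \<noteq> {}" "A \<in> P \<Longrightarrow> B \<in> nodes \<Longrightarrow> A \<subseteq> B \<Longrightarrow> B \<in> P"
    "A \<in> P \<Longrightarrow> B \<in> P \<Longrightarrow> A \<subseteq> B \<or> B \<subseteq> A" "A \<in> P \<Longrightarrow> \<exists>B\<in>P. B \<subset> A"
proof -
  note P = assms[unfolded branch_def]
  show "A \<in> P \<Longrightarrow> A \<in> nodes" using P by (meson subsetD)
  show "P \<noteq> {}" using P by (elim conjE)
  show "A \<in> P \<Longrightarrow> B \<in> nodes \<Longrightarrow> A \<subseteq> B \<Longrightarrow> B \<in> P" using P by metis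
  show "A \<in> P \<Longrightarrow> B \<in> P \<Longrightarrow> A \<subseteq> B \<or> B \<subseteq> A" using P by metis
  show "A \<in> P \<Longrightarrow> \<exists>B\<in>P. B \<subset> A" using P by metis
qed

lemma up_chain: "C \<in> nodes \<Longrightarrow> A \<in> up C \<Longrightarrow> B \<in> up C \<Longrightarrow> A \<subseteq> B \<or> B \<subseteq> A"
  using node_ne[of C] node_nested[of A B] unfolding up_def by blast

lemma limit_iff: "limit C \<longleftrightarrow> C \<in> nodes \<and> up C \<noteq> {} \<and> (\<forall>A\<in>up C. \<exists>B\<in>up C. B \<subset> A)"
proof -
  have "\<forall>A\<in>up C. \<forall>B\<in>up C. A \<subseteq> B \<or> B \<subseteq> A" if "C \<in> nodes" using up_chain[OF that] by blast
  moreover have "up C \<subseteq> nodes" "\<forall>A\<in>up C. \<forall>B\<in>nodes. A \<subseteq> B \<longrightarrow> B \<in> up C" unfolding up_def by blast+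
  ultimately show ?thesis unfolding limit_def branch_def by meson
qed

lemma core_in_node:
  assumes "A \<in> nodes" "B \<in> nodes" "x \<in> core B" "x \<in> A"
  shows "B \<subseteq> A"
proof -
  have "x \<in> B" using core_subset[OF assms(2)] assms(3) by blast
  then consider "B \<subseteq> A" | "A \<subset> B" using node_nested[OF assms(1,2,4)] by blast
  then show ?thesis
  proof cases
    case 2
    then show ?thesis using node_less[OF assms(1,2)] assms(3,4) by blast
  qed
qed

text \<open>The cores of pieces \<open>B\<close> inside \<open>A\<close> are attached one by one,
  from large to small: \<open>B\<close> has a neighbour in the connected set \<open>A\<close>, this
  neighbour lies in the core of a piece strictly between \<open>B\<close> and \<open>A\<close> or
  equal to \<open>A\<close>, and \<open>core B\<close> is adjacent to it.\<close>

lemma conn_spine: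
  assumes P: "branch P" and A: "A \<in> P"
  shows "conn (spine P \<inter> A)"
proof -
  have nA: "A \<in> nodes" by (rule branchD(1)[OF P A])
  obtain a where a: "a \<in> core A" using core_ne[OF nA] by blast
  have *: "\<forall>v\<in>core B. (a, v) \<in> (R (spine P \<inter> A))\<^sup>*" if "B \<in> nodes" "B \<in> P" "B \<subseteq> A" for B
    using that
  proof (induction B rule: node_induct)
    case (less B)
    have sub: "core B \<subseteq> spine P \<inter> A"
      using core_subset[OF less(1)] less.prems unfolding spine_def by blast
    have cB: "(u, v) \<in> (R (spine P \<inter> A))\<^sup>*" if "u \<in> core B" "v \<in> core B" for u v
      by (rule R_mono[OF sub connD[OF core_conn[OF less(1)] that]])
    show ?case
    proof (cases "B = A")
      case True
      then show ?thesis using cB a by blast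
    next
      case False
      then obtain x where x: "x \<in> nb B" "x \<in> A"
        using conn_nb[OF node_conn[OF nA], of B] less.prems node_ne[OF less(1)] by blast
      obtain B' where B': "B' \<in> up B" "x \<in> core B'" using nb_in_core[OF less(1) x(1)] by blast
      then have nB': "B' \<in> nodes" "B \<subset> B'" unfolding up_def by auto
      have "B' \<in> P" using branchD(3)[OF P less.prems(1) nB'(1)] nB'(2) by blast
      moreover have "B' \<subseteq> A" by (rule core_in_node[OF nA nB'(1) B'(2) x(2)])
      ultimately have ax: "(a, x) \<in> (R (spine P \<inter> A))\<^sup>*" "x \<in> spine P"
        using less.IH[OF nB'] B'(2) unfolding spine_def by blast+
      obtain u where u: "u \<in> core B" "{x, u} \<in> E" using core_adj[OF less(1) x(1)] by blast
      have "(x, u) \<in> (R (spine P \<inter> A))\<^sup>*" by (rule R_step[OF u(2)]) (use ax x u sub in auto)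
      then have "(a, u) \<in> (R (spine P \<inter> A))\<^sup>*" using ax(1) by (rule rtrancl_trans[rotated])
      then show ?thesis using cB[OF u(1)] by (meson rtrancl_trans)
    qed
  qed
  show ?thesis
  proof (rule connI[of _ a])
    show "spine P \<inter> A \<subseteq> V" using node_V[OF nA] by blast
    fix v assume "v \<in> spine P \<inter> A"
    then obtain B where B: "B \<in> P" "v \<in> core B" "v \<in> A" unfolding spine_def by blast
    have "B \<subseteq> A" by (rule core_in_node[OF nA branchD(1)[OF P B(1)] B(2,3)])
    then show "(a, v) \<in> (R (spine P \<inter> A))\<^sup>*" using * branchD(1)[OF P B(1)] B by blast
  qed
qed

lemma spine_Inter: "branch P \<Longrightarrow> spine P \<inter> \<Inter>P = {}"
proof -
  assume P: "branch P"
  have "v \<notin> \<Inter>P" if v: "A \<in> P" "v \<in> core A" for v A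
  proof -
    obtain B where "B \<in> P" "B \<subset> A" using branchD(5)[OF P v(1)] by blast
    then have "v \<notin> B" using node_less[of B A] branchD(1)[OF P] v by blast
    then show ?thesis using \<open>B \<in> P\<close> by blast
  qed
  then show ?thesis unfolding spine_def by blast
qed

lemma branch_finite:
  assumes P: "branch P" "A0 \<in> P" and S: "finite S"
  shows "\<exists>A\<in>P. A \<subseteq> A0 \<and> S \<inter> A \<subseteq> \<Inter>P"
  using S
proof induction
  case empty
  then show ?case using P by blast
next
  case (insert v S)
  then obtain A where A: "A \<in> P" "A \<subseteq> A0" "S \<inter> A \<subseteq> \<Inter>P" by blast
  show ?case
  proof (cases "v \<in> \<Inter>P")
    case True
    then have "insert v S \<inter> A \<subseteq> \<Inter>P" using A(3) by fastforce
    then show ?thesis using A(1,2) by blast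
  next
    case False
    then obtain B where B: "B \<in> P" "v \<notin> B" by blast
    consider "A \<subseteq> B" | "B \<subseteq> A" using branchD(4)[OF P(1) A(1) B(1)] by blast
    then show ?thesis
    proof cases
      case 1
      then show ?thesis using A B(2) by (intro bexI[of _ A]) auto
    next
      case 2
      have "S \<inter> B \<subseteq> \<Inter>P" using 2 A(3) by (meson Int_mono order_refl order_trans)
      then have "insert v S \<inter> B \<subseteq> \<Inter>P" using B(2) by simp
      then show ?thesis using 2 A(2) B(1) by (intro bexI[of _ B]) auto
    qed
  qed
qed

text \<open>With a countable cofinal sequence the parts of the spine form a decreasing sequence of
  connected sets, and every vertex drops out because the spine avoids
  \<open>\<Inter>P\<close>.\<close>

lemma branch_ray:
  assumes P: "branch P" and g: "\<And>n::nat. g n \<in> P" "\<And>A. A \<in> P \<Longrightarrow> \<exists>n. g n \<subseteq> A"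
  shows "\<exists>x. along x P"
proof -
  \<comment> \<open>Finite intersections make the sequence decreasing; within a chain they are again
    members.\<close>
  define A where "A n = (\<Inter>i\<in>{..n}. g i)" for n
  have AP: "A n \<in> P" for n
  proof (induction n)
    case 0 then show ?case using g by (simp add: A_def)
  next
    case (Suc n)
    have "A (Suc n) = g (Suc n) \<inter> A n" by (simp add: A_def atMost_Suc)
    then show ?case using branchD(4)[OF P Suc g(1)[of "Suc n"]] Suc g(1)[of "Suc n"]
      by (metis inf.absorb1 inf.absorb2)
  qed
  have "\<exists>x\<in>rays. \<forall>n. has_tail_in x (spine P \<inter> A n)"
  proof (rule decseq_conn_ray)
    show "decseq (\<lambda>n. spine P \<inter> A n)" unfolding decseq_def A_def by fastforce
    show "conn (spine P \<inter> A n)" for n by (rule conn_spine[OF P AP])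
    show "spine P \<inter> A n \<noteq> {}" for n
      using core_ne[OF branchD(1)[OF P AP]] core_subset[OF branchD(1)[OF P AP]] AP[of n]
      unfolding spine_def by blast
    fix v
    show "\<exists>n. v \<notin> spine P \<inter> A n"
    proof (cases "v \<in> spine P")
      case True
      then obtain B where "B \<in> P" "v \<notin> B" using spine_Inter[OF P] by blast
      then obtain n where "g n \<subseteq> B" using g(2) by blast
      then have "v \<notin> A n" using \<open>v \<notin> B\<close> unfolding A_def by auto
      then show ?thesis by blast
    qed blast
  qed
  then obtain x where x: "x \<in> rays" "\<And>n. has_tail_in x (spine P \<inter> A n)" by blast
  have "has_tail_in x (spine P \<inter> B)" if B: "B \<in> P" for B
  proof -
    obtain n where "g n \<subseteq> B" using g(2)[OF B] by blast
    then have "spine P \<inter> A n \<subseteq> spine P \<inter> B" unfolding A_def by auto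
    then show ?thesis by (rule has_tail_in_mono[OF x(2)])
  qed
  then show ?thesis unfolding along_def using x(1) by blast
qed

text \<open>The part of the spine inside \<open>A\<close> is connected, avoids \<open>S\<close> and
  contains a tail of \<open>x\<close>, so all of it lies on one side.\<close>

lemma along_side:
  assumes "branch P" "along x P" "A \<in> P" "finite S" "S \<inter> A \<subseteq> \<Inter>P"
  shows "spine P \<inter> A \<subseteq> side S x"
proof (rule side_absorb_freq)
  show "x \<in> rays" "frequently_in x (spine P \<inter> A)"
    using assms(2,3) tail_frequently_in unfolding along_def by auto
  show "conn (spine P \<inter> A)" by (rule conn_spine) fact+
  show "spine P \<inter> A \<inter> S = {}" using spine_Inter[OF assms(1)] assms(5) by blast
qed fact

text \<open>All neighbours of \<open>C\<close> lie on the spine and all but finitely many lie inside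
  any given \<open>A\<close>; for \<open>A\<close> deep enough these are on the side of
  \<open>x\<close>.\<close>

lemma along_conc_nb:
  assumes "limit C" "\<And>A. A \<in> up C \<Longrightarrow> finite (nb C - A)" "along x (up C)"
  shows "conc (nb C) x"
  unfolding conc_def
proof (intro allI impI)
  fix S :: "'v set" assume S: "finite S"
  have C: "C \<in> nodes" "branch (up C)" using assms(1) unfolding limit_def by auto
  obtain A0 where "A0 \<in> up C" using branchD(2)[OF C(2)] by blast
  then obtain A where A: "A \<in> up C" "S \<inter> A \<subseteq> \<Inter>(up C)"
    using branch_finite[OF C(2) _ S] by blast
  have "nb C \<subseteq> spine (up C)" using nb_in_core[OF C(1)] unfolding spine_def by blast
  then have "nb C - side S x \<subseteq> nb C - A"
    using along_side[OF C(2) assms(3) A(1) S A(2)] by blast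
  then show "finite (nb C - side S x)" using assms(2)[OF A(1)] by (rule finite_subset)
qed

section \<open>Successor pieces and the size of neighbourhoods\<close>

lemma child:
  assumes A: "A \<in> nodes" and D: "D \<in> comps (A - core A)"
  shows "D \<in> nodes" "D \<subset> A" "\<And>B. B \<in> nodes \<Longrightarrow> D \<subset> B \<Longrightarrow> A \<subseteq> B"
proof -
  have "rest (insert A (up A)) = A - core A"
    using node_V[OF A] node_less[OF A] unfolding rest_def up_def by auto
  then have D': "D \<in> comps (rest (insert A (up A)))" using D by simp
  show nD: "D \<in> nodes"
  proof (rule nodes.node[OF _ D'])
    show "B \<in> nodes" if "B \<in> insert A (up A)" for B
      using that A by (auto simp add: up_def)
  qed
  show DA: "D \<subset> A" using comps_subset[OF D] core_subset[OF A] core_ne[OF A] by blast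
  fix B assume B: "B \<in> nodes" "D \<subset> B"
  show "A \<subseteq> B"
  proof (rule ccontr)
    assume "\<not> A \<subseteq> B"
    then have "B \<subset> A" using node_nested[OF A B(1)] node_ne[OF nD] DA B(2) by blast
    then have "B \<subseteq> A - core A" by (rule node_less[OF B(1) A])
    then have "B \<subseteq> D"
      by (intro conn_subset_comps[OF node_conn[OF B(1)] _ D]) (use B(2) node_ne[OF nD] in blast)+
    then show False using B(2) by blast
  qed
qed

lemma child_not_limit:
  assumes A: "A \<in> nodes" and D: "D \<in> comps (A - core A)"
  shows "\<not> limit D"
proof
  assume "limit D"
  moreover have "A \<in> up D" using A child(2)[OF assms] unfolding up_def by blast
  ultimately obtain B where B: "B \<in> up D" "B \<subset> A" unfolding limit_iff by meson
  then have "A \<subseteq> B" by (intro child(3)[OF assms]) (simp_all add: up_def)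
  then show False using B(2) by blast
qed

lemma child_towards:
  assumes A: "A \<in> nodes" and C: "C \<in> nodes" "C \<subset> A"
  shows "\<exists>D\<in>comps (A - core A). C \<subseteq> D"
  using conn_in_comps[OF node_conn[OF C(1)] node_less[OF C(1) A C(2)] node_ne[OF C(1)]] .

lemma parent:
  assumes C: "C \<in> nodes" "up C \<noteq> {}" "\<not> limit C"
  shows "\<exists>A\<in>nodes. C \<in> comps (A - core A)"
proof -
  obtain A where A: "A \<in> up C" "\<And>B. B \<in> up C \<Longrightarrow> \<not> B \<subset> A" using C unfolding limit_iff by blast
  then have nA: "A \<in> nodes" "C \<subset> A" unfolding up_def by auto
  have le: "A \<subseteq> B" if "B \<in> up C" for B using up_chain[OF C(1) A(1) that] A(2)[OF that] by blast
  have "A - core A \<subseteq> B - core B" if "B \<in> up C" for B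
    using le[OF that] node_less[OF nA(1), of B] that unfolding up_def by blast
  then have "rest (up C) = A - core A" using A(1) node_V[OF nA(1)] unfolding rest_def by blast
  then show ?thesis using node_rest[OF C(1)] nA by auto
qed

text \<open>The invariant of the decomposition, proved from larger to smaller pieces. A successor
  gets its finite neighbourhood from the core of its parent, whose own neighbourhood is finite or
  converges to an end by induction. For a limit piece, connectedness of the pieces above yields
  neighbours arbitrarily deep.\<close>

theorem node_nb:
  assumes "C \<in> nodes"
  shows "(\<not> limit C \<longrightarrow> finite (nb C)) \<and> (limit C \<longrightarrow> infinite (nb C) \<and>
     (\<forall>A\<in>up C. finite (nb C - A)) \<and> (\<exists>x. along x (up C)))"
  using assms
proof (induction C rule: node_induct)
  case (less C)
  have nonlimit: "finite (nb C)" if nl: "\<not> limit C"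
  proof (cases "up C = {}")
    case True
    then have "C \<in> comps V" using node_rest[OF less(1)] unfolding rest_def by simp
    then have "nb C = {}" using comps_nb_V[of C "{}"] by auto
    then show ?thesis by simp
  next
    case False
    then obtain A where A: "A \<in> nodes" "C \<in> comps (A - core A)" using parent[OF less(1) _ nl] by blast
    have IH: "(\<not> limit A \<longrightarrow> finite (nb A)) \<and> (limit A \<longrightarrow> infinite (nb A) \<and>
     (\<forall>B\<in>up A. finite (nb A - B)) \<and> (\<exists>x. along x (up A)))"
      by (rule less.IH[OF A(1) child(2)[OF A]])
    have "finite (nb A) \<or> (\<exists>x\<in>rays. conc (nb A) x)"
    proof (cases "limit A")
      case True
      then obtain x where x: "along x (up A)" using IH by blast
      then have "conc (nb A) x" using along_conc_nb[OF True] IH True by blast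
      then show ?thesis using x unfolding along_def by blast
    qed (use IH in blast)
    then show ?thesis using node_core[OF A(1)] A(2) unfolding is_core_def by blast
  qed
  have lim: "infinite (nb C) \<and> (\<forall>A\<in>up C. finite (nb C - A)) \<and> (\<exists>x. along x (up C))" if l: "limit C"
  proof -
    have br: "branch (up C)" using l unfolding limit_def by blast
    have fin: "finite (nb C - A)" if A: "A \<in> up C" for A
    proof -
      have nA: "A \<in> nodes" "C \<subset> A" using A unfolding up_def by auto
      \<comment> \<open>The successor of \<open>A\<close> towards \<open>C\<close> is covered by the
        induction hypothesis, and it separates \<open>C\<close> from everything outside
        \<open>A\<close> by a finite set.\<close>
      obtain D where D: "D \<in> comps (A - core A)" "C \<subseteq> D" using child_towards[OF nA(1) less(1) nA(2)] by blast
      have "D \<noteq> C" using child_not_limit[OF nA(1) D(1)] l by blast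
      then have "finite (nb D)"
        using less.IH[OF child(1)[OF nA(1) D(1)]] D(2) child_not_limit[OF nA(1) D(1)] by blast
      moreover have "nb C - A \<subseteq> nb D" using D(2) child(2)[OF nA(1) D(1)] unfolding nb_def by blast
      ultimately show ?thesis using finite_subset by blast
    qed
    have inf: "infinite (nb C)"
    proof
      assume f: "finite (nb C)"
      obtain A0 where "A0 \<in> up C" using branchD(2)[OF br] by blast
      then obtain A where A: "A \<in> up C" "nb C \<inter> A \<subseteq> \<Inter>(up C)" using branch_finite[OF br _ f] by blast
      have "C \<subset> A" "A \<in> nodes" using A(1) unfolding up_def by auto
      then obtain x where x: "x \<in> nb C" "x \<in> A"
        using conn_nb[OF node_conn, of A C] node_ne[OF less(1)] by blast
      then have "x \<in> spine (up C)" using nb_in_core[OF less(1)] unfolding spine_def by blast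
      then show False using spine_Inter[OF br] x A(2) by blast
    qed
    \<comment> \<open>Countably many neighbours suffice: only finitely many lie outside a given
      \<open>A\<close>, so the pieces whose cores contain them become arbitrarily small.\<close>
    obtain k :: "nat \<Rightarrow> 'v" where k: "inj k" "range k \<subseteq> nb C"
      using infinite_countable_subset[OF inf] by blast
    have "\<forall>n. \<exists>A. A \<in> up C \<and> k n \<in> core A" using nb_in_core[OF less(1)] k(2) by blast
    then obtain g where g: "\<And>n. g n \<in> up C \<and> k n \<in> core (g n)" by metis
    have "\<exists>x. along x (up C)"
    proof (rule branch_ray[OF br, of g])
      show "g n \<in> up C" for n using g by blast
      fix A assume A: "A \<in> up C"
      have "infinite (range k)" using k(1) by (rule range_inj_infinite)
      then have "\<not> range k \<subseteq> nb C - A" using fin[OF A] finite_subset by blast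
      then obtain n where "k n \<in> A" using k(2) by blast
      then have "g n \<subseteq> A"
        using core_in_node[of A "g n" "k n"] g[of n] A unfolding up_def by blast
      then show "\<exists>n. g n \<subseteq> A" by blast
    qed
    then show ?thesis using inf fin by blast
  qed
  show ?case using nonlimit lim by blast
qed

end

text \<open>A key names an earlier item and a tag, and the colour encodes the colour of that item
  and the tag. Equal nonzero colours can therefore be unwound; the successor reserves 0 for items
  without key.\<close>

lemma wf_coloring:
  assumes "wf R" "\<And>C T n. key C = Some (T, n) \<Longrightarrow> (T, C) \<in> R"
  obtains c :: "'k \<Rightarrow> nat" where
    "\<And>C. c C = (case key C of None \<Rightarrow> 0 | Some (T, n) \<Rightarrow> Suc (prod_encode (c T, n)))"
proof -
  define H where "H f C = (case key C of None \<Rightarrow> 0 | Some (T, n) \<Rightarrow> Suc (prod_encode (f T, n)))"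
    for f :: "'k \<Rightarrow> nat" and C
  have eq: "wfrec R H C = H (wfrec R H) C" for C
  proof -
    have "wfrec R H C = H (cut (wfrec R H) R C) C" by (rule wfrec[OF assms(1)])
    also have "\<dots> = H (wfrec R H) C"
      unfolding H_def using assms(2)[of C] by (auto split: option.splits simp: cut_apply)
    finally show ?thesis .
  qed
  show ?thesis by (rule that[OF eq[unfolded H_def]])
qed

section \<open>A countable colouring of the non-limit pieces\<close>

context sgraph begin

lemma parent_unique:
  assumes "A \<in> nodes" "D \<in> comps (A - core A)" "B \<in> nodes" "D \<in> comps (B - core B)"
  shows "A = B"
  using child(3)[OF assms(1,2,3) child(2)[OF assms(3,4)]]
    child(3)[OF assms(3,4,1) child(2)[OF assms(1,2)]] by (rule subset_antisym)

lemma limit_node: "limit C \<Longrightarrow> C \<in> nodes"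
  unfolding limit_def by simp

lemma finite_nb_child:
  assumes "A \<in> nodes" "D \<in> comps (A - core A)" shows "finite (nb D)"
  using node_nb[OF child(1)[OF assms]] child_not_limit[OF assms] by blast

text \<open>A neighbour \<open>k\<close> of \<open>A\<close> outside \<open>F\<close> lies in the
  core of some \<open>B\<close> above \<open>A\<close>. The successor of \<open>B\<close> towards
  \<open>A\<close> is a non-limit piece that already has \<open>k\<close> as a neighbour, and its
  finite neighbourhood gives \<open>k\<close> a number.\<close>

lemma limit_pick:
  assumes A: "limit A" and F: "finite F"
  shows "\<exists>T k. T \<in> nodes \<and> \<not> limit T \<and> A \<subseteq> T \<and> k \<in> nb A \<and> k \<notin> F \<and> k \<in> nb T"
proof -
  have nA: "A \<in> nodes" by (rule limit_node[OF A])
  have "infinite (nb A)" using node_nb[OF nA] A by blast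
  then have "\<not> nb A \<subseteq> F" using F finite_subset by blast
  then obtain k where k: "k \<in> nb A" "k \<notin> F" by blast
  obtain B where B: "B \<in> up A" "k \<in> core B" using nb_in_core[OF nA k(1)] by blast
  then have nB: "B \<in> nodes" "A \<subset> B" unfolding up_def by auto
  obtain T where T: "T \<in> comps (B - core B)" "A \<subseteq> T" using child_towards[OF nB(1) nA nB(2)] by blast
  have "k \<notin> T" using comps_subset[OF T(1)] B(2) by blast
  then have "k \<in> nb T" using k(1) T(2) unfolding nb_def by blast
  then show ?thesis using child(1)[OF nB(1) T(1)] child_not_limit[OF nB(1) T(1)] T(2) k by blast
qed

text \<open>The colour of a child \<open>C\<close> of a limit node \<open>A\<close> is read off a vertex of \<open>nb A\<close> outside \<open>nb C\<close>:
  no limit node inside \<open>C\<close> has this vertex in its neighbourhood.\<close>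

lemma node_coloring:
  obtains c :: "'v set \<Rightarrow> nat" where
    "\<And>C D. C \<in> nodes \<Longrightarrow> \<not> limit C \<Longrightarrow> D \<in> nodes \<Longrightarrow> \<not> limit D \<Longrightarrow> D \<subset> C \<Longrightarrow> c C \<noteq> c D"
    "\<And>A D D'. limit A \<Longrightarrow> D \<in> comps (A - core A) \<Longrightarrow> D' \<in> comps (A - core A) \<Longrightarrow> nb D = nb D' \<Longrightarrow> c D = c D'"
proof -
  obtain T0 k0 where tk: "\<And>A F. limit A \<Longrightarrow> finite F \<Longrightarrow> T0 A F \<in> nodes \<and> \<not> limit (T0 A F) \<and>
      A \<subseteq> T0 A F \<and> k0 A F \<in> nb A \<and> k0 A F \<notin> F \<and> k0 A F \<in> nb (T0 A F)"
    using limit_pick by metis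
  have "\<exists>f :: 'v \<Rightarrow> nat. finite (nb T) \<longrightarrow> inj_on f (nb T)" for T
    using finite_imp_inj_to_nat_seg[of "nb T"] by metis
  then obtain f :: "'v set \<Rightarrow> 'v \<Rightarrow> nat" where f: "\<And>T. finite (nb T) \<Longrightarrow> inj_on (f T) (nb T)" by metis
  define p where "p C = (SOME A. A \<in> nodes \<and> C \<in> comps (A - core A))" for C
  have p: "p C = A" if "A \<in> nodes" "C \<in> comps (A - core A)" for A C
    unfolding p_def
  proof (rule some_equality)
    show "B = A" if "B \<in> nodes \<and> C \<in> comps (B - core B)" for B
      using parent_unique[of B C A] that \<open>A \<in> nodes\<close> \<open>C \<in> comps (A - core A)\<close> by blast
  qed (use that in blast)
  have p': "p C \<in> nodes \<and> C \<in> comps (p C - core (p C))" if C: "C \<in> nodes" "up C \<noteq> {}" "\<not> limit C" for C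
  proof -
    obtain A where "A \<in> nodes" "C \<in> comps (A - core A)" using parent[OF C] by blast
    then show ?thesis using p by simp
  qed
  \<comment> \<open>Below a non-limit parent the tag is 0. Below a limit parent the tag is the
    number of the picked vertex in \<open>nb (T0 _ _)\<close>, shifted by one to stay apart from 0;
    it depends only on the parent and \<open>nb C\<close>, so grouped siblings share it.\<close>
  define key where "key C = (if C \<notin> nodes \<or> limit C \<or> up C = {} then None
     else if limit (p C) then Some (T0 (p C) (nb C), Suc (f (T0 (p C) (nb C)) (k0 (p C) (nb C))))
     else Some (p C, 0))" for C
  define R where "R = {(A, D). A \<in> nodes \<and> D \<in> nodes \<and> D \<subset> A}"
  have "wf R"
    unfolding wf_def
  proof (intro allI impI)
    fix Q and D assume step: "\<forall>x. (\<forall>y. (y, x) \<in> R \<longrightarrow> Q y) \<longrightarrow> Q x"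
    have "Q D" if "D \<in> nodes" for D
      using that by (induction D rule: node_induct) (use step in \<open>auto simp: R_def\<close>)
    moreover have "Q D" if "D \<notin> nodes" using step that unfolding R_def by blast
    ultimately show "Q D" by blast
  qed
  have fnb: "finite (nb C)" if "C \<in> nodes" "\<not> limit C" for C using node_nb that by blast
  have keyT: "T \<in> nodes \<and> \<not> limit T \<and> C \<subset> T \<and> C \<in> nodes \<and> \<not> limit C \<and> up C \<noteq> {}" if k: "key C = Some (T, n)" for C T n
  proof -
    have C: "C \<in> nodes" "\<not> limit C" "up C \<noteq> {}" using k unfolding key_def by (auto split: if_splits)
    note pC = p'[OF C(1,3,2)]
    have sub: "C \<subset> p C" using child(2) pC by blast
    show ?thesis
    proof (cases "limit (p C)")
      case True
      then have "T = T0 (p C) (nb C)" using k C unfolding key_def by simp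
      then show ?thesis using tk[OF True fnb[OF C(1,2)]] sub C by blast
    next
      case False
      then have "T = p C" using k C unfolding key_def by simp
      then show ?thesis using False pC sub C by blast
    qed
  qed
  obtain c where c: "\<And>C. c C = (case key C of None \<Rightarrow> 0 | Some (T, n) \<Rightarrow> Suc (prod_encode (c T, n)))"
    using wf_coloring[OF \<open>wf R\<close>, of key] keyT unfolding R_def by blast
  \<comment> \<open>With tag 0 both pieces are successors of one parent, hence disjoint or equal.
    Otherwise both pick the same vertex; it is a neighbour of \<open>p D\<close>, which is contained
    in \<open>C\<close>, and lies outside \<open>C\<close>, so it belongs to \<open>nb C\<close>,
    which its choice for \<open>C\<close> excludes.\<close>
  have key_diff: "key C \<noteq> key D" if CD: "D \<subset> C" "key D = Some (T, n)" for C D T n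
  proof
    assume eq: "key C = key D"
    then have kC: "key C = Some (T, n)" using CD by simp
    note C = keyT[OF kC] and D = keyT[OF CD(2)]
    have pC: "p C \<in> nodes" "C \<in> comps (p C - core (p C))" using p'[of C] C by auto
    have pD: "p D \<in> nodes" "D \<in> comps (p D - core (p D))" using p'[of D] D by auto
    show False
    proof (cases n)
      case 0
      then have "p C = p D" using kC CD(2) C D unfolding key_def by (auto split: if_splits)
      then show False using comps_disjoint[of C _ D] pC pD CD(1) comps_nonempty[OF pD(2)] by auto
    next
      case (Suc i)
      then have l: "limit (p C)" "limit (p D)" "T = T0 (p C) (nb C)" "T = T0 (p D) (nb D)"
        "f T (k0 (p C) (nb C)) = f T (k0 (p D) (nb D))"
        using kC CD(2) C D unfolding key_def by (auto split: if_splits)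
      have fC: "finite (nb C)" and fD: "finite (nb D)" and fT: "finite (nb T)" using fnb C D by blast+
      have kk: "k0 (p C) (nb C) = k0 (p D) (nb D)"
        using inj_onD[OF f[OF fT] l(5)] tk[OF l(1) fC] tk[OF l(2) fD] l(3,4) by auto
      have sub: "p D \<subseteq> C" by (rule child(3)[OF pD]) (use C CD in auto)
      have "k0 (p C) (nb C) \<notin> C" using tk[OF l(1) fC] child(2)[OF pC] unfolding nb_def by blast
      then have "k0 (p D) (nb D) \<in> nb C" using tk[OF l(2) fD] sub kk unfolding nb_def by auto
      then show False using tk[OF l(1) fC] kk by simp
    qed
  qed
  \<comment> \<open>If comparable pieces had equal colours, the pieces named in their keys would
    both contain \<open>D\<close> and have equal colours, so they coincide by induction, and with
    them the keys.\<close>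
  have inj: "\<forall>C. C \<in> nodes \<longrightarrow> \<not> limit C \<longrightarrow> \<not> limit D \<longrightarrow> D \<subset> C \<longrightarrow> c C \<noteq> c D" if "D \<in> nodes" for D
    using that
  proof (induction D rule: node_induct)
    case (less D)
    show ?case
    proof (intro allI impI notI)
      fix C assume C: "C \<in> nodes" "\<not> limit C" "\<not> limit D" "D \<subset> C" "c C = c D"
      have "up D \<noteq> {}" using C unfolding up_def by blast
      then have "key D \<noteq> None" using less(1) C unfolding key_def by simp
      then obtain T n where D: "key D = Some (T, n)" by auto
      then have "c C \<noteq> 0" using c[of D] C by simp
      then have "key C \<noteq> None" using c[of C] by (auto split: option.splits)
      then obtain T' n' where C': "key C = Some (T', n')" by auto
      have "c T = c T'" "n = n'" using c[of C] c[of D] C(5) D C' by auto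
      note kT = keyT[OF D] and kT' = keyT[OF C']
      have DT': "D \<subset> T'" using kT' C(4) by blast
      have "T \<subseteq> T' \<or> T' \<subseteq> T" using node_nested[of T T'] kT kT' DT' node_ne[OF less(1)] by blast
      then have "T = T'" using less.IH[of T] less.IH[of T'] kT kT' DT' \<open>c T = c T'\<close>
        by (metis psubsetI)
      then show False using key_diff[OF C(4) D] D C' \<open>n = n'\<close> by simp
    qed
  qed
  show ?thesis
  proof (rule that[of c])
    show "c C \<noteq> c D" if "C \<in> nodes" "\<not> limit C" "D \<in> nodes" "\<not> limit D" "D \<subset> C" for C D
      using inj that by blast
    fix A D D' assume *: "limit A" "D \<in> comps (A - core A)" "D' \<in> comps (A - core A)" "nb D = nb D'"
    note nA = limit_node[OF *(1)]
    have key: "key D = Some (T0 A (nb D), Suc (f (T0 A (nb D)) (k0 A (nb D))))" if "D \<in> comps (A - core A)" for D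
    proof -
      have "A \<in> up D" using nA child(2)[OF nA that] unfolding up_def by blast
      then show ?thesis
        unfolding key_def using p[OF nA that] *(1) child(1)[OF nA that] child_not_limit[OF nA that] by auto
    qed
    show "c D = c D'" using c[of D] c[of D'] key[OF *(2)] key[OF *(3)] *(4) by simp
  qed
qed

text \<open>The colouring is injective on the non-limit pieces of a branch, and these are cofinal
  because every step down passes through a successor. Hence the branch has a countable cofinal
  sequence.\<close>

lemma branch_along:
  assumes P: "branch P" shows "\<exists>x. along x P"
proof -
  obtain c :: "'v set \<Rightarrow> nat" where
    c: "\<And>C D. C \<in> nodes \<Longrightarrow> \<not> limit C \<Longrightarrow> D \<in> nodes \<Longrightarrow> \<not> limit D \<Longrightarrow> D \<subset> C \<Longrightarrow> c C \<noteq> c D"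
    using node_coloring by metis
  obtain A0 where A0: "A0 \<in> P" using branchD(2)[OF P] by blast
  \<comment> \<open>\<open>g n\<close> is the piece of colour \<open>n\<close> on the branch;
    colours that do not occur get the arbitrary member \<open>A0\<close>.\<close>
  define g where "g n = (if \<exists>D\<in>P. \<not> limit D \<and> c D = n then SOME D. D \<in> P \<and> \<not> limit D \<and> c D = n else A0)" for n
  have g: "g n \<in> P \<and> \<not> limit (g n) \<and> c (g n) = n" if "\<exists>D\<in>P. \<not> limit D \<and> c D = n" for n
  proof -
    have "\<exists>D. D \<in> P \<and> \<not> limit D \<and> c D = n" using that by blast
    from someI_ex[OF this] show ?thesis using that unfolding g_def by simp
  qed
  have gc: "g (c D) = D" if D: "D \<in> P" "\<not> limit D" for D
  proof -
    have gD: "g (c D) \<in> P" "\<not> limit (g (c D))" "c (g (c D)) = c D" using g[of "c D"] D by blast+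
    have "\<not> g (c D) \<subset> D" "\<not> D \<subset> g (c D)"
      using c[of D "g (c D)"] c[of "g (c D)" D] gD D branchD(1)[OF P] by metis+
    then show ?thesis using branchD(4)[OF P gD(1) D(1)] by blast
  qed
  show ?thesis
  proof (rule branch_ray[OF P, of g])
    show "g n \<in> P" for n using g[of n] A0 by (cases "\<exists>D\<in>P. \<not> limit D \<and> c D = n") (auto simp: g_def)
    fix A assume A: "A \<in> P"
    then obtain B where B: "B \<in> P" "B \<subset> A" using branchD(5)[OF P] by blast
    note nA = branchD(1)[OF P A] and nB = branchD(1)[OF P B(1)]
    obtain D where D: "D \<in> comps (A - core A)" "B \<subseteq> D" using child_towards[OF nA nB B(2)] by blast
    have "D \<in> P" by (rule branchD(3)[OF P B(1) child(1)[OF nA D(1)] D(2)])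
    then have "g (c D) \<subseteq> A" using gc child_not_limit[OF nA D(1)] child(2)[OF nA D(1)] by auto
    then show "\<exists>n. g n \<subseteq> A" by blast
  qed
qed

lemma branch_limit:
  assumes P: "branch P" and C: "C \<in> comps (\<Inter>P)"
  shows "limit C" "up C = P"
proof -
  have "rest P = \<Inter>P"
  proof
    show "rest P \<subseteq> \<Inter>P" using rest_subset[of _ P] by blast
    show "\<Inter>P \<subseteq> rest P"
    proof
      fix v assume v: "v \<in> \<Inter>P"
      have "v \<in> A - core A" if "A \<in> P" for A
        using v that spine_Inter[OF P] unfolding spine_def by blast
      moreover have "v \<in> V" using v branchD(1,2)[OF P] node_V by blast
      ultimately show "v \<in> rest P" unfolding rest_def by blast
    qed
  qed
  then have nC: "C \<in> nodes" using nodes.node[of P C] C branchD(1)[OF P] by simp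
  have CP: "C \<subset> A" if "A \<in> P" for A
    using branchD(5)[OF P that] comps_subset[OF C] by blast
  show up: "up C = P"
  proof (intro equalityI subsetI)
    show "A \<in> up C" if "A \<in> P" for A using CP[OF that] branchD(1)[OF P that] unfolding up_def by blast
    fix A assume "A \<in> up C"
    then have A: "A \<in> nodes" "C \<subset> A" unfolding up_def by auto
    show "A \<in> P"
    proof (rule ccontr)
      assume no: "A \<notin> P"
      have "A \<subseteq> B" if B: "B \<in> P" for B
      proof -
        have "\<not> B \<subseteq> A" using branchD(3)[OF P B A(1)] no by blast
        then show ?thesis
          using node_nested[OF A(1) branchD(1)[OF P B]] CP[OF B] A(2) node_ne[OF nC] by blast
      qed
      then have "A \<subseteq> \<Inter>P" by blast
      then have "A \<subseteq> C" using A(2) node_ne[OF nC] by (intro conn_subset_comps[OF node_conn[OF A(1)] _ C]) auto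
      then show False using A(2) by blast
    qed
  qed
  show "limit C" unfolding limit_def using nC P up by simp
qed

section \<open>The branch that a ray follows\<close>

lemma conc_core:
  assumes "limit C" "along x (up C)"
  shows "conc (core C) x"
proof -
  note nC = limit_node[OF assms(1)]
  have "conc (nb C) x" by (rule along_conc_nb[OF assms(1) _ assms(2)]) (use node_nb[OF nC] assms(1) in blast)
  moreover have "infinite (nb C)" using node_nb[OF nC] assms(1) by blast
  moreover have "x \<in> rays" using assms(2) unfolding along_def by blast
  ultimately show ?thesis using node_core[OF nC] unfolding is_core_def by blast
qed

lemma along_freq_spine:
  assumes P: "branch P" and y: "along y P" and x: "x \<in> rays" "\<And>A. A \<in> P \<Longrightarrow> has_tail_in x A"
    and freq: "frequently_in x (spine P)"
  shows "eqv x y"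
  unfolding eqv_def
proof (intro conjI allI impI)
  show yr: "y \<in> rays" using y unfolding along_def by blast
  fix S :: "'v set" assume S: "finite S"
  obtain A0 where "A0 \<in> P" using branchD(2)[OF P] by blast
  then obtain A where A: "A \<in> P" "S \<inter> A \<subseteq> \<Inter>P" using branch_finite[OF P _ S] by blast
  have "frequently_in x (spine P \<inter> A)" by (rule frequently_tail_Int[OF freq x(2)[OF A(1)]])
  then have "frequently_in x (side S y)"
    by (rule frequently_in_mono) (rule along_side[OF P y A(1) S A(2)])
  then show "side S x = side S y" by (rule side_eqI2[OF x(1) yr S])
qed fact

text \<open>The detour through a non-limit \<open>C\<close> matters: finite neighbourhoods make the
  tail condition depend on the end only, whereas a ray may stay in the core of a limit piece, which
  would then be a least piece containing a tail.\<close>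

definition branch_of :: "(nat \<Rightarrow> 'v) \<Rightarrow> 'v set set" where
  "branch_of x = {A \<in> nodes. \<exists>C\<in>nodes. \<not> limit C \<and> C \<subseteq> A \<and> has_tail_in x C}"

lemma branch_of_tail: "A \<in> branch_of x \<Longrightarrow> has_tail_in x A"
  unfolding branch_of_def using has_tail_in_mono by blast

text \<open>There is no least piece: a non-limit piece has finite neighbourhood and hence a finite
  core, so the ray leaves the core and settles in a successor.\<close>

lemma branch_of:
  assumes x: "x \<in> rays"
  shows "branch (branch_of x)"
  unfolding branch_def
proof (intro conjI ballI impI)
  show "branch_of x \<subseteq> nodes" unfolding branch_of_def by blast
  have "has_tail_in x V" using ray_inV[OF x] unfolding has_tail_in_def by blast
  then obtain C where C: "C \<in> comps V" "has_tail_in x C" using ray_tail_in_comps[OF x] by blast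
  then have nC: "C \<in> nodes" using nodes.node[of "{}" C] unfolding rest_def by simp
  have "A \<subseteq> C" if "A \<in> nodes" "C \<subseteq> A" for A
    by (rule conn_subset_comps[OF node_conn[OF that(1)] node_V[OF that(1)] C(1)])
      (use that(2) node_ne[OF nC] in blast)
  then have "up C = {}" unfolding up_def by blast
  then have "\<not> limit C" unfolding limit_iff by simp
  then have "C \<in> branch_of x" unfolding branch_of_def using nC C(2) by blast
  then show "branch_of x \<noteq> {}" by blast
next
  fix A B assume "A \<in> branch_of x" "B \<in> nodes" "A \<subseteq> B"
  then show "B \<in> branch_of x" unfolding branch_of_def by (auto intro: order_trans)
next
  fix A B assume AB: "A \<in> branch_of x" "B \<in> branch_of x"
  then obtain n where "x n \<in> A" "x n \<in> B"
    using has_tail_in_ex[OF has_tail_in_Int[OF branch_of_tail branch_of_tail]] by blast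
  then show "A \<subseteq> B \<or> B \<subseteq> A" using node_nested[of A B] AB unfolding branch_of_def by blast
next
  fix A assume "A \<in> branch_of x"
  then obtain C where C: "C \<in> nodes" "\<not> limit C" "C \<subseteq> A" "has_tail_in x C"
    unfolding branch_of_def by blast
  have "finite (nb C)" using node_nb[OF C(1)] C(2) by blast
  then have "finite (core C)" using node_core[OF C(1)] unfolding is_core_def by blast
  then have "has_tail_in x (- core C)" using ray_avoid[OF x] unfolding has_tail_in_def by blast
  then have t: "has_tail_in x (C - core C)" using has_tail_in_Int[OF C(4)] by (simp add: Diff_eq)
  obtain D where D: "D \<in> comps (C - core C)" "has_tail_in x D"
    using ray_tail_in_comps[OF x t] node_V[OF C(1)] by blast
  have "D \<in> branch_of x" unfolding branch_of_def
    using child(1)[OF C(1) D(1)] child_not_limit[OF C(1) D(1)] D(2) by blast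
  then show "\<exists>B\<in>branch_of x. B \<subset> A" using child(2)[OF C(1) D(1)] C(3) by blast
qed

lemma nb_subset_spine:
  assumes P: "branch P" and A: "A \<in> P" shows "nb A \<subseteq> spine P"
proof
  fix x assume "x \<in> nb A"
  then obtain B where B: "B \<in> up A" "x \<in> core B" using nb_in_core[OF branchD(1)[OF P A]] by blast
  then have "B \<in> P" using branchD(3)[OF P A, of B] unfolding up_def by blast
  then show "x \<in> spine P" using B(2) unfolding spine_def by blast
qed

lemma conn_subset_Inter:
  assumes P: "branch P" and D: "conn D" "D \<inter> spine P = {}" "\<And>A. A \<in> P \<Longrightarrow> D \<inter> A \<noteq> {}"
  shows "D \<subseteq> \<Inter>P"
proof
  fix v assume v: "v \<in> D"
  have "D \<subseteq> A" if "A \<in> P" for A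
    by (rule conn_absorb[OF D(1) D(3)[OF that]]) (use nb_subset_spine[OF P that] D(2) in blast)
  then show "v \<in> \<Inter>P" using v by blast
qed

text \<open>If \<open>x\<close> were not equivalent to \<open>y\<close>, it would finally leave the
  spine and settle in a component \<open>C\<close> of \<open>\<Inter>(branch_of x)\<close>, a limit
  piece. The core of \<open>C\<close> converges to \<open>y\<close>, so \<open>x\<close> leaves that
  as well and settles in a successor of \<open>C\<close>, which then belongs to the branch although
  it lies properly below all of it.\<close>

lemma branch_of_eqv:
  assumes x: "x \<in> rays" and y: "along y (branch_of x)"
  shows "eqv x y"
proof (rule ccontr)
  assume no: "\<not> eqv x y"
  let ?P = "branch_of x"
  note P = branch_of[OF x]
  have yr: "y \<in> rays" using y unfolding along_def by blast
  have "\<not> frequently_in x (spine ?P)"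
    using along_freq_spine[OF P y x branch_of_tail] no by blast
  then obtain N where N: "\<forall>n\<ge>N. x n \<notin> spine ?P" unfolding frequently_in_def by blast
  have "x ` {N..} \<subseteq> \<Inter>?P"
  proof (rule conn_subset_Inter[OF P conn_ray_tail[OF x]])
    show "x ` {N..} \<inter> spine ?P = {}" using N by auto
    fix A assume "A \<in> ?P"
    then obtain M where "x ` {M..} \<subseteq> A" using branch_of_tail unfolding has_tail_in_def by blast
    then have "x (max M N) \<in> x ` {N..} \<inter> A" by auto
    then show "x ` {N..} \<inter> A \<noteq> {}" by blast
  qed
  then have t: "has_tail_in x (\<Inter>?P)" unfolding has_tail_in_def by blast
  have "\<Inter>?P \<subseteq> V" using branchD(1,2)[OF P] node_V by blast
  then obtain C where C: "C \<in> comps (\<Inter>?P)" "has_tail_in x C" using ray_tail_in_comps[OF x t] by blast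
  note lC = branch_limit[OF P C(1)]
  note nC = limit_node[OF lC(1)]
  have "conc (core C) y" using conc_core[OF lC(1)] y lC(2) by simp
  then have "\<not> frequently_in x (core C)" using conc_freq[OF _ yr x] no by blast
  then have "has_tail_in x (- core C)" using not_has_tail_in[of x "- core C"] by simp
  then have t: "has_tail_in x (C - core C)" using has_tail_in_Int[OF C(2)] by (simp add: Diff_eq)
  obtain D where D: "D \<in> comps (C - core C)" "has_tail_in x D"
    using ray_tail_in_comps[OF x t] node_V[OF nC] by blast
  have "D \<in> ?P" unfolding branch_of_def
    using child(1)[OF nC D(1)] child_not_limit[OF nC D(1)] D(2) by blast
  then show False using child(2)[OF nC D(1)] comps_subset[OF C(1)] by blast
qed

end

section \<open>The topology of the end space\<close>

context sgraph begin

definition cls :: "(nat \<Rightarrow> 'v) \<Rightarrow> (nat \<Rightarrow> 'v) set" where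
  "cls x = {y. eqv x y}"

definition ends :: "'v set \<Rightarrow> (nat \<Rightarrow> 'v) set set" where
  "ends U = cls ` {x \<in> rays. has_tail_in x U}"

section \<open>Open sets of the end space in terms of rays\<close>

lemma cls_eq_iff: "x \<in> rays \<Longrightarrow> y \<in> rays \<Longrightarrow> cls x = cls y \<longleftrightarrow> eqv x y"
  unfolding cls_def eqv_def by (auto simp: set_eq_iff)

lemma graph_ends_eq: "graph_ends V E = cls ` rays"
proof -
  have "ray_equiv V E `` {x} = cls x" for x
    unfolding cls_def using ray_equiv_iff by auto
  then show ?thesis unfolding graph_ends_def quotient_def by auto
qed

lemma side_mono:
  assumes xy: "x \<in> rays" "y \<in> rays" and S: "finite S'" "S \<subseteq> S'" and eq: "side S' x = side S' y"
  shows "side S x = side S y"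
proof -
  have fS: "finite S" using S finite_subset by blast
  have "side S' y \<subseteq> side S y"
    by (rule side_absorb_freq[OF xy(2) fS side_conn[OF xy(2) S(1)] _ tail_frequently_in[OF side(2)[OF xy(2) S(1)]]])
      (use side_subset[OF xy(2) S(1)] S(2) in blast)
  then have "has_tail_in x (side S y)"
    using has_tail_in_mono[OF side(2)[OF xy(1) S(1)]] eq by simp
  then show ?thesis by (intro side_eqI2[OF xy fS] tail_frequently_in)
qed

lemma end_component_cls:
  assumes x: "x \<in> rays" and S: "finite S"
  shows "end_component V E S (cls x) = side S x"
  unfolding end_component_def components_avoiding_eq
proof (rule the_equality)
  have "has_tail_in y (side S x)" if "y \<in> cls x" for y
  proof -
    have "y \<in> rays" "side S x = side S y" using that S unfolding cls_def eqv_def by auto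
    then show ?thesis using side(2)[of y S] S by simp
  qed
  then show "side S x \<in> comps (V - S) \<and> (\<forall>y\<in>cls x. has_tail_in y (side S x))"
    using side(1)[OF x S] by blast
  fix C assume C: "C \<in> comps (V - S) \<and> (\<forall>y\<in>cls x. has_tail_in y C)"
  then have "has_tail_in x C" using eqv_refl[OF x] unfolding cls_def by blast
  then have "side S x = C" using C by (intro side_eqI[OF x S] tail_frequently_in) auto
  then show "C = side S x" by simp
qed

lemma ends_in_same_component_cls:
  assumes x: "x \<in> rays" and S: "finite S"
  shows "ends_in_same_component V E S (cls x) = cls ` {y \<in> rays. side S y = side S x}"
  unfolding ends_in_same_component_def graph_ends_eq
  using end_component_cls[OF _ S] x by auto

lemma openin_end_space:
  "openin (end_space V E) U \<longleftrightarrow> U \<subseteq> cls ` rays \<and>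
     (\<forall>x\<in>rays. cls x \<in> U \<longrightarrow> (\<exists>S. finite S \<and> (\<forall>y\<in>rays. side S y = side S x \<longrightarrow> cls y \<in> U)))"
    (is "_ \<longleftrightarrow> ?R U")
proof
  let ?B = "{ends_in_same_component V E S \<omega> |S \<omega>. finite S \<and> S \<subseteq> V \<and> \<omega> \<in> graph_ends V E}"
  assume "openin (end_space V E) U"
  then have "generate_topology_on ?B U"
    unfolding end_space_def openin_topology_generated_by_iff .
  then show "?R U"
  proof induction
    case (Int a b)
    show ?case
    proof (intro conjI ballI impI)
      fix x assume x: "x \<in> rays" "cls x \<in> a \<inter> b"
      obtain S where S: "finite S" "\<forall>y\<in>rays. side S y = side S x \<longrightarrow> cls y \<in> a"
        using Int.IH(1) x by blast
      obtain S' where S': "finite S'" "\<forall>y\<in>rays. side S' y = side S' x \<longrightarrow> cls y \<in> b"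
        using Int.IH(2) x by blast
      have "cls y \<in> a \<inter> b" if y: "y \<in> rays" "side (S \<union> S') y = side (S \<union> S') x" for y
        using side_mono[OF y(1) x(1), of "S \<union> S'"] S S' y by blast
      then show "\<exists>S. finite S \<and> (\<forall>y\<in>rays. side S y = side S x \<longrightarrow> cls y \<in> a \<inter> b)"
        using S(1) S'(1) by (intro exI[of _ "S \<union> S'"]) blast
    qed (use Int.IH in blast)
  next
    case (UN K)
    show ?case
    proof (intro conjI ballI impI)
      show "\<Union>K \<subseteq> cls ` rays" using UN.IH by blast
      fix x assume x: "x \<in> rays" "cls x \<in> \<Union>K"
      then obtain k where k: "k \<in> K" "cls x \<in> k" by blast
      then obtain S where "finite S" "\<forall>y\<in>rays. side S y = side S x \<longrightarrow> cls y \<in> k"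
        using UN.IH[OF k(1)] x(1) by blast
      then show "\<exists>S. finite S \<and> (\<forall>y\<in>rays. side S y = side S x \<longrightarrow> cls y \<in> \<Union>K)"
        using k(1) by (intro exI[of _ S]) blast
    qed
  next
    case (Basis s)
    then obtain S x where S: "finite S" "x \<in> rays" "s = ends_in_same_component V E S (cls x)"
      unfolding graph_ends_eq by auto
    then have s: "s = cls ` {y \<in> rays. side S y = side S x}"
      using ends_in_same_component_cls by simp
    show ?case
    proof (intro conjI ballI impI)
      show "s \<subseteq> cls ` rays" using s by blast
      fix z assume z: "z \<in> rays" "cls z \<in> s"
      then obtain y where y: "y \<in> rays" "side S y = side S x" "cls z = cls y" using s by auto
      then have "eqv z y" using cls_eq_iff z(1) by blast
      then have "side S z = side S x" using S(1) y(2) unfolding eqv_def by simp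
      then show "\<exists>S. finite S \<and> (\<forall>y\<in>rays. side S y = side S z \<longrightarrow> cls y \<in> s)"
        using S(1) s by (intro exI[of _ S]) auto
    qed
  qed auto
next
  assume U: "?R U"
  show "openin (end_space V E) U"
  proof (subst openin_subopen, intro ballI)
    fix \<omega> assume "\<omega> \<in> U"
    then obtain x where x: "x \<in> rays" "\<omega> = cls x" using U by blast
    then obtain S where S: "finite S" "\<forall>y\<in>rays. side S y = side S x \<longrightarrow> cls y \<in> U"
      using U \<open>\<omega> \<in> U\<close> by blast
    let ?T = "ends_in_same_component V E (S \<inter> V) (cls x)"
    have T: "?T = cls ` {y \<in> rays. side S y = side S x}"
      using ends_in_same_component_cls[OF x(1), of "S \<inter> V"] S(1) by (simp add: side_Int_V)
    have "openin (end_space V E) ?T"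
      unfolding end_space_def
      by (rule topology_generated_by_Basis) (use S(1) x(1) graph_ends_eq in blast)
    moreover have "\<omega> \<in> ?T" "?T \<subseteq> U" using S x unfolding T by auto
    ultimately show "\<exists>T. openin (end_space V E) T \<and> \<omega> \<in> T \<and> T \<subseteq> U" by blast
  qed
qed

lemma topspace_end_space: "topspace (end_space V E) = cls ` rays"
proof
  show "topspace (end_space V E) \<subseteq> cls ` rays"
    using openin_end_space[of "topspace (end_space V E)"] by simp
  have "openin (end_space V E) (cls ` rays)"
    unfolding openin_end_space by blast
  then show "cls ` rays \<subseteq> topspace (end_space V E)" by (rule openin_subset)
qed

text \<open>A finite neighbourhood makes the choice of representative irrelevant. In general
  \<open>ends U\<close> only records that some ray of the end settles in \<open>U\<close>.\<close>

lemma cls_in_ends: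
  assumes "finite (nb U)" "x \<in> rays"
  shows "cls x \<in> ends U \<longleftrightarrow> has_tail_in x U"
proof
  assume "cls x \<in> ends U"
  then obtain y where y: "y \<in> rays" "has_tail_in y U" "cls x = cls y" unfolding ends_def by blast
  then have "eqv y x" using cls_eq_iff assms(2) eqv_sym by metis
  then show "has_tail_in x U" using eqv_tail assms(1) y(2) by blast
qed (use assms ends_def in blast)

lemma ends_subset: "ends U \<subseteq> cls ` rays"
  unfolding ends_def by blast

lemma ends_mono: "U \<subseteq> U' \<Longrightarrow> ends U \<subseteq> ends U'"
  unfolding ends_def using has_tail_in_mono by blast

lemma ends_clopen:
  assumes U: "finite (nb U)"
  shows "openin (end_space V E) (ends U) \<and> closedin (end_space V E) (ends U)"
proof
  have *: "has_tail_in y U \<longleftrightarrow> has_tail_in x U"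
    if "x \<in> rays" "y \<in> rays" "side (nb U) y = side (nb U) x" for x y
    using same_side_tail[OF that(1,2,3) U] same_side_tail[OF that(2,1) that(3)[symmetric] U] by blast
  show "openin (end_space V E) (ends U)"
    unfolding openin_end_space
  proof (intro conjI ballI impI ends_subset)
    fix x assume x: "x \<in> rays" "cls x \<in> ends U"
    have "cls y \<in> ends U" if "y \<in> rays" "side (nb U) y = side (nb U) x" for y
      using *[OF x(1) that] x that(1) cls_in_ends[OF U] by blast
    then show "\<exists>S. finite S \<and> (\<forall>y\<in>rays. side S y = side S x \<longrightarrow> cls y \<in> ends U)" using U by blast
  qed
  have "openin (end_space V E) (cls ` rays - ends U)"
    unfolding openin_end_space
  proof (intro conjI ballI impI Diff_subset)
    fix x assume x: "x \<in> rays" "cls x \<in> cls ` rays - ends U"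
    have "cls y \<in> cls ` rays - ends U" if "y \<in> rays" "side (nb U) y = side (nb U) x" for y
      using *[OF x(1) that] x that(1) cls_in_ends[OF U] by blast
    then show "\<exists>S. finite S \<and> (\<forall>y\<in>rays. side S y = side S x \<longrightarrow> cls y \<in> cls ` rays - ends U)"
      using U by blast
  qed
  then show "closedin (end_space V E) (ends U)"
    unfolding closedin_def topspace_end_space using ends_subset by blast
qed

text \<open>Finite neighbourhoods are separators and give clopenness. The local condition is phrased
  with tails and sides, so that its users need not handle equivalence classes.\<close>

lemma clopen_subbase_ends:
  assumes fin: "\<And>U. U \<in> \<U> \<Longrightarrow> finite (nb U)"
    and loc: "\<And>x S. x \<in> rays \<Longrightarrow> finite S \<Longrightarrow> \<exists>F G. finite F \<and> finite G \<and> F \<subseteq> \<U> \<and> G \<subseteq> \<U> \<and>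
      (\<forall>U\<in>F. has_tail_in x U) \<and> (\<forall>U\<in>G. \<not> has_tail_in x U) \<and>
      (\<forall>y\<in>rays. (\<forall>U\<in>F. has_tail_in y U) \<and> (\<forall>U\<in>G. \<not> has_tail_in y U) \<longrightarrow> side S y = side S x)"
  shows "clopen_subbase (end_space V E) (ends ` \<U>)"
  unfolding clopen_subbase_iff
proof (intro conjI ballI allI impI)
  fix A assume "A \<in> ends ` \<U>"
  then show "openin (end_space V E) A" "closedin (end_space V E) A"
    using ends_clopen[OF fin] by auto
next
  fix W \<omega> assume W: "openin (end_space V E) W \<and> \<omega> \<in> W"
  then obtain x where x: "x \<in> rays" "\<omega> = cls x" unfolding openin_end_space by blast
  then obtain S where S: "finite S" "\<forall>y\<in>rays. side S y = side S x \<longrightarrow> cls y \<in> W"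
    using W unfolding openin_end_space by blast
  obtain F G where FG: "finite F" "finite G" "F \<subseteq> \<U>" "G \<subseteq> \<U>"
      "\<forall>U\<in>F. has_tail_in x U" "\<forall>U\<in>G. \<not> has_tail_in x U"
      "\<And>y. y \<in> rays \<Longrightarrow> (\<forall>U\<in>F. has_tail_in y U) \<Longrightarrow> (\<forall>U\<in>G. \<not> has_tail_in y U) \<Longrightarrow> side S y = side S x"
    using loc[OF x(1) S(1)] by metis
  have mem: "cls y \<in> topspace (end_space V E) \<inter> \<Inter>(ends ` F) - \<Union>(ends ` G) \<longleftrightarrow>
      (\<forall>U\<in>F. has_tail_in y U) \<and> (\<forall>U\<in>G. \<not> has_tail_in y U)" if y: "y \<in> rays" for y
  proof -
    have "cls y \<in> ends U \<longleftrightarrow> has_tail_in y U" if "U \<in> F \<union> G" for U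
      using cls_in_ends[OF fin y] FG(3,4) that by blast
    then show ?thesis using y by (auto simp: topspace_end_space)
  qed
  have "\<omega> \<in> topspace (end_space V E) \<inter> \<Inter>(ends ` F) - \<Union>(ends ` G)"
    unfolding x(2) using mem[OF x(1)] FG(5,6) by blast
  moreover have "topspace (end_space V E) \<inter> \<Inter>(ends ` F) - \<Union>(ends ` G) \<subseteq> W"
  proof
    fix \<eta> assume e: "\<eta> \<in> topspace (end_space V E) \<inter> \<Inter>(ends ` F) - \<Union>(ends ` G)"
    then obtain y where y: "y \<in> rays" "\<eta> = cls y" unfolding topspace_end_space by blast
    then have "side S y = side S x" using mem[OF y(1)] FG(7)[OF y(1)] e by blast
    then show "\<eta> \<in> W" using S(2) y by blast
  qed
  ultimately show "\<exists>F G. finite F \<and> finite G \<and> F \<subseteq> ends ` \<U> \<and> G \<subseteq> ends ` \<U> \<and>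
      \<omega> \<in> topspace (end_space V E) \<inter> \<Inter>F - \<Union>G \<and> topspace (end_space V E) \<inter> \<Inter>F - \<Union>G \<subseteq> W"
    using FG(1-4) by (intro exI[of _ "ends ` F"] exI[of _ "ends ` G"] conjI finite_imageI image_mono)
qed

end

section \<open>The subbase of an end space\<close>

context sgraph begin

text \<open>\<open>D\<close> serves only to name a neighbourhood. Infinitely many components may be
  united, yet by \<open>nb_sibs\<close> no new neighbours arise.\<close>

definition sibs :: "'v set \<Rightarrow> 'v set \<Rightarrow> 'v set" where
  "sibs A D = \<Union>{D' \<in> comps (A - core A). nb D' = nb D}"

definition fam :: "'v set set" where
  "fam = {C \<in> nodes. \<not> limit C} \<union> {sibs A D | A D. limit A \<and> D \<in> comps (A - core A)}"

section \<open>The family of non-limit pieces and groups of siblings\<close>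

lemma sibsI: "D' \<in> comps (A - core A) \<Longrightarrow> nb D' = nb D \<Longrightarrow> D' \<subseteq> sibs A D"
  unfolding sibs_def by blast

lemma sibsD: "v \<in> sibs A D \<Longrightarrow> \<exists>D'\<in>comps (A - core A). nb D' = nb D \<and> v \<in> D'"
  unfolding sibs_def by blast

lemma sibs_subset: "sibs A D \<subseteq> A - core A"
  unfolding sibs_def using comps_subset by blast

lemma sibs_eq: "nb D = nb D' \<Longrightarrow> sibs A D = sibs A D'"
  unfolding sibs_def by simp

lemma nb_sibs: "nb (sibs A D) \<subseteq> nb D"
proof
  fix x assume x: "x \<in> nb (sibs A D)"
  then obtain d where d: "d \<in> sibs A D" "{x, d} \<in> E" "x \<notin> sibs A D" unfolding nb_def by blast
  then obtain D' where D': "D' \<in> comps (A - core A)" "nb D' = nb D" "d \<in> D'" using sibsD by blast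
  then have "x \<in> nb D'" using d sibsI[OF D'(1,2)] unfolding nb_def by blast
  then show "x \<in> nb D" using D' by simp
qed

lemma fam_cases:
  assumes "U \<in> fam"
  obtains "U \<in> nodes" "\<not> limit U" | A D where "limit A" "D \<in> comps (A - core A)" "U = sibs A D"
  using assms unfolding fam_def by blast

lemma fam_node: "C \<in> nodes \<Longrightarrow> \<not> limit C \<Longrightarrow> C \<in> fam"
  unfolding fam_def by blast

lemma fam_sibs: "limit A \<Longrightarrow> D \<in> comps (A - core A) \<Longrightarrow> sibs A D \<in> fam"
  unfolding fam_def by blast

lemma fam_finite_nb: "U \<in> fam \<Longrightarrow> finite (nb U)"
proof (erule fam_cases)
  show "finite (nb U)" if "U \<in> nodes" "\<not> limit U" using node_nb that by blast
  show "finite (nb U)" if "limit A" "D \<in> comps (A - core A)" "U = sibs A D" for A D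
    using finite_subset[OF nb_sibs] finite_nb_child[OF limit_node that(2)] that by blast
qed

text \<open>A piece properly inside \<open>A\<close> is connected and avoids \<open>core A\<close>,
  so it lies in a single component and hence in a single group.\<close>

lemma sibs_meet:
  assumes A: "A \<in> nodes" and B: "B \<in> nodes" and v: "v \<in> B" "v \<in> sibs A D"
  shows "A \<subseteq> B \<or> B \<subseteq> sibs A D"
proof (rule disjCI)
  assume no: "\<not> B \<subseteq> sibs A D"
  obtain D' where D': "D' \<in> comps (A - core A)" "nb D' = nb D" "v \<in> D'" using sibsD[OF v(2)] by blast
  have "v \<in> A" using v(2) sibs_subset by blast
  then have "A \<subseteq> B \<or> B \<subset> A" using node_nested[OF A B _ v(1)] by blast
  moreover have "\<not> B \<subset> A"
  proof
    assume "B \<subset> A"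
    then have "B \<subseteq> D'"
      using v(1) D'(3) by (intro conn_subset_comps[OF node_conn[OF B] node_less[OF B A] D'(1)]) auto
    then show False using no sibsI[OF D'(1,2)] by blast
  qed
  ultimately show "A \<subseteq> B" by blast
qed

lemma sibs_same:
  assumes "v \<in> sibs A D" "v \<in> sibs A D'"
  shows "sibs A D = sibs A D'"
proof -
  obtain D1 D2 where D: "D1 \<in> comps (A - core A)" "nb D1 = nb D" "v \<in> D1"
      "D2 \<in> comps (A - core A)" "nb D2 = nb D'" "v \<in> D2"
    using sibsD assms by metis
  then have "D1 = D2" using comps_disjoint by blast
  then show ?thesis using sibs_eq[of D D'] D(2,5) by simp
qed

lemma fam_nested:
  assumes U: "U \<in> fam" "U' \<in> fam" and v: "v \<in> U" "v \<in> U'"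
  shows "U \<subseteq> U' \<or> U' \<subseteq> U"
  using U(1)
proof (cases rule: fam_cases)
  case 1
  show ?thesis using U(2)
  proof (cases rule: fam_cases)
    case 1
    then show ?thesis using node_nested[of U U'] \<open>U \<in> nodes\<close> v by blast
  next
    case (2 A D)
    then show ?thesis using sibs_meet[of A U v D] limit_node \<open>U \<in> nodes\<close> v sibs_subset[of A D] by blast
  qed
next
  case UA: (2 A D)
  note nA = limit_node[OF UA(1)]
  show ?thesis using U(2)
  proof (cases rule: fam_cases)
    case 1
    then show ?thesis using sibs_meet[OF nA 1(1) v(2)] v(1) sibs_subset[of A D] UA by blast
  next
    case UB: (2 B D')
    note nB = limit_node[OF UB(1)]
    have vAB: "v \<in> A" "v \<in> B" using v UA UB sibs_subset by blast+
    have 1: "A \<subseteq> B \<or> B \<subseteq> sibs A D" by (rule sibs_meet[OF nA nB vAB(2)]) (use v UA in simp)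
    have 2: "B \<subseteq> A \<or> A \<subseteq> sibs B D'" by (rule sibs_meet[OF nB nA vAB(1)]) (use v UB in simp)
    show ?thesis
    proof (cases "A = B")
      case True
      then show ?thesis using sibs_same[of v A D D'] v UA UB by simp
    next
      case False
      then show ?thesis using 1 2 sibs_subset[of A D] sibs_subset[of B D'] UA UB by blast
    qed
  qed
qed

text \<open>Every member has a host piece: itself, or the limit piece whose successors it groups.
  Let \<open>A\<close> be the largest host. If \<open>A\<close> is not a member, the group of
  \<open>A\<close> through \<open>v\<close> is unique and contains all the others.\<close>

lemma fam_max:
  assumes M: "M \<subseteq> fam" "M \<noteq> {}" "\<And>U. U \<in> M \<Longrightarrow> v \<in> U"
  shows "\<exists>U\<in>M. \<forall>U'\<in>M. U' \<subseteq> U"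
proof -
  define M' where "M' = (M \<inter> nodes) \<union> {A \<in> nodes. \<exists>D. sibs A D \<in> M}"
  have host: "\<exists>A\<in>M'. U \<subseteq> A \<and> (U = A \<or> (\<exists>D. U = sibs A D))" if U: "U \<in> M" for U
  proof -
    have "U \<in> fam" using U M(1) by blast
    then show ?thesis
    proof (cases rule: fam_cases)
      case 1
      then show ?thesis using U unfolding M'_def by blast
    next
      case (2 A D)
      then show ?thesis using U limit_node[OF 2(1)] sibs_subset[of A D] unfolding M'_def by blast
    qed
  qed
  have "\<exists>A\<in>M'. \<forall>D\<in>M'. D \<subseteq> A"
  proof (rule node_max)
    show "M' \<subseteq> nodes" unfolding M'_def by blast
    show "M' \<noteq> {}" using host M(2) by blast
    show "v \<in> A" if "A \<in> M'" for A
      using that M(3) sibs_subset unfolding M'_def by blast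
  qed
  then obtain A where A: "A \<in> M'" and max: "\<forall>D\<in>M'. D \<subseteq> A" by (rule bexE)
  have le: "U \<subseteq> A" if "U \<in> M" for U using host[OF that] max by blast
  show ?thesis
  proof (cases "A \<in> M")
    case True
    then show ?thesis using le by blast
  next
    case False
    then obtain D where D: "sibs A D \<in> M" "A \<in> nodes" using A unfolding M'_def by blast
    have "U \<subseteq> sibs A D" if U: "U \<in> M" for U
    proof -
      obtain B where B: "B \<in> M'" "U \<subseteq> B" "U = B \<or> (\<exists>D. U = sibs B D)" using host[OF U] by blast
      have nB: "B \<in> nodes" using B(1) unfolding M'_def by blast
      show ?thesis
      proof (cases "B = A")
        case True
        then obtain D' where "U = sibs A D'" using B(3) False U by blast
        then show ?thesis using sibs_same[of v A D D'] M(3)[OF U] M(3)[OF D(1)] by simp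
      next
        case False
        have "B \<subseteq> A" using max B(1) by blast
        then have "\<not> A \<subseteq> B" using False by blast
        then have "B \<subseteq> sibs A D"
          using sibs_meet[OF D(2) nB _ M(3)[OF D(1)]] M(3)[OF U] B(2) by blast
        then show ?thesis using B(2) by blast
      qed
    qed
    then show ?thesis using D(1) by blast
  qed
qed

lemma ends_meet:
  assumes "U \<in> fam" "U' \<in> fam" "\<omega> \<in> ends U" "\<omega> \<in> ends U'"
  shows "\<exists>v. v \<in> U \<and> v \<in> U'"
proof -
  obtain x where x: "x \<in> rays" "\<omega> = cls x" "has_tail_in x U" using assms(3) unfolding ends_def by blast
  then have "has_tail_in x U'" using cls_in_ends[OF fam_finite_nb[OF assms(2)] x(1)] assms(4) by blast
  then show ?thesis using has_tail_in_ex[OF has_tail_in_Int[OF x(3)]] by blast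
qed

section \<open>The properties of the resulting subbase\<close>

lemma nested_ends_fam: "nested (ends ` fam)"
  unfolding nested_def
proof (intro ballI impI)
  fix A B assume "A \<in> ends ` fam" "B \<in> ends ` fam" and ne: "A \<inter> B \<noteq> {}"
  then obtain U U' where U: "U \<in> fam" "U' \<in> fam" "A = ends U" "B = ends U'" by blast
  obtain \<omega> where "\<omega> \<in> ends U" "\<omega> \<in> ends U'" using ne U by blast
  then obtain v where "v \<in> U" "v \<in> U'" using ends_meet U by blast
  then show "A \<subseteq> B \<or> B \<subseteq> A" using fam_nested[OF U(1,2)] ends_mono U(3,4) by metis
qed

text \<open>Different members can carry the same ends, so the sequence need not lift to an
  increasing sequence of vertex sets. Instead the largest member through a fixed vertex is taken
  among all that represent some \<open>A n\<close>.\<close>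

lemma noetherian_ends_fam: "noetherian (ends ` fam)"
  unfolding noetherian_def
proof (intro allI impI)
  fix A :: "nat \<Rightarrow> _" assume A: "range A \<subseteq> ends ` fam \<and> incseq A"
  then have inc: "A m \<subseteq> A n" if "m \<le> n" for m n using that by (simp add: incseqD)
  have "\<forall>n. \<exists>U. U \<in> fam \<and> A n = ends U" using A by blast
  then obtain U where U: "\<And>n. U n \<in> fam" "\<And>n. A n = ends (U n)" by metis
  show "\<exists>N. \<forall>n\<ge>N. A n = A N"
  proof (cases "\<forall>n. A n = {}")
    case False
    then obtain n0 \<omega> where w: "\<omega> \<in> A n0" by blast
    then obtain x where "has_tail_in x (U n0)" using U(2) unfolding ends_def by blast
    then obtain v where v: "v \<in> U n0" using has_tail_in_ex by blast
    define M where "M = {W \<in> fam. v \<in> W \<and> (\<exists>n\<ge>n0. ends W = A n)}"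
    have "\<exists>W\<in>M. \<forall>W'\<in>M. W' \<subseteq> W"
    proof (rule fam_max)
      show "M \<subseteq> fam" unfolding M_def by blast
      have "U n0 \<in> M" unfolding M_def using U v by blast
      then show "M \<noteq> {}" by blast
      show "v \<in> W" if "W \<in> M" for W using that unfolding M_def by blast
    qed
    then obtain W where W: "W \<in> M" and max: "\<forall>W'\<in>M. W' \<subseteq> W" by (rule bexE)
    obtain n1 where n1: "n1 \<ge> n0" "ends W = A n1" using W unfolding M_def by blast
    have "A n = A n1" if n: "n \<ge> n1" for n
    proof (cases "A n = A n0")
      case True
      then show ?thesis using inc[OF n] inc[OF n1(1)] by blast
    next
      case False
      have "\<not> A n \<subseteq> A n0" using inc[of n0 n] n n1(1) False by simp
      then have "\<not> U n \<subseteq> U n0" using U(2) ends_mono by metis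
      moreover have "\<omega> \<in> A n" using inc[of n0 n] n n1(1) w by auto
      ultimately have "U n0 \<subseteq> U n"
        using ends_meet[OF U(1) U(1), of \<omega> n0 n] fam_nested[OF U(1) U(1)] w U(2) by blast
      moreover have "n0 \<le> n" using n n1(1) by simp
      ultimately have "U n \<in> M" unfolding M_def using U(1)[of n] U(2)[of n] v by blast
      then have "A n \<subseteq> A n1" using max ends_mono U(2) n1(2) by metis
      then show ?thesis using inc[OF n] by blast
    qed
    then show ?thesis by blast
  qed simp
qed

lemma sigma_disjoint_ends_fam: "sigma_disjoint (ends ` fam)"
proof -
  obtain c :: "'v set \<Rightarrow> nat" where
    c: "\<And>C D. C \<in> nodes \<Longrightarrow> \<not> limit C \<Longrightarrow> D \<in> nodes \<Longrightarrow> \<not> limit D \<Longrightarrow> D \<subset> C \<Longrightarrow> c C \<noteq> c D" and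
    c': "\<And>A D D'. limit A \<Longrightarrow> D \<in> comps (A - core A) \<Longrightarrow> D' \<in> comps (A - core A) \<Longrightarrow> nb D = nb D' \<Longrightarrow> c D = c D'"
    using node_coloring by metis
  have ceq: "C = D" if "C \<in> nodes" "\<not> limit C" "D \<in> nodes" "\<not> limit D" "c C = c D" "v \<in> C" "v \<in> D" for C D v
    using c[OF that(1-4)] c[OF that(3,4,1,2)] node_nested[OF that(1,3,6,7)] that(5) by (metis psubsetI)
  define L where "L n = {C \<in> nodes. \<not> limit C \<and> c C = n}" for n
  define M where "M n = {sibs A D | A D. limit A \<and> D \<in> comps (A - core A) \<and> c D = n}" for n
  \<comment> \<open>Even indices hold the non-limit pieces of one colour, odd indices the groups of
    one colour; the colour is constant on a group.\<close>
  define F where "F n = (if even n then L (n div 2) else M (n div 2))" for n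
  have "fam = (\<Union>n. L n) \<union> (\<Union>n. M n)" unfolding fam_def L_def M_def by blast
  moreover have "(\<Union>n. F n) = (\<Union>n. L n) \<union> (\<Union>n. M n)"
  proof
    show "(\<Union>n. F n) \<subseteq> (\<Union>n. L n) \<union> (\<Union>n. M n)" unfolding F_def by auto
    have "L n = F (2 * n)" "M n = F (Suc (2 * n))" for n unfolding F_def by auto
    then show "(\<Union>n. L n) \<union> (\<Union>n. M n) \<subseteq> (\<Union>n. F n)" by blast
  qed
  ultimately have famF: "fam = (\<Union>n. F n)" by simp
  have L: "U = U'" if "U \<in> L n" "U' \<in> L n" "v \<in> U" "v \<in> U'" for U U' n v
    using ceq[of U U' v] that unfolding L_def by simp
  have M: "U = U'" if UU: "U \<in> M n" "U' \<in> M n" "v \<in> U" "v \<in> U'" for U U' n v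
  proof -
    obtain A D where A: "limit A" "D \<in> comps (A - core A)" "c D = n" "U = sibs A D"
      using UU(1) unfolding M_def by blast
    obtain B D' where B: "limit B" "D' \<in> comps (B - core B)" "c D' = n" "U' = sibs B D'"
      using UU(2) unfolding M_def by blast
    obtain D1 where D1: "D1 \<in> comps (A - core A)" "nb D1 = nb D" "v \<in> D1" using sibsD UU(3) A(4) by blast
    obtain D2 where D2: "D2 \<in> comps (B - core B)" "nb D2 = nb D'" "v \<in> D2" using sibsD UU(4) B(4) by blast
    note nA = limit_node[OF A(1)] and nB = limit_node[OF B(1)]
    have "c D1 = c D2" using c'[OF A(1) D1(1) A(2) D1(2)] c'[OF B(1) D2(1) B(2) D2(2)] A(3) B(3) by simp
    then have D12: "D1 = D2"
      by (intro ceq[OF child(1)[OF nA D1(1)] child_not_limit[OF nA D1(1)]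
            child(1)[OF nB D2(1)] child_not_limit[OF nB D2(1)] _ D1(3) D2(3)])
    then have "A = B" using parent_unique[OF nA D1(1) nB] D2(1) by simp
    then show ?thesis using A(4) B(4) sibs_eq[of D D'] D1(2) D2(2) D12 by simp
  qed
  have "disjoint (ends ` F n)" for n
    unfolding disjoint_def
  proof (intro ballI impI)
    fix a b assume "a \<in> ends ` F n" "b \<in> ends ` F n" and ab: "a \<noteq> b"
    then obtain U U' where U: "U \<in> F n" "U' \<in> F n" "a = ends U" "b = ends U'" by blast
    show "a \<inter> b = {}"
    proof (rule ccontr)
      assume "a \<inter> b \<noteq> {}"
      then obtain \<omega> where "\<omega> \<in> ends U" "\<omega> \<in> ends U'" using U by blast
      moreover have "U \<in> fam" "U' \<in> fam" using U famF by blast+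
      ultimately obtain v where "v \<in> U" "v \<in> U'" using ends_meet by blast
      then have "U = U'" using U(1,2) L M unfolding F_def by (auto split: if_splits)
      then show False using ab U by blast
    qed
  qed
  moreover have "ends ` fam = (\<Union>n. ends ` F n)" using famF by blast
  ultimately show ?thesis unfolding sigma_disjoint_def by (intro exI[of _ "\<lambda>n. ends ` F n"]) simp
qed

text \<open>One positive and finitely many negative conditions confine a ray to the side of
  \<open>x\<close>. The piece \<open>C0\<close> is so deep on the branch that the spine inside it
  avoids \<open>S\<close> and lies on that side. Rays in \<open>C0\<close> can then escape only
  below limit pieces under the branch that meet \<open>S\<close>, and there finitely many groups
  block them.\<close>

lemma clopen_subbase_ends_fam: "clopen_subbase (end_space V E) (ends ` fam)"
proof (rule clopen_subbase_ends[OF fam_finite_nb])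
  fix x and S :: "'v set" assume x: "x \<in> rays" and S: "finite S"
  let ?P = "branch_of x"
  note P = branch_of[OF x]
  obtain y where y: "along y ?P" using branch_along[OF P] by blast
  have yr: "y \<in> rays" using y unfolding along_def by blast
  have xy: "eqv x y" by (rule branch_of_eqv[OF x y])
  have PV: "\<Inter>?P \<subseteq> V" using branchD(1,2)[OF P] node_V by blast
  obtain A0 where "A0 \<in> ?P" using branchD(2)[OF P] by blast
  then obtain A where A: "A \<in> ?P" "S \<inter> A \<subseteq> \<Inter>?P" using branch_finite[OF P _ S] by blast
  then obtain C0 where C0: "C0 \<in> nodes" "\<not> limit C0" "C0 \<subseteq> A" "has_tail_in x C0"
    unfolding branch_of_def by blast
  have C0P: "C0 \<in> ?P" unfolding branch_of_def using C0 by blast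
  have SC0: "S \<inter> C0 \<subseteq> \<Inter>?P" using A(2) C0(3) by blast
  have spine_side: "spine ?P \<inter> C0 \<subseteq> side S y" by (rule along_side[OF P y C0P S SC0])
  define Cs where "Cs = {C \<in> comps (\<Inter>?P). C \<inter> S \<noteq> {}}"
  \<comment> \<open>The successors to be excluded: they meet \<open>S\<close> or have no neighbour
    on the side of \<open>y\<close>. Any other successor avoids \<open>S\<close> and is attached to
    that side, hence lies in it.\<close>
  define Ds where "Ds C = {D \<in> comps (C - core C). D \<inter> S \<noteq> {} \<or> nb D \<inter> side S y = {}}" for C
  define G where "G = (\<Union>C\<in>Cs. sibs C ` Ds C)"
  have finite_meet: "finite {C \<in> comps X. C \<inter> S \<noteq> {}}" for X
  proof -
    have "{C \<in> comps X. C \<inter> S \<noteq> {}} \<subseteq> (\<lambda>s. THE C. C \<in> comps X \<and> s \<in> C) ` S"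
    proof
      fix C assume "C \<in> {C \<in> comps X. C \<inter> S \<noteq> {}}"
      then obtain s where s: "C \<in> comps X" "s \<in> C" "s \<in> S" by blast
      have "(THE C. C \<in> comps X \<and> s \<in> C) = C"
      proof (rule the_equality)
        show "B = C" if "B \<in> comps X \<and> s \<in> B" for B
          using comps_disjoint[of B X C s] s that by blast
      qed (use s in blast)
      then show "C \<in> (\<lambda>s. THE C. C \<in> comps X \<and> s \<in> C) ` S" using s(3) by blast
    qed
    then show ?thesis using S finite_surj by blast
  qed
  have lC: "limit C" "up C = ?P" "C \<in> nodes" if "C \<in> comps (\<Inter>?P)" for C
    using branch_limit[OF P that] limit_node by auto
  have concC: "conc (core C) y" "conc (nb C) y" if "C \<in> comps (\<Inter>?P)" for C
  proof -
    show "conc (core C) y" using conc_core[OF lC(1)[OF that]] y lC(2)[OF that] by simp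
    show "conc (nb C) y"
      using along_conc_nb[OF lC(1)[OF that]] node_nb[OF lC(3)[OF that]] lC(1,2)[OF that] y by simp
  qed
  have "finite (sibs C ` Ds C)" if C: "C \<in> comps (\<Inter>?P)" for C
  proof -
    \<comment> \<open>Core and neighbourhood of \<open>C\<close> converge to \<open>y\<close>, so
      \<open>?K\<close> is finite. A group is determined by its neighbourhood, and the
      neighbourhoods that miss the side are subsets of \<open>?K\<close>.\<close>
    let ?K = "(core C \<union> nb C) - side S y"
    have "conc (core C \<union> nb C) y" by (rule conc_Un[OF concC[OF C]])
    then have fK: "finite ?K" using S unfolding conc_def by blast
    have "sibs C ` Ds C \<subseteq> sibs C ` {D \<in> comps (C - core C). D \<inter> S \<noteq> {}} \<union>
        (\<lambda>F. \<Union>{D \<in> comps (C - core C). nb D = F}) ` Pow ?K"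
    proof
      fix U assume "U \<in> sibs C ` Ds C"
      then obtain D where D: "D \<in> comps (C - core C)" "U = sibs C D" "D \<inter> S \<noteq> {} \<or> nb D \<inter> side S y = {}"
        unfolding Ds_def by blast
      show "U \<in> sibs C ` {D \<in> comps (C - core C). D \<inter> S \<noteq> {}} \<union>
        (\<lambda>F. \<Union>{D \<in> comps (C - core C). nb D = F}) ` Pow ?K"
      proof (cases "D \<inter> S = {}")
        case True
        then have "nb D \<in> Pow ?K" using nb_comps_Diff[OF D(1)] D(3) by blast
        then show ?thesis using D(2) unfolding sibs_def by blast
      qed (use D in blast)
    qed
    then show ?thesis using fK finite_meet finite_subset by (meson finite_Pow_iff finite_UnI finite_imageI)
  qed
  then have finG: "finite G" unfolding G_def using finite_meet[of "\<Inter>?P"] unfolding Cs_def by blast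
  have Gfam: "G \<subseteq> fam" unfolding G_def Cs_def Ds_def using lC(1) fam_sibs by blast
  \<comment> \<open>The equivalent ray \<open>y\<close> has a tail in the spine, whereas all members
    of \<open>G\<close> lie in \<open>\<Inter>?P\<close>, which the spine avoids.\<close>
  have Gx: "\<not> has_tail_in x U" if U: "U \<in> G" for U
  proof
    assume t: "has_tail_in x U"
    have "has_tail_in y U"
      by (rule eqv_tail[OF xy fam_finite_nb t]) (use U Gfam in blast)
    moreover have "has_tail_in y (spine ?P \<inter> C0)" using y C0P unfolding along_def by blast
    ultimately obtain n where n: "y n \<in> U" "y n \<in> spine ?P"
      using has_tail_in_ex[OF has_tail_in_Int] by blast
    obtain C D where "C \<in> comps (\<Inter>?P)" "U = sibs C D" using U unfolding G_def Cs_def by blast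
    then have "U \<subseteq> \<Inter>?P" using sibs_subset[of C D] comps_subset[of C] by blast
    then show False using n spine_Inter[OF P] by blast
  qed
  have Gz: "side S z = side S x"
    if z: "z \<in> rays" "has_tail_in z C0" "\<forall>U\<in>G. \<not> has_tail_in z U" for z
  proof (rule ccontr)
    assume "side S z \<noteq> side S x"
    then have neq: "side S z \<noteq> side S y" using xy S unfolding eqv_def by simp
    have nf: "\<not> frequently_in z K" if "K \<subseteq> side S y" for K
      using side_eqI2[OF z(1) yr S] frequently_in_mono[OF _ that] neq by blast
    have nftail: "has_tail_in z (B - K)" if "\<not> frequently_in z K" "has_tail_in z B" for B K
      using has_tail_in_Int[OF that(2), of "- K"] not_has_tail_in[of z "- K"] that(1) by (simp add: Diff_eq)
    have "has_tail_in z (C0 - spine ?P \<inter> C0)" by (rule nftail[OF nf[OF spine_side] z(2)])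
    then have t: "has_tail_in z (C0 - spine ?P)" by (rule has_tail_in_mono) blast
    have C0sV: "C0 - spine ?P \<subseteq> V" using node_V[OF C0(1)] by blast
    obtain D0 where D0: "D0 \<in> comps (C0 - spine ?P)" "has_tail_in z D0"
      using ray_tail_in_comps[OF z(1) t C0sV] by blast
    note cD0 = conn_comps[OF C0sV D0(1)] and D0sub = comps_subset[OF D0(1)]
    have "core C0 \<subseteq> spine ?P" using C0P unfolding spine_def by blast
    then have "D0 \<noteq> C0" using D0sub core_subset[OF C0(1)] core_ne[OF C0(1)] by blast
    then obtain v where v: "v \<in> nb D0" "v \<in> C0"
      using conn_nb[OF node_conn[OF C0(1)], of D0] D0sub comps_nonempty[OF D0(1)] by blast
    have "v \<in> side S y" using comps_nb[OF D0(1)] v spine_side by blast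
    \<comment> \<open>\<open>D0\<close> hangs at a spine vertex on the side of \<open>y\<close>, so
      it can be off that side only by meeting \<open>S\<close>.\<close>
    have "D0 \<inter> S \<noteq> {}"
    proof
      assume e: "D0 \<inter> S = {}"
      obtain d where d: "d \<in> D0" "{v, d} \<in> E" using v(1) unfolding nb_def by blast
      have "d \<in> side S y" using side_closed[OF yr S \<open>v \<in> side S y\<close> d(2)] e d(1) by blast
      then have "D0 \<subseteq> side S y" by (intro side_absorb[OF yr S cD0 e]) (use d(1) in blast)
      then show False using nf tail_frequently_in[OF D0(2)] by blast
    qed
    then obtain s where s: "s \<in> D0" "s \<in> S" by blast
    have sP: "s \<in> \<Inter>?P" using SC0 s D0sub by blast
    have "D0 \<subseteq> \<Inter>?P"
      by (rule conn_subset_Inter[OF P cD0]) (use D0sub s(1) sP in blast)+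
    then obtain C where C: "C \<in> comps (\<Inter>?P)" "D0 \<subseteq> C"
      using conn_in_comps[OF cD0] comps_nonempty[OF D0(1)] by blast
    have CCs: "C \<in> Cs" unfolding Cs_def using C s by blast
    have tC: "has_tail_in z C" by (rule has_tail_in_mono[OF D0(2) C(2)])
    have "\<not> frequently_in z (core C)"
    proof
      assume "frequently_in z (core C)"
      then have "eqv z y" by (rule conc_freq[OF concC(1)[OF C(1)] yr z(1)])
      then show False using neq S unfolding eqv_def by blast
    qed
    then have t2: "has_tail_in z (C - core C)" using nftail tC by blast
    have CsV: "C - core C \<subseteq> V" using node_V[OF lC(3)[OF C(1)]] by blast
    obtain D where D: "D \<in> comps (C - core C)" "has_tail_in z D"
      using ray_tail_in_comps[OF z(1) t2 CsV] by blast
    have "has_tail_in z (sibs C D)" by (rule has_tail_in_mono[OF D(2) sibsI[OF D(1) refl]])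
    then have "D \<notin> Ds C" using z(3) CCs unfolding G_def by blast
    then have D': "D \<inter> S = {}" "nb D \<inter> side S y \<noteq> {}" using D(1) unfolding Ds_def by auto
    then obtain k d where k: "k \<in> side S y" "d \<in> D" "{k, d} \<in> E" unfolding nb_def by blast
    have "d \<in> side S y" using side_closed[OF yr S k(1,3)] D'(1) k(2) by blast
    then have "D \<subseteq> side S y"
      by (intro side_absorb[OF yr S conn_comps[OF CsV D(1)] D'(1)]) (use k(2) in blast)
    then show False using nf tail_frequently_in[OF D(2)] by blast
  qed
  show "\<exists>F G. finite F \<and> finite G \<and> F \<subseteq> fam \<and> G \<subseteq> fam \<and>
      (\<forall>U\<in>F. has_tail_in x U) \<and> (\<forall>U\<in>G. \<not> has_tail_in x U) \<and>
      (\<forall>y\<in>rays. (\<forall>U\<in>F. has_tail_in y U) \<and> (\<forall>U\<in>G. \<not> has_tail_in y U) \<longrightarrow> side S y = side S x)"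
    by (intro exI[of _ "{C0}"] exI[of _ G])
      (use finG Gfam Gx Gz fam_node[OF C0(1,2)] C0(4) in simp)
qed

text \<open>The pieces that contain a representative of the chain form a branch, and the ray along
  it gives the common end. A member holding that end and lying below the whole chain would be
  contained in all pieces of the branch, but the ray runs in the spine.\<close>

lemma hereditarily_complete_ends_fam: "hereditarily_complete (end_space V E) (ends ` fam)"
proof (rule hereditarily_completeI[OF clopen_subbase_ends_fam nested_ends_fam])
  fix \<B> assume \<B>: "\<B> \<subseteq> ends ` fam" "\<B> \<noteq> {}" "{} \<notin> \<B>"
    and chain: "\<And>A B. A \<in> \<B> \<Longrightarrow> B \<in> \<B> \<Longrightarrow> A \<subseteq> B \<or> B \<subseteq> A"
    and nomin: "\<And>B. B \<in> \<B> \<Longrightarrow> \<exists>B'\<in>\<B>. B' \<subset> B"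
  define \<U> where "\<U> = {U \<in> fam. ends U \<in> \<B>}"
  define P where "P = {A \<in> nodes. \<exists>U\<in>\<U>. U \<subseteq> A}"
  have Ufam: "U \<in> fam" if "U \<in> \<U>" for U using that unfolding \<U>_def by blast
  have meet: "\<exists>v. v \<in> U \<and> v \<in> U'" if "U \<in> \<U>" "U' \<in> \<U>" for U U'
  proof -
    have "ends U \<in> \<B>" "ends U' \<in> \<B>" "U \<in> fam" "U' \<in> fam" using that unfolding \<U>_def by auto
    moreover then obtain \<omega> where "\<omega> \<in> ends U" "\<omega> \<in> ends U'"
      using chain[of "ends U" "ends U'"] \<B>(3) by (metis ex_in_conv subsetD)
    ultimately show ?thesis using ends_meet by blast
  qed
  have smaller: "\<exists>U'\<in>\<U>. U' \<subset> U" if U: "U \<in> \<U>" for U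
  proof -
    obtain B' where B': "B' \<in> \<B>" "B' \<subset> ends U" using nomin[of "ends U"] U unfolding \<U>_def by blast
    then obtain U' where U': "U' \<in> \<U>" "B' = ends U'" using \<B>(1) unfolding \<U>_def by blast
    have "\<not> U \<subseteq> U'" using ends_mono[of U U'] B'(2) U'(2) by blast
    then show ?thesis using meet[OF U U'(1)] fam_nested[OF Ufam[OF U] Ufam[OF U'(1)]] U'(1) by blast
  qed
  \<comment> \<open>Between properly nested members there is always a piece: if the smaller one is a
    group, the limit piece it comes from still fits into the larger one.\<close>
  have host: "\<exists>A\<in>P. A \<subseteq> U" if U: "U \<in> \<U>" for U
  proof -
    obtain U' where U': "U' \<in> \<U>" "U' \<subset> U" using smaller[OF U] by blast
    obtain v where v: "v \<in> U'" "v \<in> U" using meet[OF U'(1) U] by blast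
    show ?thesis using Ufam[OF U'(1)]
    proof (cases rule: fam_cases)
      case 1
      then show ?thesis using U' unfolding P_def by blast
    next
      case A': (2 A' D')
      note nA' = limit_node[OF A'(1)]
      have sub': "U' \<subseteq> A'" using A'(3) sibs_subset by blast
      have "A' \<subseteq> U" using Ufam[OF U]
      proof (cases rule: fam_cases)
        case 1
        show ?thesis using sibs_meet[OF nA' 1(1) v(2), of D'] v(1) A'(3) U'(2) by blast
      next
        case A: (2 A D)
        note nA = limit_node[OF A(1)]
        have sub: "U \<subseteq> A" using A(3) sibs_subset by blast
        have "A \<subseteq> A' \<or> A' \<subseteq> U" using sibs_meet[OF nA nA', of v D] v sub' A(3) by blast
        moreover have "A' \<subseteq> A \<or> A \<subseteq> U'" using sibs_meet[OF nA' nA, of v D'] v sub A'(3) by blast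
        moreover have "A \<noteq> A'" using sibs_same[of v A D D'] v A(3) A'(3) U'(2) by blast
        ultimately show ?thesis using sub U'(2) by blast
      qed
      then show ?thesis using U'(1) sub' nA' unfolding P_def by blast
    qed
  qed
  obtain U0 where U0: "U0 \<in> \<U>" using \<B>(1,2) unfolding \<U>_def by blast
  have P: "branch P"
    unfolding branch_def
  proof (intro conjI ballI impI)
    show "P \<subseteq> nodes" unfolding P_def by blast
    show "P \<noteq> {}" using host[OF U0] by blast
  next
    fix A B assume "A \<in> P" "B \<in> nodes" "A \<subseteq> B"
    then show "B \<in> P" unfolding P_def by (auto intro: order_trans)
  next
    fix A B assume "A \<in> P" "B \<in> P"
    then obtain U U' where "U \<in> \<U>" "U \<subseteq> A" "U' \<in> \<U>" "U' \<subseteq> B" "A \<in> nodes" "B \<in> nodes"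
      unfolding P_def by blast
    moreover then obtain v where "v \<in> U" "v \<in> U'" using meet by blast
    ultimately show "A \<subseteq> B \<or> B \<subseteq> A" using node_nested[of A B v] by blast
  next
    fix A assume "A \<in> P"
    then obtain U where U: "U \<in> \<U>" "U \<subseteq> A" unfolding P_def by blast
    obtain U' where U': "U' \<in> \<U>" "U' \<subset> U" using smaller[OF U(1)] by blast
    obtain B where "B \<in> P" "B \<subseteq> U'" using host[OF U'(1)] by blast
    then show "\<exists>B\<in>P. B \<subset> A" using U' U(2) by blast
  qed
  obtain y where y: "along y P" using branch_along[OF P] by blast
  have yr: "y \<in> rays" and yt: "\<And>A. A \<in> P \<Longrightarrow> has_tail_in y (spine P \<inter> A)" using y unfolding along_def by auto
  have yU: "cls y \<in> ends U" if U: "U \<in> \<U>" for U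
  proof -
    obtain A where A: "A \<in> P" "A \<subseteq> U" using host[OF U] by blast
    then have "has_tail_in y U" using has_tail_in_mono[OF yt[OF A(1)]] by blast
    then show ?thesis unfolding ends_def using yr by blast
  qed
  have BU: "\<exists>U\<in>\<U>. B = ends U" if "B \<in> \<B>" for B using that \<B>(1) unfolding \<U>_def by blast
  have "cls y \<in> \<Inter>\<B>" using BU yU by blast
  moreover have "\<not> A \<subseteq> \<Inter>\<B>" if A: "A \<in> ends ` fam" "cls y \<in> A" for A
  proof
    assume sub: "A \<subseteq> \<Inter>\<B>"
    obtain U where U: "U \<in> fam" "A = ends U" using A(1) by blast
    have t: "has_tail_in y U" using cls_in_ends[OF fam_finite_nb[OF U(1)] yr] A(2) U(2) by blast
    have "U \<subseteq> U'" if U': "U' \<in> \<U>" for U'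
    proof (rule ccontr)
      assume no: "\<not> U \<subseteq> U'"
      have "\<exists>v. v \<in> U \<and> v \<in> U'"
        by (rule ends_meet[OF U(1) Ufam[OF U'] _ yU[OF U']]) (use A(2) U(2) in simp)
      then have "U' \<subseteq> U" using no fam_nested[OF U(1) Ufam[OF U']] by blast
      then have "ends U' \<subseteq> A" using ends_mono U(2) by blast
      moreover obtain B' where "B' \<in> \<B>" "B' \<subset> ends U'" using nomin[of "ends U'"] U' unfolding \<U>_def by blast
      ultimately show False using sub by blast
    qed
    then have "U \<subseteq> A'" if "A' \<in> P" for A' using that unfolding P_def by blast
    then have "U \<subseteq> \<Inter>P" by blast
    moreover obtain A' where "A' \<in> P" using branchD(2)[OF P] by blast
    ultimately show False
      using has_tail_in_ex[OF has_tail_in_Int[OF t yt[of A']]] spine_Inter[OF P] by blast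
  qed
  ultimately show "\<exists>e\<in>\<Inter>\<B>. \<forall>A\<in>ends ` fam. e \<in> A \<longrightarrow> \<not> A \<subseteq> \<Inter>\<B>" by (intro bexI[of _ "cls y"]) auto
qed

end

section \<open>Ray spaces of special trees\<close>

locale otree =
  fixes T :: "'t set" and r :: "'t rel"
  assumes otree: "order_tree T r"
begin

section \<open>Order-theoretic basics of trees\<close>

lemma r_T: "(s, t) \<in> r \<Longrightarrow> s \<in> T \<and> t \<in> T"
  using otree unfolding order_tree_def order_on_defs by blast

lemma r_refl: "t \<in> T \<Longrightarrow> (t, t) \<in> r"
  using otree unfolding order_tree_def order_on_defs refl_on_def by blast

lemma r_trans: "(s, t) \<in> r \<Longrightarrow> (t, u) \<in> r \<Longrightarrow> (s, u) \<in> r"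
  using otree unfolding order_tree_def order_on_defs by (meson transD)

lemma r_antisym: "(s, t) \<in> r \<Longrightarrow> (t, s) \<in> r \<Longrightarrow> s = t"
  using otree unfolding order_tree_def order_on_defs by (meson antisymD)

lemma under_well: "t \<in> T \<Longrightarrow> well_order_on (underS r t) (Restr r (underS r t))"
  using otree unfolding order_tree_def by blast

lemma under_chain:
  assumes "(a, t) \<in> r" "(b, t) \<in> r"
  shows "(a, b) \<in> r \<or> (b, a) \<in> r"
proof (cases "a = t \<or> b = t \<or> a = b")
  case True
  then show ?thesis using assms r_refl r_T by metis
next
  case False
  have "total_on (underS r t) (Restr r (underS r t))"
    using under_well[of t] r_T[OF assms(1)] unfolding order_on_defs by blast
  then show ?thesis using False assms unfolding total_on_def underS_def by blast
qed

text \<open>Only the strict predecessors of \<open>t\<close> are well-ordered by definition.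
  \<open>t\<close> itself, which \<open>M\<close> may contain, is set aside; it lies above all the
  others.\<close>

lemma under_least:
  assumes M: "M \<noteq> {}" "\<And>s. s \<in> M \<Longrightarrow> (s, t) \<in> r"
  shows "\<exists>m\<in>M. \<forall>s\<in>M. (m, s) \<in> r"
proof (cases "M \<subseteq> {t}")
  case True
  then have "M = {t}" using M(1) by blast
  then show ?thesis using M(2)[of t] by simp
next
  case False
  then obtain s0 where s0: "s0 \<in> M - {t}" by blast
  have tT: "t \<in> T" using M(2) s0 r_T by blast
  have "wf (Restr r (underS r t) - Id)" using under_well[OF tT] unfolding order_on_defs by blast
  then obtain m where m: "m \<in> M - {t}" "\<And>s. (s, m) \<in> Restr r (underS r t) - Id \<Longrightarrow> s \<notin> M - {t}"
    using wfE_min[OF _ s0] by metis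
  have "(m, s) \<in> r" if s: "s \<in> M" for s
  proof (cases "s = t")
    case True
    then show ?thesis using M(2) m(1) by blast
  next
    case False
    have "(s, m) \<notin> Restr r (underS r t) - Id" using m(2)[of s] s False by blast
    then have "(s, m) \<notin> r \<or> s = m" using M(2) s False m(1) unfolding underS_def by auto
    then show ?thesis using under_chain[OF M(2)[OF s] M(2)[of m]] m(1) r_refl r_T M(2)[OF s] by blast
  qed
  then show ?thesis using m(1) by blast
qed

lemma tree_induct [consumes 1, case_names less]:
  assumes "t \<in> T"
    and step: "\<And>t. t \<in> T \<Longrightarrow> (\<And>s. (s, t) \<in> r \<Longrightarrow> s \<noteq> t \<Longrightarrow> P s) \<Longrightarrow> P t"
  shows "P t"
proof (rule ccontr)
  assume no: "\<not> P t"
  have "\<exists>m\<in>{s. (s, t) \<in> r \<and> \<not> P s}. \<forall>s\<in>{s. (s, t) \<in> r \<and> \<not> P s}. (m, s) \<in> r"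
    by (rule under_least[of _ t]) (use no r_refl[OF assms(1)] in auto)
  then obtain m where m: "(m, t) \<in> r" "\<not> P m" "\<And>s. (s, t) \<in> r \<Longrightarrow> \<not> P s \<Longrightarrow> (m, s) \<in> r" by blast
  have "P s" if "(s, m) \<in> r" "s \<noteq> m" for s
    using m(3)[of s] r_trans[OF that(1) m(1)] r_antisym[OF that(1)] that(2) by blast
  then show False using step[of m] m(1,2) r_T by blast
qed

text \<open>The least predecessor of any \<open>s\<close> is minimal in the tree and so equals the
  unique minimal element, which is therefore a minimum.\<close>

lemma tree_root: "\<exists>m\<in>T. \<forall>s\<in>T. (m, s) \<in> r"
proof -
  obtain m where m: "m \<in> T" "\<And>m'. m' \<in> T \<Longrightarrow> (\<forall>s\<in>T. (s, m') \<in> r \<longrightarrow> s = m') \<Longrightarrow> m' = m"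
    using otree unfolding order_tree_def by metis
  have "(m, s) \<in> r" if s: "s \<in> T" for s
  proof -
    obtain m' where m': "(m', s) \<in> r" "\<And>u. (u, s) \<in> r \<Longrightarrow> (m', u) \<in> r"
      using under_least[of "{u. (u, s) \<in> r}" s] r_refl[OF s] by blast
    have "m' = m"
      using m(2)[of m'] m' r_T r_trans[OF _ m'(1)] r_antisym by metis
    then show ?thesis using m'(1) by simp
  qed
  then show ?thesis using m(1) by blast
qed

section \<open>Rays of a tree and the subbase of sets of rays through a node\<close>

lemma tree_rays_iff:
  "P \<in> tree_rays T r \<longleftrightarrow> P \<noteq> {} \<and> P \<subseteq> T \<and> (\<forall>a\<in>P. \<forall>b\<in>P. (a, b) \<in> r \<or> (b, a) \<in> r) \<and>
     (\<forall>t\<in>P. \<forall>s. (s, t) \<in> r \<longrightarrow> s \<in> P) \<and> (\<forall>m\<in>P. \<exists>t\<in>P. (m, t) \<in> r \<and> t \<noteq> m)"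
  unfolding tree_rays_def tree_paths_def Chains_def under_def by auto

definition br :: "'t \<Rightarrow> 't set set" where
  "br t = {P \<in> tree_rays T r. t \<in> P}"

lemma tree_rayD:
  assumes "P \<in> tree_rays T r"
  shows "P \<noteq> {}" "t \<in> P \<Longrightarrow> t \<in> T" "a \<in> P \<Longrightarrow> b \<in> P \<Longrightarrow> (a, b) \<in> r \<or> (b, a) \<in> r"
    "t \<in> P \<Longrightarrow> (s, t) \<in> r \<Longrightarrow> s \<in> P" "m \<in> P \<Longrightarrow> \<exists>t\<in>P. (m, t) \<in> r \<and> t \<noteq> m"
proof -
  note P = assms[unfolded tree_rays_iff]
  show "P \<noteq> {}" using P by (elim conjE)
  show "t \<in> P \<Longrightarrow> t \<in> T" using P by (meson subsetD)
  show "a \<in> P \<Longrightarrow> b \<in> P \<Longrightarrow> (a, b) \<in> r \<or> (b, a) \<in> r" using P by metis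
  show "t \<in> P \<Longrightarrow> (s, t) \<in> r \<Longrightarrow> s \<in> P" using P by metis
  show "m \<in> P \<Longrightarrow> \<exists>t\<in>P. (m, t) \<in> r \<and> t \<noteq> m" using P by metis
qed

lemma br_mono: "(s, t) \<in> r \<Longrightarrow> br t \<subseteq> br s"
  unfolding br_def using tree_rayD(4) by blast

lemma finite_chain_above:
  assumes P: "P \<in> tree_rays T r" and S: "finite S" "S \<subseteq> P"
  shows "\<exists>t\<in>P. \<forall>s\<in>S. (s, t) \<in> r \<and> s \<noteq> t"
  using S
proof (induction S rule: finite_induct)
  case empty
  then show ?case using tree_rayD(1)[OF P] by blast
next
  case (insert a S)
  then obtain t where t: "t \<in> P" "\<forall>s\<in>S. (s, t) \<in> r \<and> s \<noteq> t" by blast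
  obtain b where b: "b \<in> P" "(a, b) \<in> r" "a \<noteq> b" using tree_rayD(5)[OF P, of a] insert.prems by blast
  consider "(b, t) \<in> r" | "(t, b) \<in> r" using tree_rayD(3)[OF P b(1) t(1)] by blast
  then show ?case
  proof cases
    case 1
    have "(a, t) \<in> r" by (rule r_trans[OF b(2) 1])
    moreover have "a \<noteq> t" using r_antisym[OF b(2)] 1 b(3) by blast
    ultimately show ?thesis using t by blast
  next
    case 2
    have "(s, b) \<in> r \<and> s \<noteq> b" if "s \<in> S" for s
      using t(2) that r_trans[OF _ 2] r_antisym[OF _ 2] by metis
    then show ?thesis using b by blast
  qed
qed

lemma topspace_ray_space: "topspace (ray_space T r) = tree_rays T r"
  unfolding ray_space_def topspace_pullback_topology by auto

lemma clopen_subbase_br: "clopen_subbase (ray_space T r) (br ` T)"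
  unfolding clopen_subbase_iff
proof (intro conjI ballI allI impI)
  let ?f = "\<lambda>x. restrict (\<lambda>t. t \<in> x) T"
  let ?D = "product_topology (\<lambda>_. discrete_topology (UNIV :: bool set)) T"
  have cyl: "openin (ray_space T r) {P \<in> tree_rays T r. (t \<in> P) \<in> B}" if t: "t \<in> T" for t B
  proof -
    have "openin ?D {f \<in> topspace ?D. f t \<in> B}"
      using continuous_map_product_projection[OF t, of "\<lambda>_. discrete_topology (UNIV :: bool set)"]
      unfolding continuous_map_def by simp
    then show ?thesis
      unfolding ray_space_def openin_pullback_topology
      by (intro exI[of _ "{f \<in> topspace ?D. f t \<in> B}"]) (use t in auto)
  qed
  fix A assume "A \<in> br ` T"
  then obtain t where t: "t \<in> T" "A = br t" by blast
  show "openin (ray_space T r) A"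
    using cyl[OF t(1), of "{True}"] unfolding t(2) br_def by simp
  have "tree_rays T r - br t = {P \<in> tree_rays T r. (t \<in> P) \<in> {False}}" unfolding br_def by auto
  then show "closedin (ray_space T r) A"
    using cyl[OF t(1), of "{False}"] unfolding t(2) closedin_def topspace_ray_space
    by (auto simp: br_def)
next
  let ?f = "\<lambda>x. restrict (\<lambda>t. t \<in> x) T"
  let ?D = "product_topology (\<lambda>_. discrete_topology (UNIV :: bool set)) T"
  fix U x assume "openin (ray_space T r) U \<and> x \<in> U"
  then obtain W where W: "openin ?D W" "U = ?f -` W \<inter> tree_rays T r" "x \<in> U"
    unfolding ray_space_def openin_pullback_topology by blast
  then have "?f x \<in> W" by blast
  then obtain B where B: "finite {t \<in> T. B t \<noteq> UNIV}" "?f x \<in> Pi\<^sub>E T B" "Pi\<^sub>E T B \<subseteq> W"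
    using W(1) unfolding openin_product_topology_alt by force
  \<comment> \<open>The finitely many restricted coordinates: those in \<open>x\<close> become
    positive conditions, the others negative ones.\<close>
  define I where "I = {t \<in> T. B t \<noteq> UNIV}"
  have xr: "x \<in> tree_rays T r" using W by blast
  have "x \<in> topspace (ray_space T r) \<inter> \<Inter>(br ` (I \<inter> x)) - \<Union>(br ` (I - x))"
    using xr unfolding topspace_ray_space br_def by blast
  moreover have "topspace (ray_space T r) \<inter> \<Inter>(br ` (I \<inter> x)) - \<Union>(br ` (I - x)) \<subseteq> U"
  proof
    fix P assume P: "P \<in> topspace (ray_space T r) \<inter> \<Inter>(br ` (I \<inter> x)) - \<Union>(br ` (I - x))"
    then have Pr: "P \<in> tree_rays T r" unfolding topspace_ray_space by blast
    have same: "t \<in> P \<longleftrightarrow> t \<in> x" if "t \<in> I" for t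
      using P Pr that unfolding br_def by blast
    have "(t \<in> P) \<in> B t" if "t \<in> T" for t
    proof (cases "t \<in> I")
      case True
      then show ?thesis using same[OF True] PiE_mem[OF B(2) that] that by simp
    next
      case False
      then show ?thesis using that unfolding I_def by simp
    qed
    then have "?f P \<in> Pi\<^sub>E T B" by auto
    then show "P \<in> U" using B(3) W(2) Pr by blast
  qed
  moreover have "finite I" "I \<subseteq> T" using B(1) unfolding I_def by auto
  ultimately show "\<exists>F G. finite F \<and> finite G \<and> F \<subseteq> br ` T \<and> G \<subseteq> br ` T \<and>
      x \<in> topspace (ray_space T r) \<inter> \<Inter>F - \<Union>G \<and> topspace (ray_space T r) \<inter> \<Inter>F - \<Union>G \<subseteq> U"
    by (intro exI[of _ "br ` (I \<inter> x)"] exI[of _ "br ` (I - x)"] conjI finite_imageI image_mono) auto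
qed

lemma br_comparable: "P \<in> br s \<Longrightarrow> P \<in> br t \<Longrightarrow> (s, t) \<in> r \<or> (t, s) \<in> r"
  unfolding br_def using tree_rayD(3) by blast

lemma nested_br: "nested (br ` T)"
  unfolding nested_def using br_comparable br_mono by blast

text \<open>Once some ray \<open>P\<close> has entered the sequence, all later nodes lie on the
  chain \<open>P\<close>. Those below \<open>t n0\<close> have a least one, and its set of rays is
  the largest.\<close>

lemma noetherian_br: "noetherian (br ` T)"
  unfolding noetherian_def
proof (intro allI impI)
  fix A :: "nat \<Rightarrow> _" assume A: "range A \<subseteq> br ` T \<and> incseq A"
  then have inc: "A m \<subseteq> A n" if "m \<le> n" for m n using that by (simp add: incseqD)
  have "\<forall>n. \<exists>t. t \<in> T \<and> A n = br t" using A by blast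
  then obtain t where t: "\<And>n. t n \<in> T" "\<And>n. A n = br (t n)" by metis
  show "\<exists>N. \<forall>n\<ge>N. A n = A N"
  proof (cases "\<forall>n. A n = {}")
    case False
    then obtain n0 P where P: "P \<in> A n0" by blast
    have tP: "t n \<in> P" if "n \<ge> n0" for n using P inc[OF that] t(2) unfolding br_def by blast
    have Pr: "P \<in> tree_rays T r" using P t(2) unfolding br_def by blast
    let ?M = "{t n | n. n \<ge> n0 \<and> (t n, t n0) \<in> r}"
    have "\<exists>m\<in>?M. \<forall>s\<in>?M. (m, s) \<in> r"
      by (rule under_least[of _ "t n0"]) (use r_refl t(1) in blast)+
    then obtain n1 where n1: "n1 \<ge> n0" "(t n1, t n0) \<in> r"
        "\<And>n. n \<ge> n0 \<Longrightarrow> (t n, t n0) \<in> r \<Longrightarrow> (t n1, t n) \<in> r" by blast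
    have "A n \<subseteq> A n1" if n: "n \<ge> n1" for n
    proof -
      have "n \<ge> n0" using n n1(1) by simp
      have "(t n1, t n) \<in> r"
        using n1(3)[OF \<open>n \<ge> n0\<close>] tree_rayD(3)[OF Pr tP[OF \<open>n \<ge> n0\<close>] tP[OF order_refl]]
          r_trans[OF n1(2)] by blast
      then show ?thesis using br_mono t(2) by simp
    qed
    then show ?thesis using inc by (metis subset_antisym)
  qed simp
qed

text \<open>The nodes of the chain are cofinal in their down-closure \<open>P\<close>, which is a
  ray. A set \<open>br u\<close> that contains \<open>P\<close> has \<open>u\<close> below some node
  of the chain, so it contains a member of \<open>\<B>\<close> and even a strictly larger set than
  the next one.\<close>

lemma hereditarily_complete_br: "hereditarily_complete (ray_space T r) (br ` T)"
proof (rule hereditarily_completeI[OF clopen_subbase_br nested_br])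
  fix \<B> assume \<B>: "\<B> \<subseteq> br ` T" "\<B> \<noteq> {}" "{} \<notin> \<B>"
    and chain: "\<And>A B. A \<in> \<B> \<Longrightarrow> B \<in> \<B> \<Longrightarrow> A \<subseteq> B \<or> B \<subseteq> A"
    and nomin: "\<And>B. B \<in> \<B> \<Longrightarrow> \<exists>B'\<in>\<B>. B' \<subset> B"
  define M where "M = {t \<in> T. br t \<in> \<B>}"
  have comp: "(s, t) \<in> r \<or> (t, s) \<in> r" if "s \<in> M" "t \<in> M" for s t
  proof -
    have st: "br s \<in> \<B>" "br t \<in> \<B>" using that unfolding M_def by auto
    then have "br s \<noteq> {}" "br t \<noteq> {}" using \<B>(3) by metis+
    then obtain P where "P \<in> br s" "P \<in> br t" using chain[OF st] by blast
    then show ?thesis by (rule br_comparable)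
  qed
  have BM: "\<exists>t\<in>M. B = br t" if "B \<in> \<B>" for B using that \<B>(1) unfolding M_def by blast
  have above: "\<exists>t'\<in>M. (t, t') \<in> r \<and> t \<noteq> t' \<and> br t' \<subset> br t" if t: "t \<in> M" for t
  proof -
    obtain B' where B': "B' \<in> \<B>" "B' \<subset> br t" using nomin[of "br t"] t unfolding M_def by blast
    then obtain t' where t': "t' \<in> M" "B' = br t'" using BM by blast
    have "(t', t) \<notin> r" using br_mono[of t' t] B'(2) t'(2) by blast
    then show ?thesis using comp[OF t t'(1)] t' B'(2) r_refl t unfolding M_def by blast
  qed
  define P where "P = {s. \<exists>t\<in>M. (s, t) \<in> r}"
  have MP: "M \<subseteq> P" unfolding P_def M_def using r_refl by blast
  have Pr: "P \<in> tree_rays T r"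
    unfolding tree_rays_iff
  proof (intro conjI ballI allI impI)
    show "P \<noteq> {}" using BM \<B>(2) MP by blast
    show "P \<subseteq> T" unfolding P_def using r_T by blast
  next
    fix a b assume "a \<in> P" "b \<in> P"
    then obtain s t where st: "s \<in> M" "t \<in> M" "(a, s) \<in> r" "(b, t) \<in> r" unfolding P_def by blast
    then show "(a, b) \<in> r \<or> (b, a) \<in> r" using comp[OF st(1,2)] under_chain r_trans by metis
  next
    fix t s assume "t \<in> P" "(s, t) \<in> r"
    then show "s \<in> P" unfolding P_def using r_trans by blast
  next
    fix m assume "m \<in> P"
    then obtain t where t: "t \<in> M" "(m, t) \<in> r" unfolding P_def by blast
    obtain t' where t': "t' \<in> M" "(t, t') \<in> r" "t \<noteq> t'" using above[OF t(1)] by blast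
    have "m \<noteq> t'" using r_antisym[OF t'(2)] t(2) t'(3) by blast
    then show "\<exists>t\<in>P. (m, t) \<in> r \<and> t \<noteq> m" using r_trans[OF t(2) t'(2)] t'(1) MP by blast
  qed
  have "P \<in> \<Inter>\<B>" using BM MP Pr unfolding br_def by blast
  moreover have "\<not> A \<subseteq> \<Inter>\<B>" if A: "A \<in> br ` T" "P \<in> A" for A
  proof
    assume sub: "A \<subseteq> \<Inter>\<B>"
    obtain u where u: "A = br u" "u \<in> P" using A unfolding br_def by blast
    then obtain t where t: "t \<in> M" "(u, t) \<in> r" unfolding P_def by blast
    obtain t' where t': "t' \<in> M" "br t' \<subset> br t" using above[OF t(1)] by blast
    have "br t \<subseteq> A" using br_mono[OF t(2)] u(1) by simp
    moreover have "br t' \<in> \<B>" using t'(1) unfolding M_def by blast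
    ultimately show False using sub t'(2) by blast
  qed
  ultimately show "\<exists>e\<in>\<Inter>\<B>. \<forall>A\<in>br ` T. e \<in> A \<longrightarrow> \<not> A \<subseteq> \<Inter>\<B>" by (intro bexI[of _ P]) auto
qed

end

lemma special_tree_subbase:
  assumes "special_tree T r"
  shows "\<exists>\<A>. clopen_subbase (ray_space T r) \<A> \<and> nested \<A> \<and> noetherian \<A> \<and>
            hereditarily_complete (ray_space T r) \<A> \<and> sigma_disjoint \<A>"
proof -
  interpret otree T r by unfold_locales (use assms special_tree_def in blast)
  obtain A :: "nat \<Rightarrow> _" where A: "T = (\<Union>n. A n)" "\<And>n. order_antichain r (A n)"
    using assms unfolding special_tree_def by blast
  have "disjoint (br ` A n)" for n
    unfolding disjoint_def
  proof (intro ballI impI)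
    fix a b assume "a \<in> br ` A n" "b \<in> br ` A n" and ab: "a \<noteq> b"
    then obtain s t where st: "s \<in> A n" "t \<in> A n" "a = br s" "b = br t" by blast
    show "a \<inter> b = {}"
    proof (rule ccontr)
      assume "a \<inter> b \<noteq> {}"
      then have "(s, t) \<in> r \<or> (t, s) \<in> r" using br_comparable st(3,4) by blast
      then have "s = t" using A(2)[of n] st(1,2) unfolding order_antichain_def by metis
      then show False using ab st(3,4) by blast
    qed
  qed
  moreover have "br ` T = (\<Union>n. br ` A n)" using A(1) by blast
  ultimately have "sigma_disjoint (br ` T)"
    unfolding sigma_disjoint_def by (intro exI[of _ "\<lambda>n. br ` A n"]) simp
  then show ?thesis
    using clopen_subbase_br nested_br noetherian_br hereditarily_complete_br by blast
qed

section \<open>The graph on a special tree\<close>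

text \<open>A node below \<open>t\<close> with a neighbour strictly above \<open>t\<close> has smaller index than \<open>t\<close>, so there are only
  finitely many of them.\<close>

locale stree = otree +
  fixes idx :: "'a \<Rightarrow> nat"
  assumes idx: "(s, t) \<in> r \<Longrightarrow> s \<noteq> t \<Longrightarrow> idx s \<noteq> idx t"
begin

text \<open>A predecessor is visible if its index is a strict minimum among all nodes from it up to,
  but excluding, \<open>t\<close>. An immediate predecessor is always visible.\<close>

definition vis :: "'a \<Rightarrow> 'a \<Rightarrow> bool" where
  "vis s t \<longleftrightarrow> (s, t) \<in> r \<and> s \<noteq> t \<and>
     (\<forall>u. (s, u) \<in> r \<and> (u, t) \<in> r \<and> u \<noteq> s \<and> u \<noteq> t \<longrightarrow> idx s < idx u)"

definition TE :: "'a set set" where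
  "TE = {{s, t} | s t. vis s t}"

sublocale G: sgraph T TE
  by unfold_locales (auto simp: simple_graph_def TE_def vis_def dest: r_T)

lemma TE_cases: "{u, v} \<in> TE \<Longrightarrow> vis u v \<or> vis v u"
  unfolding TE_def by (auto simp: doubleton_eq_iff)

text \<open>The up-set is strict because at a limit level \<open>t\<close> itself may see infinitely
  many predecessors; neighbours of nodes beyond \<open>t\<close> are bounded by
  \<open>idx t\<close>.\<close>

definition Us :: "'a \<Rightarrow> 'a set" where
  "Us t = {u. (t, u) \<in> r \<and> u \<noteq> t}"

lemma nb_Us: "G.nb (Us t) \<subseteq> {s. (s, t) \<in> r \<and> (s = t \<or> idx s < idx t)}"
proof
  fix x assume "x \<in> G.nb (Us t)"
  then obtain c where c: "x \<notin> Us t" "(t, c) \<in> r" "c \<noteq> t" "{x, c} \<in> TE"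
    unfolding G.nb_def Us_def by blast
  have "\<not> vis c x"
  proof
    assume "vis c x"
    then have "(c, x) \<in> r" unfolding vis_def by blast
    then have "(t, x) \<in> r" "x \<noteq> t" using r_trans[OF c(2)] r_antisym[OF c(2)] c(3) by blast+
    then show False using c(1) unfolding Us_def by blast
  qed
  then have v: "vis x c" using TE_cases[OF c(4)] by blast
  then have xc: "(x, c) \<in> r" unfolding vis_def by blast
  have "(x, t) \<in> r" using under_chain[OF xc c(2)] c(1) r_refl r_T[OF c(2)] unfolding Us_def by blast
  moreover have "idx x < idx t" if "x \<noteq> t"
    using v calculation c(2,3) that unfolding vis_def by blast
  ultimately show "x \<in> {s. (s, t) \<in> r \<and> (s = t \<or> idx s < idx t)}" by blast
qed

lemma finite_nb_Us: "finite (G.nb (Us t))"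
proof -
  let ?B = "{s. (s, t) \<in> r \<and> (s = t \<or> idx s < idx t)}"
  have "inj_on idx ?B"
  proof (rule inj_onI)
    fix a b assume ab: "a \<in> ?B" "b \<in> ?B" "idx a = idx b"
    then have "(a, b) \<in> r \<or> (b, a) \<in> r" using under_chain[of a t b] by simp
    then show "a = b" using idx[of a b] idx[of b a] ab(3) by auto
  qed
  moreover have "idx ` ?B \<subseteq> {..idx t}" by auto
  ultimately have "finite ?B" using finite_imageD finite_subset by blast
  then show ?thesis using nb_Us finite_subset by blast
qed

text \<open>Among the nodes from \<open>t\<close> up to but excluding \<open>v\<close>, the one of
  least index is visible from \<open>v\<close> and lies in \<open>D\<close>; induction on
  \<open>v\<close> connects it to \<open>t\<close>.\<close>

lemma conn_convex:
  assumes D: "D \<subseteq> T" "t \<in> D" "\<And>v. v \<in> D \<Longrightarrow> (t, v) \<in> r"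
    and cvx: "\<And>a v. v \<in> D \<Longrightarrow> (t, a) \<in> r \<Longrightarrow> (a, v) \<in> r \<Longrightarrow> a \<in> D"
  shows "G.conn D"
proof (rule G.connI[OF D(1)])
  fix v assume "v \<in> D"
  then have "v \<in> T" using D(1) by blast
  then show "(t, v) \<in> (G.R D)\<^sup>*" using \<open>v \<in> D\<close>
  proof (induction v rule: tree_induct)
    case (less v)
    show ?case
    proof (cases "v = t")
      case False
      let ?I = "{s. (t, s) \<in> r \<and> (s, v) \<in> r \<and> s \<noteq> v}"
      have "t \<in> ?I" using D(2,3) less.prems False by blast
      then obtain s where s: "s \<in> ?I" "\<And>u. u \<in> ?I \<Longrightarrow> idx s \<le> idx u"
        using ex_has_least_nat[of "\<lambda>s. s \<in> ?I" t idx] by blast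
      have "vis s v"
        unfolding vis_def
      proof (intro conjI allI impI)
        fix u assume u: "(s, u) \<in> r \<and> (u, v) \<in> r \<and> u \<noteq> s \<and> u \<noteq> v"
        then have "u \<in> ?I" using s(1) r_trans by blast
        then have "idx s \<le> idx u" by (rule s(2))
        moreover have "idx s \<noteq> idx u" using idx[of s u] u by auto
        ultimately show "idx s < idx u" by simp
      qed (use s(1) in auto)
      then have "{s, v} \<in> TE" unfolding TE_def by blast
      moreover have "s \<in> D" using cvx[OF less.prems] s(1) by blast
      ultimately have "(t, s) \<in> (G.R D)\<^sup>*" "(s, v) \<in> (G.R D)\<^sup>*"
        using less.IH[of s] s(1) G.R_step less.prems by auto
      then show ?thesis by (rule rtrancl_trans)
    qed simp
  qed
qed

text \<open>The path of the tree that a graph ray follows; \<open>finite_nb_Us\<close> makes it an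
  invariant of the end.\<close>

definition limset :: "(nat \<Rightarrow> 'a) \<Rightarrow> 'a set" where
  "limset x = {t \<in> T. has_tail_in x (Us t)}"

section \<open>Ends of the graph correspond to rays of the tree\<close>

lemma tail_neq: "x \<in> G.rays \<Longrightarrow> has_tail_in x (- {t})"
  using G.ray_avoid[of x "{t}"] unfolding has_tail_in_def by blast

lemma limset_tree_ray:
  assumes x: "x \<in> G.rays"
  shows "limset x \<in> tree_rays T r"
  unfolding tree_rays_iff
proof (intro conjI ballI allI impI)
  obtain m where m: "m \<in> T" "\<And>s. s \<in> T \<Longrightarrow> (m, s) \<in> r" using tree_root by blast
  have "has_tail_in x (Us m)"
    by (rule has_tail_in_mono[OF has_tail_in_Int[OF tail_neq[OF x, of m], of T]])
      (use G.ray_inV[OF x] m(2) in \<open>auto simp: Us_def has_tail_in_def\<close>)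
  then show "limset x \<noteq> {}" unfolding limset_def using m by blast
  show "limset x \<subseteq> T" unfolding limset_def by blast
next
  fix a b assume "a \<in> limset x" "b \<in> limset x"
  then obtain n where "x n \<in> Us a" "x n \<in> Us b"
    using has_tail_in_ex[OF has_tail_in_Int] unfolding limset_def by blast
  then show "(a, b) \<in> r \<or> (b, a) \<in> r" using under_chain unfolding Us_def by blast
next
  fix t s assume ts: "t \<in> limset x" "(s, t) \<in> r"
  have "Us t \<subseteq> Us s" unfolding Us_def using r_trans[OF ts(2)] r_antisym[OF ts(2)] by blast
  then show "s \<in> limset x" using ts has_tail_in_mono r_T unfolding limset_def by blast
next
  fix t assume t: "t \<in> limset x"
  then obtain N where N: "x ` {N..} \<subseteq> Us t" unfolding limset_def has_tail_in_def by blast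
  \<comment> \<open>The least element \<open>u\<close> is the immediate successor of
    \<open>t\<close> towards the tail. No node lies strictly between, so the tail, which stays above
    \<open>t\<close>, cannot leave the up-set of \<open>u\<close>; hence \<open>t\<close> is not
    maximal in \<open>limset x\<close>.\<close>
  let ?I = "{v. (t, v) \<in> r \<and> v \<noteq> t \<and> (v, x N) \<in> r}"
  have xN: "x N \<in> Us t" using N by auto
  then have "x N \<in> ?I" using r_refl r_T unfolding Us_def by blast
  then have "\<exists>u\<in>?I. \<forall>s\<in>?I. (u, s) \<in> r" by (intro under_least[of _ "x N"]) auto
  then obtain u where u: "u \<in> ?I" "\<And>s. s \<in> ?I \<Longrightarrow> (u, s) \<in> r" by blast
  define U where "U = {v. (u, v) \<in> r}"
  have "z \<notin> Us t" if z: "z \<in> G.nb U" for z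
  proof
    assume zt: "z \<in> Us t"
    obtain c where c: "z \<notin> U" "(u, c) \<in> r" "{z, c} \<in> TE" using z unfolding G.nb_def U_def by blast
    show False using TE_cases[OF c(3)]
    proof
      assume "vis c z"
      then have "(u, z) \<in> r" using r_trans[OF c(2)] unfolding vis_def by blast
      then show False using c(1) unfolding U_def by blast
    next
      assume "vis z c"
      then have "(z, c) \<in> r" unfolding vis_def by blast
      then have "(z, u) \<in> r" using under_chain[OF _ c(2)] c(1) unfolding U_def by blast
      then have "z \<in> ?I" using zt r_trans u(1) unfolding Us_def by blast
      then show False using u(2) c(1) unfolding U_def by blast
    qed
  qed
  then have "x ` {N..} \<inter> G.nb U = {}" using N by blast
  moreover have "x ` {N..} \<inter> U \<noteq> {}" using u(1) unfolding U_def by auto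
  ultimately have "x ` {N..} \<subseteq> U" using G.conn_absorb[OF G.conn_ray_tail[OF x]] by blast
  then have "has_tail_in x U" unfolding has_tail_in_def by blast
  then have "has_tail_in x (Us u)"
    by (rule has_tail_in_mono[OF has_tail_in_Int[OF _ tail_neq[OF x, of u]]]) (auto simp: U_def Us_def)
  then have "u \<in> limset x" using u(1) r_T unfolding limset_def by blast
  then show "\<exists>u\<in>limset x. (t, u) \<in> r \<and> u \<noteq> t" using u(1) by blast
qed

text \<open>Choose \<open>t\<close> on the path above all of \<open>S\<close> that the path
  contains, and let \<open>D\<close> be the nodes above \<open>t\<close> that are not above any
  other vertex of \<open>S\<close>. This set is convex with least element \<open>t\<close>, hence
  connected; it avoids \<open>S\<close> and contains a tail of every ray in question.\<close>

lemma limset_side: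
  assumes x: "x \<in> G.rays" and S: "finite S"
  shows "\<exists>t\<in>limset x. \<forall>y\<in>G.rays. has_tail_in y (Us t) \<and> (\<forall>s\<in>S \<inter> T - limset x. \<not> has_tail_in y (Us s)) \<longrightarrow>
      G.side S y = G.side S x"
proof -
  let ?P = "limset x"
  note P = limset_tree_ray[OF x]
  obtain t where t: "t \<in> ?P" "\<And>s. s \<in> S \<inter> ?P \<Longrightarrow> (s, t) \<in> r \<and> s \<noteq> t"
    using finite_chain_above[OF P, of "S \<inter> ?P"] S by blast
  have tT: "t \<in> T" by (rule tree_rayD(2)[OF P t(1)])
  let ?S' = "S \<inter> T - ?P"
  define D where "D = {v. (t, v) \<in> r \<and> (\<forall>s\<in>?S'. (s, v) \<notin> r)}"
  have "t \<in> D" unfolding D_def using r_refl[OF tT] tree_rayD(4)[OF P t(1)] by blast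
  then have cD: "G.conn D"
  proof (intro conn_convex[of D t])
    show "D \<subseteq> T" unfolding D_def using r_T by blast
    show "(t, v) \<in> r" if "v \<in> D" for v using that unfolding D_def by simp
    show "a \<in> D" if "v \<in> D" "(t, a) \<in> r" "(a, v) \<in> r" for a v
      using that(1,2) r_trans[OF _ that(3)] unfolding D_def by blast
  qed
  have DS: "D \<inter> S = {}"
  proof (rule ccontr)
    assume "D \<inter> S \<noteq> {}"
    then obtain s where s: "s \<in> S" "(t, s) \<in> r" "\<forall>s'\<in>?S'. (s', s) \<notin> r" unfolding D_def by blast
    have "s \<in> T" using r_T[OF s(2)] by simp
    then have "s \<in> ?P" using r_refl[of s] s by auto
    then have "(s, t) \<in> r" "s \<noteq> t" using t(2)[of s] s(1) by auto
    then show False using r_antisym[OF s(2)] by simp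
  qed
  have sub: "D \<subseteq> G.side S y"
    if y: "y \<in> G.rays" "has_tail_in y (Us t)" "\<forall>s\<in>?S'. \<not> has_tail_in y (Us s)" for y
  proof -
    have "has_tail_in y {v. \<forall>s\<in>F. (s, v) \<notin> r}" if "finite F" "F \<subseteq> ?S'" for F
      using that
    proof (induction F rule: finite_induct)
      case empty
      then show ?case by (simp add: has_tail_in_def)
    next
      case (insert s F)
      have "\<not> frequently_in y (Us s)"
        using G.ray_finite_nb[OF y(1) finite_nb_Us] y(3) insert.prems by blast
      then have "has_tail_in y (- Us s)" using not_has_tail_in[of y "- Us s"] by simp
      then have "has_tail_in y (- Us s \<inter> - {s} \<inter> {v. \<forall>s\<in>F. (s, v) \<notin> r})"
        using insert.IH insert.prems tail_neq[OF y(1)] by (intro has_tail_in_Int) auto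
      then show ?case by (rule has_tail_in_mono) (auto simp: Us_def)
    qed
    then have "has_tail_in y (Us t \<inter> {v. \<forall>s\<in>?S'. (s, v) \<notin> r})"
      using S by (intro has_tail_in_Int y(2)) auto
    then have "has_tail_in y D" by (rule has_tail_in_mono) (auto simp: Us_def D_def)
    then show ?thesis by (intro G.side_absorb_freq[OF y(1) S cD DS] tail_frequently_in)
  qed
  have xD: "D \<subseteq> G.side S x" using t(1) by (intro sub x) (auto simp: limset_def)
  have "G.side S y = G.side S x"
    if y: "y \<in> G.rays" "has_tail_in y (Us t)" "\<forall>s\<in>?S'. \<not> has_tail_in y (Us s)" for y
    using G.comps_disjoint[OF G.side(1)[OF y(1) S] G.side(1)[OF x S]] sub[OF y] xD \<open>t \<in> D\<close> by blast
  then show ?thesis using t(1) by blast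
qed

lemma clopen_subbase_Us: "clopen_subbase (end_space T TE) (G.ends ` Us ` T)"
proof (rule G.clopen_subbase_ends)
  show "finite (G.nb U)" if "U \<in> Us ` T" for U using that finite_nb_Us by blast
  fix x and S :: "'a set" assume x: "x \<in> G.rays" and S: "finite S"
  obtain t where t: "t \<in> limset x" and tS: "\<And>y. y \<in> G.rays \<Longrightarrow> has_tail_in y (Us t) \<Longrightarrow>
      (\<forall>s\<in>S \<inter> T - limset x. \<not> has_tail_in y (Us s)) \<Longrightarrow> G.side S y = G.side S x"
    using limset_side[OF x S] by blast
  show "\<exists>F G. finite F \<and> finite G \<and> F \<subseteq> Us ` T \<and> G \<subseteq> Us ` T \<and>
      (\<forall>U\<in>F. has_tail_in x U) \<and> (\<forall>U\<in>G. \<not> has_tail_in x U) \<and>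
      (\<forall>y\<in>G.rays. (\<forall>U\<in>F. has_tail_in y U) \<and> (\<forall>U\<in>G. \<not> has_tail_in y U) \<longrightarrow> G.side S y = G.side S x)"
    using t tS S by (intro exI[of _ "{Us t}"] exI[of _ "Us ` (S \<inter> T - limset x)"]) (auto simp: limset_def)
qed

lemma limset_eqv:
  assumes x: "x \<in> G.rays" "y \<in> G.rays"
  shows "limset x = limset y \<longleftrightarrow> G.eqv x y"
proof
  assume eq: "limset x = limset y"
  have "G.side S x = G.side S y" if S: "finite S" for S
  proof -
    obtain t where t: "t \<in> limset y" "has_tail_in x (Us t) \<and> (\<forall>s\<in>S \<inter> T - limset y. \<not> has_tail_in x (Us s)) \<longrightarrow>
      G.side S x = G.side S y"
      using limset_side[OF x(2) S] x(1) by blast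
    then show ?thesis unfolding eq[symmetric] by (auto simp: limset_def)
  qed
  then show "G.eqv x y" unfolding G.eqv_def using x by blast
next
  assume e: "G.eqv x y"
  show "limset x = limset y"
    unfolding limset_def using G.eqv_tail[OF e finite_nb_Us] G.eqv_tail[OF G.eqv_sym[OF e] finite_nb_Us] by blast
qed

text \<open>Indices are injective on \<open>P\<close>, so \<open>P\<close> is countable. The parts
  of \<open>P\<close> above its first \<open>n\<close> elements in this enumeration are intervals,
  hence connected, and they shrink to nothing because \<open>P\<close> has no maximum.\<close>

lemma limset_surj:
  assumes P: "P \<in> tree_rays T r"
  shows "\<exists>x\<in>G.rays. limset x = P"
proof -
  obtain p0 where p0: "p0 \<in> P" using tree_rayD(1)[OF P] by blast
  define g where "g n = (if \<exists>t\<in>P. idx t = n then SOME t. t \<in> P \<and> idx t = n else p0)" for n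
  have gs: "g n \<in> P \<and> idx (g n) = n" if "\<exists>t\<in>P. idx t = n" for n
  proof -
    have "\<exists>t. t \<in> P \<and> idx t = n" using that by blast
    from someI_ex[OF this] show ?thesis using that unfolding g_def by simp
  qed
  have gP: "g n \<in> P" for n using gs[of n] p0 by (cases "\<exists>t\<in>P. idx t = n") (auto simp: g_def)
  have gi: "g (idx t) = t" if "t \<in> P" for t
    using gs[of "idx t"] that tree_rayD(3)[OF P] idx by metis
  define B where "B n = {v \<in> P. \<forall>i\<le>n. (g i, v) \<in> r}" for n
  have above: "\<exists>b\<in>P. \<forall>i\<le>n. (g i, b) \<in> r" for n
    using finite_chain_above[OF P, of "g ` {..n}"] gP by auto
  have "\<exists>x\<in>G.rays. \<forall>n. has_tail_in x (B n)"
  proof (rule G.decseq_conn_ray)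
    show "decseq B" unfolding decseq_def B_def by auto
    show "B n \<noteq> {}" for n using above[of n] unfolding B_def by blast
    show "\<exists>n. v \<notin> B n" for v
    proof (cases "v \<in> P")
      case True
      then obtain w where w: "w \<in> P" "(v, w) \<in> r" "w \<noteq> v" using tree_rayD(5)[OF P] by blast
      then have "(g (idx w), v) \<notin> r" using gi r_antisym by metis
      then have "v \<notin> B (idx w)" unfolding B_def by blast
      then show ?thesis by blast
    qed (auto simp: B_def)
    fix n
    obtain b where b: "b \<in> B n" using above[of n] unfolding B_def by blast
    have "\<exists>m\<in>{v. (v, b) \<in> r \<and> v \<in> B n}. \<forall>s\<in>{v. (v, b) \<in> r \<and> v \<in> B n}. (m, s) \<in> r"
      by (rule under_least[of _ b]) (use b r_refl tree_rayD(2)[OF P] in \<open>auto simp: B_def\<close>)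
    then obtain m where m: "m \<in> B n" "(m, b) \<in> r" "\<And>s. (s, b) \<in> r \<Longrightarrow> s \<in> B n \<Longrightarrow> (m, s) \<in> r" by blast
    have least: "(m, v) \<in> r" if v: "v \<in> B n" for v
      using tree_rayD(3)[OF P, of v b] v b m r_trans[OF m(2)] unfolding B_def by blast
    show "G.conn (B n)"
    proof (rule conn_convex[of _ m])
      show "B n \<subseteq> T" using tree_rayD(2)[OF P] unfolding B_def by blast
      fix a v assume "v \<in> B n" "(m, a) \<in> r" "(a, v) \<in> r"
      then show "a \<in> B n" using m(1) r_trans tree_rayD(4)[OF P] unfolding B_def by blast
    qed (use m least in auto)
  qed
  then obtain x where x: "x \<in> G.rays" "\<And>n. has_tail_in x (B n)" by blast
  have "limset x = P"
  proof (intro equalityI subsetI)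
    fix t assume "t \<in> limset x"
    then have "has_tail_in x (Us t \<inter> B 0)" using x(2) unfolding limset_def by (intro has_tail_in_Int) auto
    then obtain v where "v \<in> Us t" "v \<in> B 0" using has_tail_in_ex by blast
    then show "t \<in> P" using tree_rayD(4)[OF P] unfolding Us_def B_def by blast
  next
    fix t assume t: "t \<in> P"
    then obtain w where w: "w \<in> P" "(t, w) \<in> r" "w \<noteq> t" using tree_rayD(5)[OF P] by blast
    have "B (idx w) \<subseteq> Us t"
    proof
      fix v assume "v \<in> B (idx w)"
      then have "(w, v) \<in> r" using gi[OF w(1)] unfolding B_def by auto
      then show "v \<in> Us t" unfolding Us_def using r_trans[OF w(2)] r_antisym[OF w(2)] w(3) by blast
    qed
    then show "t \<in> limset x"
      unfolding limset_def using has_tail_in_mono[OF x(2)] tree_rayD(2)[OF P t] by blast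
  qed
  then show ?thesis using x(1) by blast
qed

lemma end_space_homeomorphic_ray_space: "end_space T TE homeomorphic_space ray_space T r"
proof -
  \<comment> \<open>Read off from the end itself, so that no representative ray has to be
    chosen.\<close>
  define f where "f \<omega> = {t \<in> T. \<omega> \<in> G.ends (Us t)}" for \<omega>
  have f: "f (G.cls x) = limset x" if "x \<in> G.rays" for x
    unfolding f_def limset_def using G.cls_in_ends[OF finite_nb_Us that] by simp
  have "bij_betw f (G.cls ` G.rays) (tree_rays T r)"
    unfolding bij_betw_def
  proof
    show "inj_on f (G.cls ` G.rays)"
    proof (rule inj_onI)
      fix a b assume ab: "a \<in> G.cls ` G.rays" "b \<in> G.cls ` G.rays" "f a = f b"
      then obtain x y where xy: "x \<in> G.rays" "y \<in> G.rays" "a = G.cls x" "b = G.cls y" by blast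
      then have "limset x = limset y" using ab(3) f by simp
      then show "a = b" using limset_eqv[OF xy(1,2)] G.cls_eq_iff[OF xy(1,2)] xy(3,4) by simp
    qed
    have "f ` G.cls ` G.rays = limset ` G.rays"
      unfolding image_image by (rule image_cong[OF refl f])
    also have "\<dots> = tree_rays T r"
    proof
      show "limset ` G.rays \<subseteq> tree_rays T r" using limset_tree_ray by blast
      show "tree_rays T r \<subseteq> limset ` G.rays"
      proof
        fix P assume "P \<in> tree_rays T r"
        then obtain x where "x \<in> G.rays" "limset x = P" using limset_surj by blast
        then show "P \<in> limset ` G.rays" by blast
      qed
    qed
    finally show "f ` G.cls ` G.rays = tree_rays T r" .
  qed
  moreover have "f ` G.ends (Us t) = br t" if t: "t \<in> T" for t
  proof (intro equalityI subsetI)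
    fix P assume "P \<in> f ` G.ends (Us t)"
    then obtain x where x: "x \<in> G.rays" "has_tail_in x (Us t)" "P = f (G.cls x)"
      unfolding G.ends_def by blast
    then show "P \<in> br t" unfolding br_def using f[OF x(1)] limset_tree_ray[OF x(1)] t by (simp add: limset_def)
  next
    fix P assume P: "P \<in> br t"
    then obtain x where x: "x \<in> G.rays" "limset x = P" using limset_surj unfolding br_def by blast
    then have "has_tail_in x (Us t)" using P unfolding br_def limset_def by blast
    then show "P \<in> f ` G.ends (Us t)" using f[OF x(1)] x unfolding G.ends_def by blast
  qed
  then have "image f ` G.ends ` Us ` T = br ` T" unfolding image_image by (rule image_cong[OF refl])
  ultimately show ?thesis
    by (intro homeomorphic_space_clopen_subbase[OF clopen_subbase_Us clopen_subbase_br])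
      (simp_all only: topspace_ray_space G.topspace_end_space)
qed

end

lemma special_tree_graph:
  assumes "special_tree T r"
  shows "\<exists>E. simple_graph T E \<and> end_space T E homeomorphic_space ray_space T r"
proof -
  obtain A :: "nat \<Rightarrow> _" where A: "T = (\<Union>n. A n)" "\<And>n. order_antichain r (A n)"
    using assms unfolding special_tree_def by blast
  interpret otree T r by unfold_locales (use assms special_tree_def in blast)
  define idx where "idx t = (LEAST n. t \<in> A n)" for t
  have idx: "t \<in> A (idx t)" if "t \<in> T" for t
    unfolding idx_def by (rule LeastI_ex) (use that A(1) in blast)
  interpret stree T r idx
  proof
    show "idx s \<noteq> idx t" if "(s, t) \<in> r" "s \<noteq> t" for s t
      using idx[of s] idx[of t] r_T[OF that(1)] that A(2)[of "idx t"] unfolding order_antichain_def by auto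
  qed
  show ?thesis using G.simple end_space_homeomorphic_ray_space by blast
qed

section \<open>From subbases to special trees\<close>

text \<open>The copies of a minimal member \<open>A\<close> precede the proper subsets of \<open>A\<close>, which thus become limit nodes:
  placing them above \<open>A\<close> beside its subsets would isolate the new ray.\<close>

locale subbased =
  fixes X :: "'a topology" and \<A> :: "'a set set"
  assumes hausdorff: "Hausdorff_space X" and sub: "clopen_subbase X \<A>" and nest: "nested \<A>"
    and noeth: "noetherian \<A>" and complete: "hereditarily_complete X \<A>" and disj: "sigma_disjoint \<A>"
begin

text \<open>The whole space is the root. The empty set is dropped because it is contained in
  incomparable members, so its predecessors would not form a chain.\<close>

definition \<F> :: "'a set set" where
  "\<F> = insert (topspace X) (\<A> - {{}})"

definition is_min :: "'a set \<Rightarrow> 'a \<Rightarrow> bool" where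
  "is_min A x \<longleftrightarrow> A \<in> \<F> \<and> x \<in> A \<and> (\<forall>B\<in>\<F>. x \<in> B \<longrightarrow> A \<subseteq> B)"

text \<open>Since the members separate points, at most one point has \<open>A\<close> as its
  smallest neighbourhood in \<open>\<F>\<close>; one sequence of copies per member is
  enough.\<close>

definition L :: "('a set \<times> nat) set" where
  "L = {(A, n). A \<in> \<F> \<and> (n = 0 \<or> (\<exists>x. is_min A x))}"

definition le :: "'a set \<times> nat \<Rightarrow> 'a set \<times> nat \<Rightarrow> bool" where
  "le a b \<longleftrightarrow> fst b \<subset> fst a \<or> (fst a = fst b \<and> snd a \<le> snd b)"

definition T :: "('a, 'b) ample set" where
  "T = Inr ` L"

definition r :: "('a, 'b) ample rel" where
  "r = {(Inr a, Inr b) | a b. a \<in> L \<and> b \<in> L \<and> le a b}"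

section \<open>The tree order on members and copies\<close>

lemma F_subset: "A \<in> \<F> \<Longrightarrow> A \<subseteq> topspace X"
  unfolding \<F>_def using clopen_subbaseD(3)[OF sub] by blast

lemma F_nested: "A \<in> \<F> \<Longrightarrow> B \<in> \<F> \<Longrightarrow> v \<in> A \<Longrightarrow> v \<in> B \<Longrightarrow> A \<subseteq> B \<or> B \<subseteq> A"
  using F_subset[of A] F_subset[of B] nestedD[OF nest, of A B v] unfolding \<F>_def by blast

lemma F_chain:
  assumes "A \<in> \<F>" "B \<in> \<F>" "C \<in> \<F>" "C \<subseteq> A" "C \<subseteq> B"
  shows "A \<subseteq> B \<or> B \<subseteq> A"
proof (cases "C = {}")
  case True
  then have "topspace X = {}" using assms(3) unfolding \<F>_def by blast
  then show ?thesis using F_subset assms(1,2) by blast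
next
  case False
  then show ?thesis using F_nested[OF assms(1,2)] assms(4,5) by blast
qed

lemma F_clopen: "A \<in> \<F> \<Longrightarrow> openin X A \<and> closedin X A"
  unfolding \<F>_def using clopen_subbaseD[OF sub] by auto

lemma sub_F: "clopen_subbase X \<F>"
  unfolding clopen_subbase_def
proof (intro conjI ballI allI impI)
  fix A assume "A \<in> \<F>"
  then show "openin X A" "closedin X A" using F_clopen by auto
next
  fix Y U assume Y: "topspace Y = topspace X \<and> (\<forall>A\<in>\<F>. openin Y A \<and> closedin Y A)" and U: "openin X U"
  have "openin Y A \<and> closedin Y A" if "A \<in> \<A>" for A
    using Y that unfolding \<F>_def by (cases "A = {}") auto
  then show "openin Y U" using sub U Y unfolding clopen_subbase_def by metis
qed

lemma wf_F: "wf {(B, A). B \<in> \<F> \<and> A \<in> \<F> \<and> A \<subset> B}"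
  unfolding wf_iff_no_infinite_down_chain
proof
  assume "\<exists>f. \<forall>i. (f (Suc i), f i) \<in> {(B, A). B \<in> \<F> \<and> A \<in> \<F> \<and> A \<subset> B}"
  then obtain f where f: "\<And>i. f (Suc i) \<in> \<F> \<and> f i \<in> \<F> \<and> f i \<subset> f (Suc i)" by auto
  have "f (Suc i) \<in> \<A>" for i
    using f[of i] f[of "Suc i"] F_subset[of "f (Suc (Suc i))"] unfolding \<F>_def by blast
  then have "range (\<lambda>i. f (Suc i)) \<subseteq> \<A>" by blast
  moreover have "incseq (\<lambda>i. f (Suc i))" by (rule incseq_SucI) (use f[of "Suc _"] in blast)
  ultimately have "\<exists>N. \<forall>n\<ge>N. f (Suc n) = f (Suc N)" 
    using noeth[unfolded noetherian_def, THEN spec, of "\<lambda>i. f (Suc i)"] by simp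
  then obtain N where "\<forall>n\<ge>N. f (Suc n) = f (Suc N)" by blast
  then have "f (Suc (Suc N)) = f (Suc N)" by (meson le_SucI order_refl)
  then show False using f[of "Suc N"] by blast
qed

lemma le_antisym: "le a b \<Longrightarrow> le b a \<Longrightarrow> a = b"
  unfolding le_def by (auto simp: prod_eq_iff)

lemma le_trans: "le a b \<Longrightarrow> le b c \<Longrightarrow> le a c"
  unfolding le_def by auto

lemma le_refl: "le a a"
  unfolding le_def by simp

lemma le_chain:
  assumes "a \<in> L" "b \<in> L" "c \<in> L" "le a c" "le b c" shows "le a b \<or> le b a"
proof -
  have "fst a \<in> \<F>" "fst b \<in> \<F>" "fst c \<in> \<F>" using assms unfolding L_def by auto
  then have "fst a \<subseteq> fst b \<or> fst b \<subseteq> fst a"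
    using F_chain[of "fst a" "fst b" "fst c"] assms(4,5) unfolding le_def by blast
  then show ?thesis unfolding le_def by auto
qed

lemma r_iff: "(Inr a, Inr b) \<in> r \<longleftrightarrow> a \<in> L \<and> b \<in> L \<and> le a b"
  unfolding r_def by blast

lemma r_cases: "(s, t) \<in> r \<Longrightarrow> \<exists>a b. s = Inr a \<and> t = Inr b \<and> a \<in> L \<and> b \<in> L \<and> le a b"
  unfolding r_def by blast

lemma wf_r: "wf (r - Id)"
proof (rule wf_subset)
  let ?lex = "{(B, A). B \<in> \<F> \<and> A \<in> \<F> \<and> A \<subset> B} <*lex*> less_than"
  show "wf (inv_image ?lex projr)"
    by (intro wf_inv_image wf_lex_prod wf_F wf_less_than)
  show "r - Id \<subseteq> inv_image ?lex projr"
  proof (rule subrelI)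
    fix s t assume st: "(s, t) \<in> r - Id"
    then obtain a b where ab: "s = Inr a" "t = Inr b" "a \<in> L" "b \<in> L" "le a b" using r_cases by blast
    have "a \<noteq> b" using st ab by blast
    moreover have "fst a \<in> \<F>" "fst b \<in> \<F>" using ab unfolding L_def by auto
    ultimately have "(a, b) \<in> ?lex"
      using ab(5) unfolding le_def by (cases a; cases b) auto
    then show "(s, t) \<in> inv_image ?lex projr" using ab(1,2) by simp
  qed
qed

lemma top_L: "(topspace X, 0) \<in> L"
  unfolding L_def \<F>_def by simp

lemma top_le: "b \<in> L \<Longrightarrow> le (topspace X, 0) b"
  unfolding L_def le_def using F_subset by (cases b) auto

lemma order_tree: "order_tree T r"
  unfolding order_tree_def
proof (intro conjI ballI)
  show "partial_order_on T r"
    unfolding order_on_defs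
  proof (intro conjI)
    show "r \<subseteq> T \<times> T" unfolding r_def T_def by blast
    show "refl_on T r" unfolding refl_on_def T_def by (auto simp: r_iff le_refl)
    show "trans r"
    proof (rule transI)
      fix s t u assume "(s, t) \<in> r" "(t, u) \<in> r"
      then show "(s, u) \<in> r" unfolding r_def using le_trans by auto
    qed
    show "antisym r"
    proof (rule antisymI)
      fix s t assume "(s, t) \<in> r" "(t, s) \<in> r"
      then show "s = t" unfolding r_def using le_antisym by auto
    qed
  qed
  show "\<exists>!m. m \<in> T \<and> (\<forall>s\<in>T. (s, m) \<in> r \<longrightarrow> s = m)"
  proof (rule ex1I[of _ "Inr (topspace X, 0)"])
    show "Inr (topspace X, 0) \<in> T \<and> (\<forall>s\<in>T. (s, Inr (topspace X, 0)) \<in> r \<longrightarrow> s = Inr (topspace X, 0))"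
    proof (intro conjI ballI impI)
      show "Inr (topspace X, 0) \<in> T" unfolding T_def using top_L by blast
      fix s assume "(s, Inr (topspace X, 0)) \<in> r"
      then obtain a where "s = Inr a" "a \<in> L" "le a (topspace X, 0)" unfolding r_def by blast
      then show "s = Inr (topspace X, 0)" using le_antisym top_le by blast
    qed
    fix m assume m: "m \<in> T \<and> (\<forall>s\<in>T. (s, m) \<in> r \<longrightarrow> s = m)"
    then obtain a where a: "m = Inr a" "a \<in> L" unfolding T_def by blast
    have "(Inr (topspace X, 0), m) \<in> r" unfolding a(1) r_iff using a(2) top_L top_le by blast
    moreover have "Inr (topspace X, 0) \<in> T" unfolding T_def using top_L by blast
    ultimately show "m = Inr (topspace X, 0)" using m by metis
  qed
  fix t assume "t \<in> T"
  show "well_order_on (underS r t) (Restr r (underS r t))"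
    unfolding order_on_defs
  proof (intro conjI)
    show "Restr r (underS r t) \<subseteq> underS r t \<times> underS r t" by blast
    show "refl_on (underS r t) (Restr r (underS r t))"
      unfolding refl_on_def underS_def using r_iff le_refl r_cases by blast
    have "trans r" "antisym r" using \<open>partial_order_on T r\<close> unfolding order_on_defs by auto
    then show "trans (Restr r (underS r t))" "antisym (Restr r (underS r t))"
      by (auto intro: trans_Restr antisym_Restr)
    show "total_on (underS r t) (Restr r (underS r t))"
      unfolding total_on_def
    proof (intro ballI impI)
      fix s u assume su: "s \<in> underS r t" "u \<in> underS r t" "s \<noteq> u"
      then obtain a b c where "s = Inr a" "u = Inr b" "t = Inr c" "a \<in> L" "b \<in> L" "c \<in> L" "le a c" "le b c"
        unfolding underS_def r_def by blast
      then have "(s, u) \<in> r \<or> (u, s) \<in> r" using le_chain r_iff by blast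
      then show "(s, u) \<in> Restr r (underS r t) \<or> (u, s) \<in> Restr r (underS r t)" using su(1,2) by blast
    qed
    show "wf (Restr r (underS r t) - Id)" by (rule wf_subset[OF wf_r]) blast
  qed
qed

lemma special: "special_tree (T :: ('a, 'b) ample set) r"
proof -
  obtain D :: "nat \<Rightarrow> _" where D: "\<A> = (\<Union>n. D n)" "\<And>n. disjoint (D n)"
    using disj unfolding sigma_disjoint_def by blast
  define D' where "D' n = (case n of 0 \<Rightarrow> {topspace X} | Suc k \<Rightarrow> D k - {{}})" for n
  have F: "\<F> = (\<Union>n. D' n)"
  proof (intro equalityI subsetI)
    fix A assume "A \<in> \<F>"
    then consider "A = topspace X" | "A \<in> \<A>" "A \<noteq> {}" unfolding \<F>_def by blast
    then show "A \<in> (\<Union>n. D' n)"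
    proof cases
      case 1
      then have "A \<in> D' 0" unfolding D'_def by simp
      then show ?thesis by blast
    next
      case 2
      then obtain k where "A \<in> D k" using D(1) by blast
      then have "A \<in> D' (Suc k)" using 2 unfolding D'_def by simp
      then show ?thesis by blast
    qed
  next
    fix A assume "A \<in> (\<Union>n. D' n)"
    then obtain n where "A \<in> D' n" by blast
    then show "A \<in> \<F>" using D(1) unfolding \<F>_def D'_def by (cases n) auto
  qed
  have anti: "\<not> B \<subset> A" if "A \<in> D' n" "B \<in> D' n" for A B n
  proof (cases n)
    case (Suc k)
    then have AB: "A \<in> D k" "B \<in> D k" "B \<noteq> {}" using that unfolding D'_def by auto
    show ?thesis using disjointD[OF D(2) AB(1,2)] AB(3) by blast
  qed (use that in \<open>auto simp: D'_def\<close>)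
  define K :: "nat \<Rightarrow> ('a, 'b) ample set" where "K k = {Inr (A, m) | A m. (A, m) \<in> L \<and> A \<in> D' (fst (prod_decode k)) \<and> m = snd (prod_decode k)}" for k
  have "(T :: ('a, 'b) ample set) = (\<Union>k. K k)"
  proof (intro equalityI subsetI)
    fix t :: "('a, 'b) ample" assume "t \<in> T"
    then obtain A m where t: "t = Inr (A, m)" "(A, m) \<in> L" unfolding T_def by auto
    then have "A \<in> \<F>" unfolding L_def by simp
    then obtain n where "A \<in> D' n" using F by blast
    then have "t \<in> K (prod_encode (n, m))" unfolding K_def using t by simp
    then show "t \<in> (\<Union>k. K k)" by blast
  next
    fix t :: "('a, 'b) ample" assume "t \<in> (\<Union>k. K k)"
    then show "t \<in> T" unfolding K_def T_def by blast
  qed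
  moreover have "order_antichain r (K k)" for k
    unfolding order_antichain_def
  proof (intro ballI impI)
    fix s t :: "('a, 'b) ample" assume st: "s \<in> K k" "t \<in> K k" "(s, t) \<in> r"
    then obtain A B m where AB: "s = Inr (A, m)" "t = Inr (B, m)"
        "A \<in> D' (fst (prod_decode k))" "B \<in> D' (fst (prod_decode k))"
      unfolding K_def by blast
    then have "le (A, m) (B, m)" using st(3) r_iff by blast
    then show "s = t" using anti[OF AB(3,4)] AB(1,2) unfolding le_def by simp
  qed
  ultimately show ?thesis unfolding special_tree_def using order_tree by blast
qed

section \<open>Points of the space as rays of the tree\<close>

definition ray_of :: "'a \<Rightarrow> ('a, 'b) ample set" where
  "ray_of x = {Inr (A, n) | A n. (A, n) \<in> L \<and> x \<in> A}"

lemma ray_of_iff: "Inr (A, n) \<in> ray_of x \<longleftrightarrow> (A, n) \<in> L \<and> x \<in> A"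
  unfolding ray_of_def by blast

lemma L_0: "A \<in> \<F> \<Longrightarrow> (A, 0) \<in> L"
  unfolding L_def by simp

lemma L_F: "(A, n) \<in> L \<Longrightarrow> A \<in> \<F>"
  unfolding L_def by simp

interpretation O: otree T r
  by unfold_locales (rule order_tree)

lemma ray_of_tree_ray:
  assumes x: "x \<in> topspace X"
  shows "ray_of x \<in> tree_rays T r"
  unfolding O.tree_rays_iff
proof (intro conjI ballI allI impI)
  show "ray_of x \<noteq> {}" unfolding ray_of_def using top_L x by blast
  show "ray_of x \<subseteq> T" unfolding ray_of_def T_def by blast
next
  fix a b :: "('a, 'b) ample" assume "a \<in> ray_of x" "b \<in> ray_of x"
  then obtain A n B m where ab: "a = Inr (A, n)" "b = Inr (B, m)" "(A, n) \<in> L" "(B, m) \<in> L" "x \<in> A" "x \<in> B"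
    unfolding ray_of_def by blast
  have "A \<subseteq> B \<or> B \<subseteq> A" by (rule F_nested[OF L_F[OF ab(3)] L_F[OF ab(4)] ab(5,6)])
  then have "le (A, n) (B, m) \<or> le (B, m) (A, n)" unfolding le_def by auto
  then show "(a, b) \<in> r \<or> (b, a) \<in> r" using ab r_iff by blast
next
  fix t s :: "('a, 'b) ample" assume t: "t \<in> ray_of x" "(s, t) \<in> r"
  then obtain B m where B: "t = Inr (B, m)" "x \<in> B" unfolding ray_of_def by blast
  then obtain A n where A: "s = Inr (A, n)" "(A, n) \<in> L" "le (A, n) (B, m)"
    using t(2) unfolding r_def by auto
  then have "x \<in> A" using B(2) unfolding le_def by auto
  then show "s \<in> ray_of x" unfolding A(1) ray_of_iff using A(2) by blast
next
  fix t :: "('a, 'b) ample" assume "t \<in> ray_of x"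
  then obtain A n where A: "t = Inr (A, n)" "(A, n) \<in> L" "x \<in> A" unfolding ray_of_def by blast
  show "\<exists>u\<in>ray_of x. (t, u) \<in> r \<and> u \<noteq> t"
  proof (cases "is_min A x")
    case True
    then have "(A, Suc n) \<in> L" using L_F[OF A(2)] unfolding L_def by blast
    moreover have "le (A, n) (A, Suc n)" unfolding le_def by simp
    ultimately show ?thesis using A by (intro bexI[of _ "Inr (A, Suc n)"]) (auto simp: r_iff ray_of_iff)
  next
    case False
    then obtain B where B: "B \<in> \<F>" "x \<in> B" "\<not> A \<subseteq> B" unfolding is_min_def using L_F A by blast
    then have "B \<subset> A" using F_nested[OF L_F[OF A(2)] B(1) A(3) B(2)] by blast
    then have "le (A, n) (B, 0)" unfolding le_def by simp
    then show ?thesis using A L_0[OF B(1)] B(2,3)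
      by (intro bexI[of _ "Inr (B, 0)"]) (auto simp: r_iff ray_of_iff)
  qed
qed

lemma ray_of_inj:
  assumes x: "x \<in> topspace X" "y \<in> topspace X" and eq: "(ray_of x :: ('a, 'b) ample set) = ray_of y"
  shows "x = y"
proof (rule ccontr)
  assume "x \<noteq> y"
  then obtain U W where UW: "openin X U" "openin X W" "x \<in> U" "y \<in> W" "disjnt U W"
    using hausdorff x unfolding Hausdorff_space_def by blast
  obtain F G where FG: "F \<subseteq> \<F>" "G \<subseteq> \<F>" "x \<in> topspace X \<inter> \<Inter>F - \<Union>G" "topspace X \<inter> \<Inter>F - \<Union>G \<subseteq> U"
    using sub_F UW(1,3) unfolding clopen_subbase_iff by metis
  have same: "x \<in> A \<longleftrightarrow> y \<in> A" if A: "A \<in> \<F>" for A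
    using ray_of_iff[of A 0 x, where ?'b = 'b] ray_of_iff[of A 0 y, where ?'b = 'b] eq L_0[OF A] by simp
  have "y \<in> A" if "A \<in> F" for A using same[of A] that FG(1,3) by auto
  moreover have "y \<notin> A" if "A \<in> G" for A using same[of A] that FG(2,3) by auto
  ultimately have "y \<in> topspace X \<inter> \<Inter>F - \<Union>G" using x(2) by simp
  then have "y \<in> U" by (rule subsetD[OF FG(4)])
  then show False using UW(4,5) unfolding disjnt_def by blast
qed

text \<open>A chain \<open>P\<close> without minimum has a point lying in no further member of the subbase: otherwise its
  intersection is open, and completeness fails on the complement.\<close>

lemma chain_point:
  assumes P: "P \<subseteq> \<F>" "P \<noteq> {}" and chain: "\<And>A B. A \<in> P \<Longrightarrow> B \<in> P \<Longrightarrow> A \<subseteq> B \<or> B \<subseteq> A"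
    and up: "\<And>A B. A \<in> P \<Longrightarrow> B \<in> \<F> \<Longrightarrow> A \<subseteq> B \<Longrightarrow> B \<in> P"
    and nomin: "\<And>A. A \<in> P \<Longrightarrow> \<exists>B\<in>P. B \<subset> A"
  shows "\<exists>x\<in>\<Inter>P. \<forall>B\<in>\<F>. x \<in> B \<longrightarrow> B \<in> P"
proof (rule ccontr)
  assume no: "\<not> ?thesis"
  have "openin X (\<Inter>P)"
  proof (subst openin_subopen, intro ballI)
    fix x assume x: "x \<in> \<Inter>P"
    then obtain B where B: "B \<in> \<F>" "x \<in> B" "B \<notin> P" using no by blast
    have "B \<subseteq> A" if A: "A \<in> P" for A
    proof -
      have "A \<in> \<F>" "x \<in> A" using A P(1) x by auto
      then have "A \<subseteq> B \<or> B \<subseteq> A" by (rule F_nested[OF _ B(1) _ B(2)])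
      then show ?thesis using up[OF A B(1)] B(3) by blast
    qed
    then have "B \<subseteq> \<Inter>P" by (rule Inter_greatest)
    then show "\<exists>U. openin X U \<and> x \<in> U \<and> U \<subseteq> \<Inter>P" using F_clopen[OF B(1)] B(2) by blast
  qed
  then have "closedin X (topspace X - \<Inter>P)" by blast
  then have cf: "complete_family {A \<inter> (topspace X - \<Inter>P) | A. A \<in> \<A>}"
    using complete unfolding hereditarily_complete_def by blast
  let ?Y = "topspace X - \<Inter>P"
  let ?D = "(\<lambda>A. A \<inter> ?Y) ` (P \<inter> \<A>)"
  have PA: "\<exists>B\<in>P \<inter> \<A>. B \<subset> A" if A: "A \<in> P" for A
  proof -
    obtain B where B: "B \<in> P" "B \<subset> A" using nomin[OF A] by blast
    have "A \<subseteq> topspace X" using F_subset A P(1) by blast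
    then have "B \<noteq> topspace X" using B(2) by blast
    then have "B \<in> \<A>" using B(1) P(1) unfolding \<F>_def by blast
    then show ?thesis using B by blast
  qed
  \<comment> \<open>A finite subfamily has a least set \<open>M\<close>; the chain goes on to a
    proper subset of \<open>M\<close>, and a point lost there is outside
    \<open>\<Inter>P\<close>.\<close>
  have cen: "centered ?D"
    unfolding centered_def
  proof (intro allI impI)
    fix \<E> assume E: "\<E> \<subseteq> ?D" "finite \<E> \<and> \<E> \<noteq> {}"
    then obtain Q where Q: "Q \<subseteq> P \<inter> \<A>" "finite Q" "\<E> = (\<lambda>A. A \<inter> ?Y) ` Q"
      using finite_subset_image[of \<E> "\<lambda>A. A \<inter> ?Y" "P \<inter> \<A>"] by blast
    have "\<exists>M\<in>Q. \<forall>A\<in>Q. M \<subseteq> A"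
      by (rule finite_chain_Min[OF Q(2)]) (use E Q chain in \<open>auto simp: subset_iff\<close>)
    then obtain M where M: "M \<in> Q" "\<forall>A\<in>Q. M \<subseteq> A" by (rule bexE)
    have MP: "M \<in> P" using M(1) Q(1) by blast
    obtain B where B: "B \<in> P" "B \<subset> M" using nomin[OF MP] by blast
    then obtain y where y: "y \<in> M" "y \<notin> B" by blast
    have "y \<in> ?Y" using y B(1) F_subset[of M] MP P(1) by auto
    then have "y \<in> \<Inter>\<E>" unfolding Q(3) using M(2) y(1) by auto
    then show "\<Inter>\<E> \<noteq> {}" by blast
  qed
  have Dsub: "?D \<subseteq> {A \<inter> ?Y | A. A \<in> \<A>}" by blast
  have Dne: "?D \<noteq> {}" using PA P(2) by blast
  have "\<Inter>?D \<noteq> {}"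
    by (rule cf[unfolded complete_family_def, rule_format, OF Dsub conjI[OF Dne cen]])
  then obtain y where y: "\<forall>A\<in>P \<inter> \<A>. y \<in> A \<inter> ?Y" by blast
  have "y \<in> A" if A: "A \<in> P" for A
  proof -
    obtain B where "B \<in> P \<inter> \<A>" "B \<subset> A" using PA[OF A] by (rule bexE)
    then show ?thesis using y by blast
  qed
  then have "y \<in> \<Inter>P" by (rule InterI)
  moreover obtain A where "A \<in> P" using P(2) by (meson ex_in_conv)
  then obtain B where "B \<in> P \<inter> \<A>" using PA by blast
  then have "y \<in> ?Y" using y by blast
  ultimately show False by simp
qed

text \<open>If the members occurring in \<open>P\<close> have no smallest one,
  \<open>chain_point\<close> provides the point. If \<open>A\<close> is the smallest, then
  \<open>P\<close>, having no maximum, contains arbitrarily high copies of \<open>A\<close>; copies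
  exist only when \<open>A\<close> is the smallest member around some point, which is the one
  sought.\<close>

lemma ray_of_surj:
  assumes P: "(P :: ('a, 'b) ample set) \<in> tree_rays T r"
  shows "\<exists>x\<in>topspace X. ray_of x = P"
proof -
  define Q where "Q = {A. \<exists>n. Inr (A, n) \<in> P}"
  have PL: "(A, n) \<in> L" if "Inr (A, n) \<in> P" for A n
    using O.tree_rayD(2)[OF P that] unfolding T_def by blast
  have QF: "Q \<subseteq> \<F>" unfolding Q_def using PL L_F by blast
  have down: "Inr a \<in> P" if "Inr b \<in> P" "a \<in> L" "le a b" for a b
  proof (rule O.tree_rayD(4)[OF P that(1)])
    show "(Inr a, Inr b) \<in> r" unfolding r_iff using that PL by (cases b) auto
  qed
  have chain: "A \<subseteq> B \<or> B \<subseteq> A" if "A \<in> Q" "B \<in> Q" for A B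
  proof -
    obtain n m where "Inr (A, n) \<in> P" "Inr (B, m) \<in> P" using \<open>A \<in> Q\<close> \<open>B \<in> Q\<close> unfolding Q_def by blast
    then have "le (A, n) (B, m) \<or> le (B, m) (A, n)" using O.tree_rayD(3)[OF P] r_iff by blast
    then show ?thesis unfolding le_def by auto
  qed
  have up: "B \<in> Q" if AB: "A \<in> Q" "B \<in> \<F>" "A \<subseteq> B" for A B
  proof (cases "A = B")
    case False
    obtain n where n: "Inr (A, n) \<in> P" using AB(1) unfolding Q_def by blast
    have "Inr (B, 0) \<in> P" by (rule down[OF n L_0[OF AB(2)]]) (use False AB(3) in \<open>auto simp: le_def\<close>)
    then show ?thesis unfolding Q_def by blast
  qed (use AB in simp)
  have "P \<noteq> {}" by (rule O.tree_rayD(1)[OF P])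
  then obtain t where "t \<in> P" by blast
  then have "Q \<noteq> {}" using O.tree_rayD(2)[OF P \<open>t \<in> P\<close>] unfolding T_def Q_def by auto
  have PT: "\<exists>A n. t = Inr (A, n) \<and> A \<in> Q" if "t \<in> P" for t
    using O.tree_rayD(2)[OF P that] that unfolding T_def Q_def by auto
  show ?thesis
  proof (cases "\<forall>A\<in>Q. \<exists>B\<in>Q. B \<subset> A")
    case True
    then have "\<exists>x\<in>\<Inter>Q. \<forall>B\<in>\<F>. x \<in> B \<longrightarrow> B \<in> Q"
      by (intro chain_point[OF QF \<open>Q \<noteq> {}\<close> chain up]) auto
    then obtain x where x: "x \<in> \<Inter>Q" "\<forall>B\<in>\<F>. x \<in> B \<longrightarrow> B \<in> Q" by (rule bexE)
    have "ray_of x = P"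
    proof (intro equalityI subsetI)
      fix t :: "('a, 'b) ample" assume "t \<in> ray_of x"
      then obtain B n where B: "t = Inr (B, n)" "(B, n) \<in> L" "x \<in> B" unfolding ray_of_def by blast
      then have "B \<in> Q" using x(2) L_F by blast
      then obtain A where A: "A \<in> Q" "A \<subset> B" using True by blast
      then obtain k where "Inr (A, k) \<in> P" unfolding Q_def by blast
      then show "t \<in> P" unfolding B(1) by (rule down[OF _ B(2)]) (use A in \<open>simp add: le_def\<close>)
    next
      fix t assume t: "t \<in> P"
      then obtain A n where A: "t = Inr (A, n)" "A \<in> Q" using PT by blast
      have "(A, n) \<in> L" "x \<in> A" using PL t A x(1) by auto
      then show "t \<in> ray_of x" unfolding A(1) ray_of_iff by blast
    qed
    moreover have "x \<in> topspace X" using x(1) \<open>Q \<noteq> {}\<close> QF F_subset by blast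
    ultimately show ?thesis by blast
  next
    case False
    then obtain A where "A \<in> Q" and min: "\<forall>B\<in>Q. \<not> B \<subset> A" by blast
    then have A: "A \<in> Q" "\<And>B. B \<in> Q \<Longrightarrow> A \<subseteq> B" using chain[of A] by blast+
    have suc: "\<exists>m>n. Inr (A, m) \<in> P" if n: "Inr (A, n) \<in> P" for n
    proof -
      obtain u where u: "u \<in> P" "(Inr (A, n), u) \<in> r" "u \<noteq> Inr (A, n)" using O.tree_rayD(5)[OF P n] by blast
      obtain B m where B: "u = Inr (B, m)" "B \<in> Q" using PT[OF u(1)] by blast
      have "le (A, n) (B, m)" using u(2) B(1) r_iff by blast
      then have "B = A \<and> n \<le> m" using A(2)[OF B(2)] unfolding le_def by auto
      then show ?thesis using u B(1) by (intro exI[of _ m]) (auto simp: le_less)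
    qed
    obtain n0 where n0: "Inr (A, n0) \<in> P" using A(1) unfolding Q_def by blast
    obtain m where m: "m > n0" "Inr (A, m) \<in> P" using suc[OF n0] by blast
    then obtain x where x: "is_min A x" using PL[OF m(2)] unfolding L_def by auto
    have AL: "(A, n) \<in> L" for n using x L_F[OF PL[OF m(2)]] unfolding L_def by blast
    have all: "Inr (A, n) \<in> P" for n
    proof -
      have "\<exists>k\<ge>n. Inr (A, k) \<in> P"
      proof (induction n)
        case 0
        then show ?case using n0 by blast
      next
        case (Suc n)
        then obtain k where k: "k \<ge> n" "Inr (A, k) \<in> P" by blast
        then obtain l where "l > k" "Inr (A, l) \<in> P" using suc by blast
        then show ?case using k(1) by (intro exI[of _ l]) simp
      qed
      then obtain k where k: "k \<ge> n" "Inr (A, k) \<in> P" by blast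
      show ?thesis by (rule down[OF k(2) AL]) (use k(1) in \<open>simp add: le_def\<close>)
    qed
    have "ray_of x = P"
    proof (intro equalityI subsetI)
      fix t :: "('a, 'b) ample" assume "t \<in> ray_of x"
      then obtain B n where B: "t = Inr (B, n)" "(B, n) \<in> L" "x \<in> B" unfolding ray_of_def by blast
      then have "A \<subseteq> B" using x L_F unfolding is_min_def by blast
      show "t \<in> P"
      proof (cases "A = B")
        case True
        then show ?thesis using all B(1) by simp
      next
        case False
        then show ?thesis unfolding B(1)
          by (intro down[OF n0 B(2)]) (use \<open>A \<subseteq> B\<close> in \<open>auto simp: le_def\<close>)
      qed
    next
      fix t assume t: "t \<in> P"
      then obtain B n where B: "t = Inr (B, n)" "B \<in> Q" using PT by blast
      have "x \<in> B" using A(2)[OF B(2)] x unfolding is_min_def by blast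
      moreover have "(B, n) \<in> L" using PL t B(1) by simp
      ultimately show "t \<in> ray_of x" unfolding B(1) ray_of_iff by blast
    qed
    moreover have "x \<in> topspace X" using x F_subset unfolding is_min_def by blast
    ultimately show ?thesis by blast
  qed
qed

lemma homeomorphic_ray_space: "X homeomorphic_space ray_space (T :: ('a, 'b) ample set) r"
proof (rule homeomorphic_space_clopen_subbase[OF sub_F O.clopen_subbase_br])
  show "bij_betw (ray_of :: 'a \<Rightarrow> ('a, 'b) ample set) (topspace X) (topspace (ray_space T r))"
    unfolding bij_betw_def O.topspace_ray_space
  proof
    show "inj_on (ray_of :: 'a \<Rightarrow> ('a, 'b) ample set) (topspace X)" by (rule inj_onI) (rule ray_of_inj)
    show "(ray_of :: 'a \<Rightarrow> ('a, 'b) ample set) ` topspace X = tree_rays T r"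
    proof
      show "(ray_of :: 'a \<Rightarrow> ('a, 'b) ample set) ` topspace X \<subseteq> tree_rays T r"
        using ray_of_tree_ray by blast
      show "tree_rays T r \<subseteq> (ray_of :: 'a \<Rightarrow> ('a, 'b) ample set) ` topspace X"
      proof
        fix P :: "('a, 'b) ample set" assume "P \<in> tree_rays T r"
        then obtain x where "x \<in> topspace X" "ray_of x = P" using ray_of_surj by blast
        then show "P \<in> ray_of ` topspace X" by blast
      qed
    qed
  qed
  \<comment> \<open>All copies of a member yield the same set of rays, so the copies do not enlarge
    the subbase.\<close>
  have im: "ray_of ` A = O.br (Inr (A, n) :: ('a, 'b) ample)" if An: "(A, n) \<in> L" for A n
  proof (intro equalityI subsetI)
    fix P :: "('a, 'b) ample set" assume "P \<in> ray_of ` A"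
    then obtain x where x: "x \<in> A" "P = ray_of x" by blast
    have "x \<in> topspace X" using x(1) F_subset[OF L_F[OF An]] by blast
    then show "P \<in> O.br (Inr (A, n))"
      unfolding O.br_def x(2) using ray_of_tree_ray ray_of_iff An x(1) by blast
  next
    fix P assume P: "P \<in> O.br (Inr (A, n) :: ('a, 'b) ample)"
    then obtain x where "ray_of x = P" using ray_of_surj unfolding O.br_def by blast
    then show "P \<in> ray_of ` A" using P ray_of_iff[of A n x] unfolding O.br_def by blast
  qed
  show "image (ray_of :: 'a \<Rightarrow> ('a, 'b) ample set) ` \<F> = O.br ` T"
  proof (intro equalityI subsetI)
    fix B assume "B \<in> image (ray_of :: 'a \<Rightarrow> ('a, 'b) ample set) ` \<F>"
    then obtain A where A: "A \<in> \<F>" "B = ray_of ` A" by blast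
    have "(Inr (A, 0) :: ('a, 'b) ample) \<in> T" unfolding T_def using L_0[OF A(1)] by blast
    then show "B \<in> O.br ` T" unfolding A(2) im[OF L_0[OF A(1)]] by blast
  next
    fix B assume "B \<in> O.br ` (T :: ('a, 'b) ample set)"
    then obtain A n where A: "(A, n) \<in> L" "B = O.br (Inr (A, n) :: ('a, 'b) ample)" unfolding T_def by auto
    then show "B \<in> image ray_of ` \<F>" using im[OF A(1)] L_F[OF A(1)] by blast
  qed
qed

end

theorem mainTheorem1:
  fixes X :: "'a topology"
  assumes "Hausdorff_space X"
  shows
    "((\<exists>(V :: ('a, 'v) ample set) E. simple_graph V E \<and> X homeomorphic_space end_space V E)
        \<longleftrightarrow>
      (\<exists>(T :: ('a, 't) ample set) r. special_tree T r \<and> X homeomorphic_space ray_space T r))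
     \<and>
     ((\<exists>(T :: ('a, 't) ample set) r. special_tree T r \<and> X homeomorphic_space ray_space T r)
        \<longleftrightarrow>
      (\<exists>\<A>. clopen_subbase X \<A> \<and> nested \<A> \<and> noetherian \<A> \<and>
            hereditarily_complete X \<A> \<and> sigma_disjoint \<A>))"
    (is "(?graph \<longleftrightarrow> ?tree) \<and> (_ \<longleftrightarrow> ?subbase)")
proof -
  \<comment> \<open>The type variable \<open>'b\<close> does not occur in the theorem, so the fact
    is polymorphic: it supplies trees over \<open>'t\<close> as well as over \<open>'v\<close>, and
    in the latter case the nodes become the vertices of the graph.\<close>
  have trees: "\<exists>(T :: ('a, 'b) ample set) r. special_tree T r \<and> X homeomorphic_space ray_space T r"
    if subbase: ?subbase
  proof -
    obtain \<A> where "clopen_subbase X \<A>" "nested \<A>" "noetherian \<A>" "hereditarily_complete X \<A>" "sigma_disjoint \<A>"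
      using subbase by blast
    then interpret subbased X \<A> by unfold_locales (use assms in auto)
    show ?thesis using special homeomorphic_ray_space by blast
  qed
  have 12: ?subbase if graph: ?graph
  proof -
    obtain V :: "('a, 'v) ample set" and E where VE: "simple_graph V E" "X homeomorphic_space end_space V E"
      using graph by blast
    interpret sgraph V E by unfold_locales (rule VE(1))
    show ?thesis
      by (rule good_subbase_homeomorphic[OF VE(2) clopen_subbase_ends_fam nested_ends_fam
            noetherian_ends_fam hereditarily_complete_ends_fam sigma_disjoint_ends_fam])
  qed
  have 23: ?subbase if tree: ?tree
  proof -
    obtain T :: "('a, 't) ample set" and r where T: "special_tree T r" "X homeomorphic_space ray_space T r"
      using tree by blast
    obtain \<A> where "clopen_subbase (ray_space T r) \<A>" "nested \<A>" "noetherian \<A>"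
        "hereditarily_complete (ray_space T r) \<A>" "sigma_disjoint \<A>"
      using special_tree_subbase[OF T(1)] by blast
    then show ?thesis by (rule good_subbase_homeomorphic[OF T(2)])
  qed
  have 31: ?graph if subbase: ?subbase
  proof -
    obtain T :: "('a, 'v) ample set" and r where T: "special_tree T r" "X homeomorphic_space ray_space T r"
      using trees[OF subbase] by blast
    obtain E where "simple_graph T E" "end_space T E homeomorphic_space ray_space T r"
      using special_tree_graph[OF T(1)] by blast
    then show ?thesis using T(2) homeomorphic_space_sym homeomorphic_space_trans by blast
  qed
  show ?thesis using 12 23 31 trees by blast
qed

end
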